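(* Let $1\le k\le n$, and let $\beta_k\in\mathrm{Hom}_{\mathbf{Web}_q(\mathfrak{sp}_{2n})}(1\otimes k,k\otimes 1)$ be the crossing in which the strand labelled $1$ goes from bottom left to top right and passes under the strand labelled $k$, which goes from bottom right to top left. Then $$(-1)^k\beta_k=I_{k+1}-q^{-1}H_{k-1}-\frac{q^{n-k+1}}{[n-k+1]}\,I_{k-1},$$ where $I_j$ and $H_j$ are the following webs $1\otimes k\to k\otimes 1$ (bottom endpoints labelled $1,k$ and top endpoints labelled $k,1$, from left to right): in $I_j$ the two bottom endpoints are joined at a trivalent vertex, the two top endpoints are joined at a trivalent vertex, and these two vertices are connected by a (vertical) edge labelled $j$; in $H_j$ the two left endpoints are joined at a trivalent vertex, the two right endpoints are joined at a trivalent vertex, and these two vertices are connected by a (horizontal) edge labelled $j$. The same relation consequently holds locally in $C_n$ skein algebras.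
   Context: **Ground ring.** $n\ge1$, and $\mathcal R$ is a commutative unital integral domain containing an invertible element $q$ such that $[k]$ is invertible in $\mathcal R$ for $k=1,\dots,n$. Here $[m]=\frac{q^m-q^{-m}}{q-q^{-1}}$ is understood as a Laurent polynomial in $q$, evaluated at $q\in\mathcal R$ (so $[0]=0$). **Webs.** A flat $C_n$ web is a planar unoriented graph, all of whose interior vertices are trivalent (vertex-free loops and the empty web are allowed), with edges labelled by elements of $\{1,\dots,n\}$, such that the three edges at each vertex are labelled $1,k,k+1$ for some $1\le k\le n-1$ (in either cyclic order). Conventions: edges labelled $0$ are erased, and a diagram containing an edge with label $>n$ or $<0$ is zero. Webs drawn in a strip with endpoints on the bottom and top lines are read from bottom to top. $\mathbf{Web}_q(\mathfrak{sp}_{2n})$ is the pivotal $\mathcal R$-linear category whose objects are finite tensor products of the self-dual objects $1,\dots,n$ and whose morphisms are $\mathcal R$-linear combinations of flat webs up to planar isotopy, modulo the local relations: (a) a circle labelled $1$ equals $-\frac{[n][2n+2]}{[n+1]}$ (a Laurent polynomial in $q$, namely $-[n](q^{n+1}+q^{-n-1})$); (b) a web containing an edge labelled $2$ one end of which is a vertex whose two other half-edges are joined by an arc labelled $1$ bounding a disk (a lollipop) is $0$; (c) the bigon in which an edge labelled $k$ splits into parallel edges labelled $1$ (left) and $k-1$ (right), which merge again to an edge labelled $k$, equals $[k]$ times the single edge labelled $k$; (d) the two webs $1\otimes k\otimes 1\to k+2$, merging the first two strands into $k+1$ and then merging with the third, or merging the last two strands into $k+1$ and then merging with the first, are equal;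 (e) in $\mathrm{Hom}(k\otimes k,1\otimes 1)$, $1\le k\le n$: $H'_{k+1}=Y-\frac{[n-k]}{[n-k+1]}H'_{k-1}+\frac{[n-k]}{[n]}C$, where $H'_j$ is the web in which the two left endpoints (bottom $k$, top $1$) meet at a vertex, the two right endpoints (bottom $k$, top $1$) meet at a vertex, and these two vertices are joined by an edge labelled $j$; $Y$ is the web in which the two top endpoints meet at a vertex with an edge labelled $2$, the other end of this edge is a vertex with two edges labelled $1$, the left (right) one of which ends at a vertex on the edge from the bottom left (right) endpoint, and these last two vertices are joined by an edge labelled $k-1$; $C$ consists of an arc labelled $k$ joining the bottom endpoints and an arc labelled $1$ joining the top endpoints. **Crossings.** The crossing $\beta_1$ of two strands labelled $1$ in which the strand from bottom right to top left is over is defined as $\beta_1=q^{-1}\,\mathrm{Id}+\frac{q^{n}}{[n]}U-V$ (its inverse, with the other strand over, is $q\,\mathrm{Id}+\frac{q^{-n}}{[n]}U-V$). Here $\mathrm{Id}$ is the identity web of $1\otimes 1$, $U$ is the cup-cap web (arc joining the bottom endpoints, arc joining the top endpoints), and $V$ merges the two bottom strands into an edge labelled $2$ which splits again into the two top strands. For $1\le k\le n-1$, $\beta_{k+1}$ is defined inductively by splitting the strand labelled $k+1$ into parallel strands labelled $1$ and $k$: $$\beta_{k+1}=\frac1{[k+1]}\,(m_{1,k}\otimes\mathrm{id}_1)\circ(\mathrm{id}_1\otimes\beta_k)\circ(\beta_1\otimes\mathrm{id}_k)\circ(\mathrm{id}_1\otimes s_{1,k}),$$ where $m_{1,k}:1\otimes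 k\to k+1$ and $s_{1,k}:k+1\to 1\otimes k$ are the single-vertex webs. **Skein algebras.** The $C_n$ skein algebra of an oriented surface $\Sigma$ is spanned over $\mathcal R$ by isotopy classes of closed ribbon $C_n$ webs in $\Sigma\times(0,1)$ modulo the following relations applied locally: the defining local relations (a)–(e) of $\mathbf{Web}_q(\mathfrak{sp}_{2n})$ (circle, lollipop, bigon, associativity, and the relation expressing $H'_{k+1}$ through $Y$, $H'_{k-1}$ and $C$); the formulas $q^{-1}\,\mathrm{Id}+\frac{q^{n}}{[n]}U-V$ for the crossing $\beta_1$ of two strands labelled $1$ and $q\,\mathrm{Id}+\frac{q^{-n}}{[n]}U-V$ for its inverse; and the inductive formula defining $\beta_{k+1}$ from $\beta_k$ and $\beta_1$ by splitting the strand labelled $k+1$ into strands labelled $1$ and $k$ and dividing by $[k+1]$ (crossings of strands labelled $l+1,k+1$ with general $l$ being defined by similarly splitting both strands, into $l,1$ and $k,1$, and dividing by $[l+1][k+1]$). *)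

theory Defs
  imports "HOL-Complex_Analysis.Complex_Analysis" "HOL-Library.Poly_Mapping" "HOL-Library.Multiset"
begin

section \<open>Quantum integers in a commutative ring\<close>

definition unit_inv :: "'r::comm_ring_1 \<Rightarrow> 'r" where
  "unit_inv x = (THE y. x * y = 1)"

definition qpow :: "'r::comm_ring_1 \<Rightarrow> int \<Rightarrow> 'r" where
  "qpow q m = (if m \<ge> 0 then q ^ nat m else unit_inv q ^ nat (- m))"

text \<open>The Laurent polynomial $[m] = q^{m-1} + q^{m-3} + \dots + q^{1-m}$ evaluated at \<open>q\<close>; it makes
  sense also when $q - q^{-1}$ is not invertible.\<close>

definition qint :: "'r::comm_ring_1 \<Rightarrow> nat \<Rightarrow> 'r" where
  "qint q m = (\<Sum>i<m. qpow q (int m - 1 - 2 * int i))"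

lemma unit_inv_right:
  fixes x :: "'r::comm_ring_1"
  assumes "x dvd 1"
  shows "x * unit_inv x = 1"
proof -
  obtain y where y: "x * y = 1"
    using assms by (metis dvdE)
  have "z = y" if "x * z = 1" for z
    using that y by (metis mult.assoc mult.commute mult_1)
  with y have "(THE y. x * y = 1) = y"
    by blast
  with y show ?thesis
    by (simp add: unit_inv_def)
qed

section \<open>Formal linear combinations of web diagrams\<close>

text \<open>
  Morphism expressions of a strict pivotal linear category on self-dual generating objects (the
  labels).  Diagrams are read from bottom to top: \<open>t \<^bold>\<circ> s\<close> is \<open>t\<close> on top of \<open>s\<close>, and
  \<open>s \<^bold>\<otimes> t\<close> is \<open>s\<close> to the left of \<open>t\<close>.  \<open>Merge a b c\<close> is a single vertex with two bottom endpoints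
  \<open>a, b\<close> and top endpoint \<open>c\<close>; \<open>Split a b c\<close> is a single vertex with bottom endpoint \<open>c\<close> and top
  endpoints \<open>a, b\<close>.  \<open>Cross p a b\<close> is a crossing with bottom endpoints \<open>a, b\<close> and top endpoints
  \<open>b, a\<close>; \<open>p\<close> tells whether the strand \<open>a\<close>, which goes from bottom left to top right, passes under
  or over the strand \<open>b\<close>.  Flat webs contain no \<open>Cross\<close>.
\<close>

datatype position = Under | Over

datatype 'r web =
    Strands "nat list"
  | Cup nat
  | Cap nat
  | Merge nat nat nat
  | Split nat nat nat
  | Cross position nat nat
  | Comp "'r web" "'r web"  (infixr "\<^bold>\<circ>" 70)
  | Tens "'r web" "'r web"  (infixr "\<^bold>\<otimes>" 75)
  | Zero "nat list" "nat list"
  | Add "'r web" "'r web"   (infixl "\<^bold>+" 60)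
  | Scale 'r "'r web"       (infixr "\<^bold>*" 65)

definition admissible :: "nat \<Rightarrow> nat \<Rightarrow> nat \<Rightarrow> nat \<Rightarrow> bool" where
  "admissible n a b c \<longleftrightarrow> (\<exists>k\<in>{1..<n}. {#a, b, c#} = {#1, k, k + 1#})"

text \<open>\<open>web_in K n t a b\<close>: the expression \<open>t\<close> is a morphism from the tensor product \<open>a\<close> to the tensor
  product \<open>b\<close>; crossings are permitted only if \<open>K\<close> holds.\<close>

inductive web_in :: "bool \<Rightarrow> nat \<Rightarrow> 'r web \<Rightarrow> nat list \<Rightarrow> nat list \<Rightarrow> bool" for K n where
  "set a \<subseteq> {1..n} \<Longrightarrow> web_in K n (Strands a) a a"
| "k \<in> {1..n} \<Longrightarrow> web_in K n (Cup k) [] [k, k]"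
| "k \<in> {1..n} \<Longrightarrow> web_in K n (Cap k) [k, k] []"
| "admissible n a b c \<Longrightarrow> web_in K n (Merge a b c) [a, b] [c]"
| "admissible n a b c \<Longrightarrow> web_in K n (Split a b c) [c] [a, b]"
| "K \<Longrightarrow> a \<in> {1..n} \<Longrightarrow> b \<in> {1..n} \<Longrightarrow> web_in K n (Cross p a b) [a, b] [b, a]"
| "web_in K n s a b \<Longrightarrow> web_in K n t b c \<Longrightarrow> web_in K n (t \<^bold>\<circ> s) a c"
| "web_in K n s a b \<Longrightarrow> web_in K n t c d \<Longrightarrow> web_in K n (s \<^bold>\<otimes> t) (a @ c) (b @ d)"
| "set a \<union> set b \<subseteq> {1..n} \<Longrightarrow> web_in K n (Zero a b) a b"
| "web_in K n s a b \<Longrightarrow> web_in K n t a b \<Longrightarrow> web_in K n (s \<^bold>+ t) a b"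
| "web_in K n s a b \<Longrightarrow> web_in K n (r \<^bold>* s) a b"

text \<open>
  Equality of morphisms in the pivotal linear category presented by the relations \<open>R\<close>.  Planar
  isotopy of webs is encoded by the axioms of a strict pivotal category: the rules of a strict
  monoidal category, the zigzag identities for self-dual objects, and \<open>rotate_right\<close>,
  \<open>rotate_left\<close>, which say that bending one leg of a vertex gives the vertex with the same cyclic
  order of its legs.
\<close>

inductive cat_eq ::
  "bool \<Rightarrow> nat \<Rightarrow> (nat list \<Rightarrow> nat list \<Rightarrow> 'r::comm_ring_1 web \<Rightarrow> 'r web \<Rightarrow> bool) \<Rightarrow>
   nat list \<Rightarrow> nat list \<Rightarrow> 'r web \<Rightarrow> 'r web \<Rightarrow> bool"
  for K n R where
  relation: "R a b s t \<Longrightarrow> cat_eq K n R a b s t"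
| refl: "web_in K n s a b \<Longrightarrow> cat_eq K n R a b s s"
| sym: "cat_eq K n R a b s t \<Longrightarrow> cat_eq K n R a b t s"
| trans: "cat_eq K n R a b s t \<Longrightarrow> cat_eq K n R a b t u \<Longrightarrow> cat_eq K n R a b s u"
| comp_cong: "cat_eq K n R a b s s' \<Longrightarrow> cat_eq K n R b c t t' \<Longrightarrow>
    cat_eq K n R a c (t \<^bold>\<circ> s) (t' \<^bold>\<circ> s')"
| tens_cong: "cat_eq K n R a b s s' \<Longrightarrow> cat_eq K n R c d t t' \<Longrightarrow>
    cat_eq K n R (a @ c) (b @ d) (s \<^bold>\<otimes> t) (s' \<^bold>\<otimes> t')"
| add_cong: "cat_eq K n R a b s s' \<Longrightarrow> cat_eq K n R a b t t' \<Longrightarrow>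
    cat_eq K n R a b (s \<^bold>+ t) (s' \<^bold>+ t')"
| scale_cong: "cat_eq K n R a b s s' \<Longrightarrow> cat_eq K n R a b (r \<^bold>* s) (r \<^bold>* s')"
| comp_assoc: "web_in K n s a b \<Longrightarrow> web_in K n t b c \<Longrightarrow> web_in K n u c d \<Longrightarrow>
    cat_eq K n R a d (u \<^bold>\<circ> (t \<^bold>\<circ> s)) ((u \<^bold>\<circ> t) \<^bold>\<circ> s)"
| comp_id_left: "web_in K n s a b \<Longrightarrow> cat_eq K n R a b (Strands b \<^bold>\<circ> s) s"
| comp_id_right: "web_in K n s a b \<Longrightarrow> cat_eq K n R a b (s \<^bold>\<circ> Strands a) s"
| tens_assoc: "web_in K n s a a' \<Longrightarrow> web_in K n t b b' \<Longrightarrow> web_in K n u c c' \<Longrightarrow>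
    cat_eq K n R (a @ b @ c) (a' @ b' @ c') (s \<^bold>\<otimes> (t \<^bold>\<otimes> u)) ((s \<^bold>\<otimes> t) \<^bold>\<otimes> u)"
| tens_unit_left: "web_in K n s a b \<Longrightarrow> cat_eq K n R a b (Strands [] \<^bold>\<otimes> s) s"
| tens_unit_right: "web_in K n s a b \<Longrightarrow> cat_eq K n R a b (s \<^bold>\<otimes> Strands []) s"
| tens_id: "set a \<subseteq> {1..n} \<Longrightarrow> set b \<subseteq> {1..n} \<Longrightarrow>
    cat_eq K n R (a @ b) (a @ b) (Strands a \<^bold>\<otimes> Strands b) (Strands (a @ b))"
| interchange: "web_in K n s a b \<Longrightarrow> web_in K n t b c \<Longrightarrow> web_in K n s' a' b' \<Longrightarrow> web_in K n t' b' c' \<Longrightarrow>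
    cat_eq K n R (a @ a') (c @ c') ((t \<^bold>\<circ> s) \<^bold>\<otimes> (t' \<^bold>\<circ> s')) ((t \<^bold>\<otimes> t') \<^bold>\<circ> (s \<^bold>\<otimes> s'))"
| zigzag_left: "k \<in> {1..n} \<Longrightarrow> cat_eq K n R [k] [k]
    ((Cap k \<^bold>\<otimes> Strands [k]) \<^bold>\<circ> (Strands [k] \<^bold>\<otimes> Cup k)) (Strands [k])"
| zigzag_right: "k \<in> {1..n} \<Longrightarrow> cat_eq K n R [k] [k]
    ((Strands [k] \<^bold>\<otimes> Cap k) \<^bold>\<circ> (Cup k \<^bold>\<otimes> Strands [k])) (Strands [k])"
| rotate_right: "admissible n a b c \<Longrightarrow> cat_eq K n R [a] [c, b]
    ((Merge a b c \<^bold>\<otimes> Strands [b]) \<^bold>\<circ> (Strands [a] \<^bold>\<otimes> Cup b)) (Split c b a)"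
| rotate_left: "admissible n a b c \<Longrightarrow> cat_eq K n R [b] [a, c]
    ((Strands [a] \<^bold>\<otimes> Merge a b c) \<^bold>\<circ> (Cup a \<^bold>\<otimes> Strands [b])) (Split a c b)"
| add_assoc: "web_in K n s a b \<Longrightarrow> web_in K n t a b \<Longrightarrow> web_in K n u a b \<Longrightarrow>
    cat_eq K n R a b ((s \<^bold>+ t) \<^bold>+ u) (s \<^bold>+ (t \<^bold>+ u))"
| add_commute: "web_in K n s a b \<Longrightarrow> web_in K n t a b \<Longrightarrow> cat_eq K n R a b (s \<^bold>+ t) (t \<^bold>+ s)"
| add_zero: "web_in K n s a b \<Longrightarrow> cat_eq K n R a b (s \<^bold>+ Zero a b) s"
| add_minus: "web_in K n s a b \<Longrightarrow> cat_eq K n R a b (s \<^bold>+ (- 1) \<^bold>* s) (Zero a b)"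
| scale_one: "web_in K n s a b \<Longrightarrow> cat_eq K n R a b (1 \<^bold>* s) s"
| scale_scale: "web_in K n s a b \<Longrightarrow> cat_eq K n R a b (r \<^bold>* r' \<^bold>* s) ((r * r') \<^bold>* s)"
| scale_add_scalar: "web_in K n s a b \<Longrightarrow>
    cat_eq K n R a b ((r + r') \<^bold>* s) (r \<^bold>* s \<^bold>+ r' \<^bold>* s)"
| scale_add: "web_in K n s a b \<Longrightarrow> web_in K n t a b \<Longrightarrow>
    cat_eq K n R a b (r \<^bold>* (s \<^bold>+ t)) (r \<^bold>* s \<^bold>+ r \<^bold>* t)"
| comp_add_left: "web_in K n s a b \<Longrightarrow> web_in K n t b c \<Longrightarrow> web_in K n t' b c \<Longrightarrow>
    cat_eq K n R a c ((t \<^bold>+ t') \<^bold>\<circ> s) (t \<^bold>\<circ> s \<^bold>+ t' \<^bold>\<circ> s)"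
| comp_add_right: "web_in K n s a b \<Longrightarrow> web_in K n s' a b \<Longrightarrow> web_in K n t b c \<Longrightarrow>
    cat_eq K n R a c (t \<^bold>\<circ> (s \<^bold>+ s')) (t \<^bold>\<circ> s \<^bold>+ t \<^bold>\<circ> s')"
| comp_scale_left: "web_in K n s a b \<Longrightarrow> web_in K n t b c \<Longrightarrow>
    cat_eq K n R a c ((r \<^bold>* t) \<^bold>\<circ> s) (r \<^bold>* (t \<^bold>\<circ> s))"
| comp_scale_right: "web_in K n s a b \<Longrightarrow> web_in K n t b c \<Longrightarrow>
    cat_eq K n R a c (t \<^bold>\<circ> (r \<^bold>* s)) (r \<^bold>* (t \<^bold>\<circ> s))"
| tens_add_left: "web_in K n s a b \<Longrightarrow> web_in K n s' a b \<Longrightarrow> web_in K n t c d \<Longrightarrow>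
    cat_eq K n R (a @ c) (b @ d) ((s \<^bold>+ s') \<^bold>\<otimes> t) (s \<^bold>\<otimes> t \<^bold>+ s' \<^bold>\<otimes> t)"
| tens_add_right: "web_in K n s a b \<Longrightarrow> web_in K n t c d \<Longrightarrow> web_in K n t' c d \<Longrightarrow>
    cat_eq K n R (a @ c) (b @ d) (s \<^bold>\<otimes> (t \<^bold>+ t')) (s \<^bold>\<otimes> t \<^bold>+ s \<^bold>\<otimes> t')"
| tens_scale_left: "web_in K n s a b \<Longrightarrow> web_in K n t c d \<Longrightarrow>
    cat_eq K n R (a @ c) (b @ d) ((r \<^bold>* s) \<^bold>\<otimes> t) (r \<^bold>* (s \<^bold>\<otimes> t))"
| tens_scale_right: "web_in K n s a b \<Longrightarrow> web_in K n t c d \<Longrightarrow>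
    cat_eq K n R (a @ c) (b @ d) (s \<^bold>\<otimes> (r \<^bold>* t)) (r \<^bold>* (s \<^bold>\<otimes> t))"

section \<open>The webs appearing in the relations\<close>

text \<open>Conventions: edges labelled \<open>0\<close> are erased (so that a vertex with a leg labelled \<open>0\<close> becomes a
  plain strand, cup or cap), and a web with an edge label exceeding \<open>n\<close> is zero.\<close>

definition strand0 :: "nat \<Rightarrow> 'r web" where
  "strand0 k = (if k = 0 then Strands [] else Strands [k])"

definition cap0 :: "nat \<Rightarrow> 'r web" where
  "cap0 k = (if k = 0 then Strands [] else Cap k)"

definition merge0 :: "nat \<Rightarrow> nat \<Rightarrow> nat \<Rightarrow> 'r web" where
  "merge0 a b c =
    (if a = 0 then strand0 b else if b = 0 then strand0 a else if c = 0 then Cap a else Merge a b c)"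

definition split0 :: "nat \<Rightarrow> nat \<Rightarrow> nat \<Rightarrow> 'r web" where
  "split0 a b c =
    (if a = 0 then strand0 b else if b = 0 then strand0 a else if c = 0 then Cup a else Split a b c)"

definition cross0 :: "position \<Rightarrow> nat \<Rightarrow> nat \<Rightarrow> 'r web" where
  "cross0 p a b = (if a = 0 then strand0 b else if b = 0 then strand0 a else Cross p a b)"

definition with_edge :: "nat \<Rightarrow> nat \<Rightarrow> nat list \<Rightarrow> nat list \<Rightarrow> 'r web \<Rightarrow> 'r web" where
  "with_edge n j a b t = (if j \<le> n then t else Zero a b)"

definition web_U :: "'r web" where
  "web_U = Cup 1 \<^bold>\<circ> Cap 1"

definition web_V :: "nat \<Rightarrow> 'r web" where
  "web_V n = with_edge n 2 [1, 1] [1, 1] (Split 1 1 2 \<^bold>\<circ> Merge 1 1 2)"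

definition web_I :: "nat \<Rightarrow> nat \<Rightarrow> nat \<Rightarrow> 'r web" where
  "web_I n k j = with_edge n j [1, k] [k, 1] (split0 k 1 j \<^bold>\<circ> merge0 1 k j)"

definition web_H :: "nat \<Rightarrow> nat \<Rightarrow> nat \<Rightarrow> 'r web" where
  "web_H n k j = with_edge n j [1, k] [k, 1]
     ((merge0 1 j k \<^bold>\<otimes> Strands [1]) \<^bold>\<circ> (Strands [1] \<^bold>\<otimes> split0 j 1 k))"

definition web_H' :: "nat \<Rightarrow> nat \<Rightarrow> nat \<Rightarrow> 'r web" where
  "web_H' n k j = with_edge n j [k, k] [1, 1]
     ((merge0 k j 1 \<^bold>\<otimes> Strands [1]) \<^bold>\<circ> (Strands [k] \<^bold>\<otimes> split0 j 1 k))"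

definition web_Y :: "nat \<Rightarrow> nat \<Rightarrow> 'r web" where
  "web_Y n k = with_edge n 2 [k, k] [1, 1]
     (Split 1 1 2 \<^bold>\<circ> Merge 1 1 2 \<^bold>\<circ> (Strands [1] \<^bold>\<otimes> cap0 (k - 1) \<^bold>\<otimes> Strands [1])
       \<^bold>\<circ> (split0 1 (k - 1) k \<^bold>\<otimes> split0 (k - 1) 1 k))"

definition web_C :: "nat \<Rightarrow> 'r web" where
  "web_C k = Cup 1 \<^bold>\<circ> Cap k"

section \<open>The category of flat webs\<close>

inductive web_rel ::
  "nat \<Rightarrow> 'r::comm_ring_1 \<Rightarrow> nat list \<Rightarrow> nat list \<Rightarrow> 'r web \<Rightarrow> 'r web \<Rightarrow> bool"
  for n q where
  circle: "web_rel n q [] [] (Cap 1 \<^bold>\<circ> Cup 1)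
    ((- (qint q n * (qpow q (int n + 1) + qpow q (- int n - 1)))) \<^bold>* Strands [])"
| lollipop: "2 \<le> n \<Longrightarrow> web_rel n q [] [2] (Merge 1 1 2 \<^bold>\<circ> Cup 1) (Zero [] [2])"
| bigon: "1 \<le> k \<Longrightarrow> k \<le> n \<Longrightarrow> web_rel n q [k] [k]
    (merge0 1 (k - 1) k \<^bold>\<circ> split0 1 (k - 1) k) (qint q k \<^bold>* Strands [k])"
| assoc: "1 \<le> k \<Longrightarrow> k + 2 \<le> n \<Longrightarrow> web_rel n q [1, k, 1] [k + 2]
    (Merge (k + 1) 1 (k + 2) \<^bold>\<circ> (Merge 1 k (k + 1) \<^bold>\<otimes> Strands [1]))
    (Merge 1 (k + 1) (k + 2) \<^bold>\<circ> (Strands [1] \<^bold>\<otimes> Merge k 1 (k + 1)))"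
| switch: "1 \<le> k \<Longrightarrow> k \<le> n \<Longrightarrow> web_rel n q [k, k] [1, 1]
    (web_H' n k (k + 1))
    (web_Y n k
      \<^bold>+ (- (qint q (n - k) * unit_inv (qint q (n - k + 1)))) \<^bold>* web_H' n k (k - 1)
      \<^bold>+ (qint q (n - k) * unit_inv (qint q n)) \<^bold>* web_C k)"

text \<open>\<open>web_eq n q a b s t\<close>: \<open>s\<close> and \<open>t\<close> are equal in $\mathrm{Hom}(a,b)$ of the flat web category.\<close>

definition web_eq :: "nat \<Rightarrow> 'r::comm_ring_1 \<Rightarrow> nat list \<Rightarrow> nat list \<Rightarrow> 'r web \<Rightarrow> 'r web \<Rightarrow> bool" where
  "web_eq n q = cat_eq False n (web_rel n q)"

definition beta1 :: "nat \<Rightarrow> 'r::comm_ring_1 \<Rightarrow> 'r web" where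
  "beta1 n q = qpow q (- 1) \<^bold>* Strands [1, 1]
     \<^bold>+ (qpow q (int n) * unit_inv (qint q n)) \<^bold>* web_U \<^bold>+ (- 1) \<^bold>* web_V n"

definition beta1_inverse :: "nat \<Rightarrow> 'r::comm_ring_1 \<Rightarrow> 'r web" where
  "beta1_inverse n q = q \<^bold>* Strands [1, 1]
     \<^bold>+ (qpow q (- int n) * unit_inv (qint q n)) \<^bold>* web_U \<^bold>+ (- 1) \<^bold>* web_V n"

text \<open>The clause for \<open>0\<close> is only there to make the function total (a crossing with an erased strand).\<close>

fun beta :: "nat \<Rightarrow> 'r::comm_ring_1 \<Rightarrow> nat \<Rightarrow> 'r web" where
  "beta n q 0 = Strands [1]"
| "beta n q (Suc 0) = beta1 n q"
| "beta n q (Suc (Suc i)) = (let k = Suc i in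
     unit_inv (qint q (k + 1)) \<^bold>*
       ((Merge 1 k (k + 1) \<^bold>\<otimes> Strands [1]) \<^bold>\<circ> (Strands [1] \<^bold>\<otimes> beta n q k)
         \<^bold>\<circ> (beta1 n q \<^bold>\<otimes> Strands [k]) \<^bold>\<circ> (Strands [1] \<^bold>\<otimes> Split 1 k (k + 1))))"

section \<open>Tangle webs: flat webs with crossings\<close>

inductive cross_rel ::
  "nat \<Rightarrow> 'r::comm_ring_1 \<Rightarrow> nat list \<Rightarrow> nat list \<Rightarrow> 'r web \<Rightarrow> 'r web \<Rightarrow> bool"
  for n q where
  under_1_1: "cross_rel n q [1, 1] [1, 1] (Cross Under 1 1) (beta1 n q)"
| over_1_1: "cross_rel n q [1, 1] [1, 1] (Cross Over 1 1) (beta1_inverse n q)"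
| under_1_Suc: "1 \<le> k \<Longrightarrow> k + 1 \<le> n \<Longrightarrow> cross_rel n q [1, k + 1] [k + 1, 1]
    (Cross Under 1 (k + 1))
    (unit_inv (qint q (k + 1)) \<^bold>*
       ((Merge 1 k (k + 1) \<^bold>\<otimes> Strands [1]) \<^bold>\<circ> (Strands [1] \<^bold>\<otimes> Cross Under 1 k)
         \<^bold>\<circ> (Cross Under 1 1 \<^bold>\<otimes> Strands [k]) \<^bold>\<circ> (Strands [1] \<^bold>\<otimes> Split 1 k (k + 1))))"
| Suc_Suc: "l + 1 \<le> n \<Longrightarrow> k + 1 \<le> n \<Longrightarrow> (l, k) \<noteq> (0, 0) \<Longrightarrow> cross_rel n q [l + 1, k + 1] [k + 1, l + 1]
    (Cross p (l + 1) (k + 1))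
    ((unit_inv (qint q (l + 1)) * unit_inv (qint q (k + 1))) \<^bold>*
       ((merge0 k 1 (k + 1) \<^bold>\<otimes> merge0 l 1 (l + 1))
         \<^bold>\<circ> (strand0 k \<^bold>\<otimes> cross0 p l 1 \<^bold>\<otimes> Strands [1])
         \<^bold>\<circ> (cross0 p l k \<^bold>\<otimes> Cross p 1 1)
         \<^bold>\<circ> (strand0 l \<^bold>\<otimes> cross0 p 1 k \<^bold>\<otimes> Strands [1])
         \<^bold>\<circ> (split0 l 1 (l + 1) \<^bold>\<otimes> split0 k 1 (k + 1))))"

definition tangle_eq :: "nat \<Rightarrow> 'r::comm_ring_1 \<Rightarrow> nat list \<Rightarrow> nat list \<Rightarrow> 'r web \<Rightarrow> 'r web \<Rightarrow> bool" where
  "tangle_eq n q = cat_eq True n (\<lambda>a b s t. web_rel n q a b s t \<or> cross_rel n q a b s t)"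

section \<open>Oriented surfaces\<close>

text \<open>For an injective continuous map \<open>h\<close> between planar sets: \<open>h\<close> preserves the orientation at all
  interior points of \<open>D\<close>.\<close>

definition preserves_orientation :: "complex set \<Rightarrow> (complex \<Rightarrow> complex) \<Rightarrow> bool" where
  "preserves_orientation D h \<longleftrightarrow>
    (\<forall>z r. 0 < r \<longrightarrow> cball z r \<subseteq> D \<longrightarrow> winding_number (h \<circ> circlepath z r) (h z) = 1)"

definition surface_chart :: "'a topology \<Rightarrow> 'a set \<times> ('a \<Rightarrow> complex) \<Rightarrow> bool" where
  "surface_chart X = (\<lambda>(U, c). openin X U \<and> openin (top_of_set {z. 0 \<le> Im z}) (c ` U) \<and>
     homeomorphic_map (subtopology X U) (top_of_set (c ` U)) c)"

text \<open>A surface, possibly with boundary (charts take values in the closed upper half plane), with an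
  oriented atlas \<open>A\<close>.\<close>

definition oriented_surface :: "'a topology \<Rightarrow> ('a set \<times> ('a \<Rightarrow> complex)) set \<Rightarrow> bool" where
  "oriented_surface X A \<longleftrightarrow>
     Hausdorff_space X \<and>
     (\<exists>\<B>. countable \<B> \<and> (\<forall>B\<in>\<B>. openin X B) \<and>
        (\<forall>V. openin X V \<longrightarrow> (\<exists>\<U>\<subseteq>\<B>. V = \<Union>\<U>))) \<and>
     (\<Union>(U, c)\<in>A. U) = topspace X \<and>
     (\<forall>C\<in>A. surface_chart X C) \<and>
     (\<forall>(U, c)\<in>A. \<forall>(V, d)\<in>A.
        preserves_orientation (c ` (U \<inter> V)) (d \<circ> inv_into U c))"

definition thickening :: "'a topology \<Rightarrow> ('a \<times> real) topology" where
  "thickening X = prod_topology X (top_of_set {0<..<1})"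

section \<open>Ribbons and their pictures in a cube\<close>

text \<open>A labelled ribbon consists of the points of the band and, for each label \<open>j\<close>, the points of the
  closed core edges labelled \<open>j\<close>.\<close>

type_synonym 'p ribbon = "'p set \<times> (nat \<Rightarrow> 'p set)"

definition ribbon_image :: "('p \<Rightarrow> 's) \<Rightarrow> 'p ribbon \<Rightarrow> 's ribbon" where
  "ribbon_image g W = (g ` fst W, \<lambda>j. g ` snd W j)"

definition ribbon_restrict :: "'p set \<Rightarrow> 'p ribbon \<Rightarrow> 'p ribbon" where
  "ribbon_restrict B W = (fst W \<inter> B, \<lambda>j. snd W j \<inter> B)"

definition ribbon_union :: "'p ribbon \<Rightarrow> 'p ribbon \<Rightarrow> 'p ribbon" where
  "ribbon_union V W = (fst V \<union> fst W, \<lambda>j. snd V j \<union> snd W j)"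

definition square :: "complex set" where
  "square = {p. 0 \<le> Re p \<and> Re p \<le> 1 \<and> 0 \<le> Im p \<and> Im p \<le> 1}"

definition cube :: "(complex \<times> real) set" where
  "cube = square \<times> {-1..1}"

text \<open>The band of half-width \<open>1/16\<close>, lying flat at height \<open>0\<close>, around a labelled graph in the square;
  the graph is given by a list of labelled arcs.\<close>

definition flat_band :: "(nat \<times> complex set) list \<Rightarrow> (complex \<times> real) ribbon" where
  "flat_band G =
     ({(p, 0) |p. p \<in> square \<and> (\<exists>(j, e)\<in>set G. \<exists>c\<in>e. dist p c \<le> 1 / 16)},
      \<lambda>j. {(c, 0) |c. \<exists>e. (j, e) \<in> set G \<and> c \<in> e})"

definition strand_model :: "nat \<Rightarrow> (complex \<times> real) ribbon" where
  "strand_model k = flat_band [(k, closed_segment (Complex (1/2) 0) (Complex (1/2) 1))]"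

definition cap_model :: "nat \<Rightarrow> (complex \<times> real) ribbon" where
  "cap_model k = flat_band [(k, sphere (Complex (1/2) 0) (1/4) \<inter> square)]"

definition cup_model :: "nat \<Rightarrow> (complex \<times> real) ribbon" where
  "cup_model k = flat_band [(k, sphere (Complex (1/2) 1) (1/4) \<inter> square)]"

definition merge_model :: "nat \<Rightarrow> nat \<Rightarrow> nat \<Rightarrow> (complex \<times> real) ribbon" where
  "merge_model a b c = flat_band
     [(a, closed_segment (Complex (1/4) 0) (Complex (1/2) (1/2))),
      (b, closed_segment (Complex (3/4) 0) (Complex (1/2) (1/2))),
      (c, closed_segment (Complex (1/2) (1/2)) (Complex (1/2) 1))]"

definition split_model :: "nat \<Rightarrow> nat \<Rightarrow> nat \<Rightarrow> (complex \<times> real) ribbon" where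
  "split_model a b c = flat_band
     [(a, closed_segment (Complex (1/2) (1/2)) (Complex (1/4) 1)),
      (b, closed_segment (Complex (1/2) (1/2)) (Complex (3/4) 1)),
      (c, closed_segment (Complex (1/2) 0) (Complex (1/2) (1/2)))]"

text \<open>The two strands of a crossing; over a point with ordinate \<open>y\<close> they run at the heights
  \<open>\<plusminus> y * (1 - y)\<close>.  The offset \<open>x\<close> sweeps out the width of the bands.\<close>

definition cross_model :: "position \<Rightarrow> nat \<Rightarrow> nat \<Rightarrow> (complex \<times> real) ribbon" where
  "cross_model p a b =
     (let h = (case p of Under \<Rightarrow> -1 | Over \<Rightarrow> 1);
          rising = (\<lambda>x y. (Complex (1/4 + y/2 + x) y, h * (y * (1 - y))));
          falling = (\<lambda>x y. (Complex (3/4 - y/2 + x) y, - h * (y * (1 - y))))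
      in ({rising x y |x y. x \<in> {-1/16..1/16} \<and> y \<in> {0..1}}
            \<union> {falling x y |x y. x \<in> {-1/16..1/16} \<and> y \<in> {0..1}},
          \<lambda>j. {rising 0 y |y. y \<in> {0..1} \<and> j = a} \<union> {falling 0 y |y. y \<in> {0..1} \<and> j = b}))"

definition stack :: "(complex \<times> real) ribbon \<Rightarrow> (complex \<times> real) ribbon \<Rightarrow> (complex \<times> real) ribbon" where
  "stack P Q = ribbon_union
     (ribbon_image (\<lambda>(p, z). (Complex (Re p) ((Im p + 1) / 2), z)) P)
     (ribbon_image (\<lambda>(p, z). (Complex (Re p) (Im p / 2), z)) Q)"

definition beside :: "(complex \<times> real) ribbon \<Rightarrow> (complex \<times> real) ribbon \<Rightarrow> (complex \<times> real) ribbon" where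
  "beside P Q = ribbon_union
     (ribbon_image (\<lambda>(p, z). (Complex (Re p / 2) (Im p), z)) P)
     (ribbon_image (\<lambda>(p, z). (Complex ((Re p + 1) / 2) (Im p), z)) Q)"

text \<open>The trace on the horizontal side with ordinate \<open>y\<close>.\<close>

definition trace_at :: "real \<Rightarrow> (complex \<times> real) ribbon \<Rightarrow> (real \<times> real) ribbon" where
  "trace_at y P = ribbon_image (\<lambda>(p, z). (Re p, z)) (ribbon_restrict {(p, z). Im p = y} P)"

text \<open>Homeomorphisms of the square mapping each of its four sides to itself (hence preserving the
  orientation).\<close>

definition square_homeo :: "(complex \<Rightarrow> complex) \<Rightarrow> bool" where
  "square_homeo h \<longleftrightarrow> homeomorphic_map (top_of_set square) (top_of_set square) h \<and>
     (\<forall>p\<in>square. (Re (h p) = 0 \<longleftrightarrow> Re p = 0) \<and> (Re (h p) = 1 \<longleftrightarrow> Re p = 1) \<and>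
                 (Im (h p) = 0 \<longleftrightarrow> Im p = 0) \<and> (Im (h p) = 1 \<longleftrightarrow> Im p = 1))"

text \<open>\<open>picture t P\<close>: the ribbon \<open>P\<close> in the cube is drawn, with the blackboard framing, according to the
  diagram \<open>t\<close> (which contains no linear operations).\<close>

inductive picture :: "'r web \<Rightarrow> (complex \<times> real) ribbon \<Rightarrow> bool" where
  "picture (Strands []) ({}, \<lambda>_. {})"
| "picture (Strands [k]) (strand_model k)"
| "picture (Strands a) P \<Longrightarrow> picture (Strands b) Q \<Longrightarrow> picture (Strands (a @ b)) (beside P Q)"
| "picture (Cup k) (cup_model k)"
| "picture (Cap k) (cap_model k)"
| "picture (Merge a b c) (merge_model a b c)"
| "picture (Split a b c) (split_model a b c)"
| "picture (Cross p a b) (cross_model p a b)"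
| "picture t P \<Longrightarrow> picture s Q \<Longrightarrow> trace_at 0 P = trace_at 1 Q \<Longrightarrow> picture (t \<^bold>\<circ> s) (stack P Q)"
| "picture s P \<Longrightarrow> picture t Q \<Longrightarrow> picture (s \<^bold>\<otimes> t) (beside P Q)"
| "picture t P \<Longrightarrow> square_homeo h \<Longrightarrow> picture t (ribbon_image (\<lambda>(p, z). (h p, z)) P)"

section \<open>Skein algebras\<close>

text \<open>A closed ribbon web in the thickened surface: a compact orientable band which near each of its
  points looks like a piece of an edge or like a vertex.  The embedded cubes used here need not
  preserve any orientation, so both cyclic orders at a vertex occur.\<close>

definition ribbon_web :: "nat \<Rightarrow> 'a topology \<Rightarrow> ('a \<times> real) ribbon \<Rightarrow> bool" where
  "ribbon_web n X W \<longleftrightarrow>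
     compactin (thickening X) (fst W) \<and> (\<forall>j. snd W j \<subseteq> fst W) \<and>
     (\<exists>A. oriented_surface (subtopology (thickening X) (fst W)) A) \<and>
     (\<forall>p\<in>fst W. \<exists>\<phi> P.
        embedding_map (top_of_set cube) (thickening X) \<phi> \<and>
        openin (thickening X) (\<phi> ` interior cube) \<and> p \<in> \<phi> ` interior cube \<and>
        ((\<exists>k\<in>{1..n}. P = strand_model k) \<or> (\<exists>a b c. admissible n a b c \<and> P = merge_model a b c)) \<and>
        ribbon_restrict (\<phi> ` cube) W = ribbon_image \<phi> P)"

definition isotopic :: "'a topology \<Rightarrow> ('a \<times> real) ribbon \<Rightarrow> ('a \<times> real) ribbon \<Rightarrow> bool" where
  "isotopic X W W' \<longleftrightarrow> (\<exists>H.
     continuous_map (prod_topology (top_of_set {0..1::real}) (thickening X)) (thickening X)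
       (\<lambda>(t, p). H t p) \<and>
     (\<forall>t\<in>{0..1}. homeomorphic_map (thickening X) (thickening X) (H t)) \<and>
     (\<forall>p\<in>topspace (thickening X). H 0 p = p) \<and>
     W' = ribbon_image (H 1) W)"

text \<open>Oriented cubes in the thickened surface whose horizontal slices are parallel to the surface, so
  that a picture drawn in the cube is a piece of a diagram on the surface.  The upward direction is
  that of increasing second coordinate.\<close>

definition cube_in :: "'a topology \<Rightarrow> ('a set \<times> ('a \<Rightarrow> complex)) set \<Rightarrow>
    (complex \<times> real \<Rightarrow> 'a \<times> real) \<Rightarrow> bool" where
  "cube_in X A \<phi> \<longleftrightarrow> (\<exists>f u v.
     embedding_map (top_of_set square) X f \<and>
     (\<forall>(U, c)\<in>A. preserves_orientation {p\<in>square. f p \<in> U} (c \<circ> f)) \<and>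
     0 < u \<and> u < v \<and> v < (1::real) \<and>
     \<phi> = (\<lambda>(p, z). (f p, (u + v) / 2 + z * (v - u) / 2)))"

text \<open>\<open>insertion n X \<phi> W0 t F\<close>: \<open>F\<close> is the linear combination of ribbon webs obtained by drawing the
  linear combination of diagrams \<open>t\<close> in the cube \<open>\<phi>\<close>, with \<open>W0\<close> outside of it.\<close>

inductive insertion :: "nat \<Rightarrow> 'a topology \<Rightarrow> (complex \<times> real \<Rightarrow> 'a \<times> real) \<Rightarrow> ('a \<times> real) ribbon \<Rightarrow>
    'r::comm_ring_1 web \<Rightarrow> (('a \<times> real) ribbon \<Rightarrow>\<^sub>0 'r) \<Rightarrow> bool"
  for n X \<phi> W0 where
  diagram: "ribbon_web n X W \<Longrightarrow> picture t P \<Longrightarrow> ribbon_restrict (\<phi> ` cube) W = ribbon_image \<phi> P \<Longrightarrow>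
    ribbon_restrict (- \<phi> ` interior cube) W = W0 \<Longrightarrow>
    insertion n X \<phi> W0 t (Poly_Mapping.single W 1)"
| zero: "insertion n X \<phi> W0 (Zero a b) 0"
| add: "insertion n X \<phi> W0 s F \<Longrightarrow> insertion n X \<phi> W0 t G \<Longrightarrow> insertion n X \<phi> W0 (s \<^bold>+ t) (F + G)"
| scale: "insertion n X \<phi> W0 s F \<Longrightarrow> insertion n X \<phi> W0 (r \<^bold>* s) (Poly_Mapping.map ((*) r) F)"

text \<open>
  The submodule of the free module on ribbon webs by which one divides in the skein algebra.  In the
  rule \<open>local_relation\<close> the two sides drawn in a cube are equal in the linear category of tangle webs
  presented by the defining local relations.  That category is the quotient of the span of the
  diagrams in a cube by all instances of the defining relations in smaller cubes (and by planar
  isotopies), so this is the same as imposing the defining relations in all cubes.  The product of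
  the skein algebra is not involved in local relations.
\<close>

inductive_set skein_null :: "nat \<Rightarrow> 'r::comm_ring_1 \<Rightarrow> 'a topology \<Rightarrow> ('a set \<times> ('a \<Rightarrow> complex)) set \<Rightarrow>
    (('a \<times> real) ribbon \<Rightarrow>\<^sub>0 'r) set"
  for n q X A where
  zero: "0 \<in> skein_null n q X A"
| add: "F \<in> skein_null n q X A \<Longrightarrow> G \<in> skein_null n q X A \<Longrightarrow> F + G \<in> skein_null n q X A"
| scale: "F \<in> skein_null n q X A \<Longrightarrow> Poly_Mapping.map ((*) r) F \<in> skein_null n q X A"
| isotopy: "ribbon_web n X W \<Longrightarrow> ribbon_web n X W' \<Longrightarrow> isotopic X W W' \<Longrightarrow>
    Poly_Mapping.single W 1 - Poly_Mapping.single W' 1 \<in> skein_null n q X A"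
| local_relation: "tangle_eq n q a b s t \<Longrightarrow> cube_in X A \<phi> \<Longrightarrow>
    insertion n X \<phi> W0 s F \<Longrightarrow> insertion n X \<phi> W0 t G \<Longrightarrow> F - G \<in> skein_null n q X A"

definition holds_locally :: "nat \<Rightarrow> 'r::comm_ring_1 \<Rightarrow> 'a topology \<Rightarrow> ('a set \<times> ('a \<Rightarrow> complex)) set \<Rightarrow>
    'r web \<Rightarrow> 'r web \<Rightarrow> bool" where
  "holds_locally n q X A s t \<longleftrightarrow> (\<forall>\<phi> W0 F G. cube_in X A \<phi> \<longrightarrow>
     insertion n X \<phi> W0 s F \<longrightarrow> insertion n X \<phi> W0 t G \<longrightarrow> F - G \<in> skein_null n q X A)"

end

theory Submission
  imports Defs
begin

text \<open>
The formula for the crossing of a strand $1$ under a strand $k$ is proved by induction on $k$,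
inserting the formula for $k$ into the recursive definition of \<open>beta\<close>.  Write $k = j + 1$.  The
induction hypothesis presents $(-1)^k\beta_k$ as a combination of $I_{k+1}$, $H_{k-1}$, $I_{k-1}$,
and $-\beta_1$ is a combination of $V$, the identity and $U$; so $(-1)^{k+1}[k+1]\beta_{k+1}$ is a
combination of nine webs.  Each of the nine is a combination of the three webs
$I_{k+2}$, $H_k$, $I_k$ wanted for $k + 1$ (\<open>crossing_terms\<close>), and it remains to compare
coefficients (\<open>coefficient_H\<close>, \<open>coefficient_I\<close>).

Four facts reduce the nine webs.
(1) The switching relation, turned by a quarter, lives in $\mathrm{End}(1\otimes k)$ and says that
splitting after merging $1\otimes k \to k+1$ is a combination of the identity, of $V$ absorbed into the
strand $k$, and of the web through the edge $k - 1$ (\<open>switch_turned\<close>); for $k = 1$ it computes $V$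
turned by a quarter (\<open>turn_1_V\<close>), so that $V$ can be moved around a cup or a cap (\<open>V_cu\<close>, \<open>ca_V\<close>).
(2) Two strands $1$ that merge one after the other into a thick strand absorb $V$ at the cost of a
factor $[2]$; therefore a cup, and dually a cap, next to them gives zero by the lollipop relation
(\<open>merge_V\<close>, \<open>merge_cu\<close>, \<open>split_V\<close>, \<open>ca_split\<close>).
(3) The triangle with outer edges $k$, $k+1$, $1$ and inner edges $1$, $k+1$, $k$ is $[n+1]/[n-k+1]$ times a
vertex for $k \ge 1$ (\<open>H_open_left\<close>); this is a second induction, resting on (1) and (2).
(4) The triangle with the same outer edges and inner edges $1$, $k-1$, $k$ is $[k]$ times a vertex, by
associativity and the bigon relation (\<open>under_merge_open_right\<close>).

To calculate with webs, expressions are replaced by representatives of their classes, so that equality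
of morphisms becomes equality in the logic; ill-typed expressions are all identified, and this makes most
laws of a linear monoidal category hold without side conditions.  Edges labelled $0$ are treated on
the same footing as the others, so that the smallest labels fit into the general pattern.

In the skein algebra the crossing is not an abbreviation but a generator; the relations for crossings
identify it with \<open>beta\<close> (\<open>cross_under_eq_beta\<close>), and the flat identity, which is also an identity between
webs with crossings (\<open>cat_eq_mono\<close>), becomes a local relation.
\<close>

section \<open>Quantum integers\<close>

lemma qpow_of_nat: "qpow q (int i) = q ^ i"
  by (simp add: qpow_def)

lemma qint_0: "qint q 0 = 0"
  by (simp add: qint_def)

lemma qint_1: "qint q (Suc 0) = 1"
  by (simp add: qint_def qpow_def)

context
  fixes q :: "'r::comm_ring_1"
  assumes q_unit: "q dvd 1"
begin

lemma q_unit_inv: "q * unit_inv q = 1" "unit_inv q * q = 1"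
  using unit_inv_right[OF q_unit] by (simp_all add: mult.commute)

lemma q_power_inv: "q ^ i * unit_inv q ^ i = 1" "unit_inv q ^ i * q ^ i = 1"
  using q_unit_inv by (simp_all add: power_mult_distrib[symmetric])

lemma qpow_minus_of_nat: "qpow q (- int i) = unit_inv q ^ i"
  by (cases "i = 0") (simp_all add: qpow_def)

lemma qpow_diff: "qpow q (int i - int j) = q ^ i * unit_inv q ^ j"
proof (cases "j \<le> i")
  case True
  then obtain d where d: "i = d + j" by (metis le_add_diff_inverse2)
  have "q ^ i * unit_inv q ^ j = q ^ d * (q ^ j * unit_inv q ^ j)"
    unfolding d power_add by (simp add: mult.assoc)
  then show ?thesis using d q_power_inv by (simp add: qpow_of_nat)
next
  case False
  then obtain d where d: "j = d + i" by (metis le_add_diff_inverse2 nat_le_linear)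
  have "q ^ i * unit_inv q ^ j = unit_inv q ^ d * (q ^ i * unit_inv q ^ i)"
    unfolding d power_add by (simp add: mult_ac)
  then show ?thesis using d q_power_inv by (simp add: qpow_minus_of_nat)
qed

lemma qpow_add: "qpow q (a + b) = qpow q a * qpow q b"
proof -
  obtain i j i' j' where "a = int i - int j" "b = int i' - int j'"
    by (metis int_diff_cases)
  moreover have "int i - int j + (int i' - int j') = int (i + i') - int (j + j')" by simp
  ultimately show ?thesis
    by (simp only: qpow_diff power_add) (simp add: mult_ac)
qed

lemma qint_Suc: "qint q (Suc m) = q * qint q m + qpow q (- int m)"
proof -
  have "qint q (Suc m) = (\<Sum>i<m. qpow q (int m - 2 * int i)) + qpow q (int m - 2 * int m)"
    by (simp add: qint_def)
  also have "(\<Sum>i<m. qpow q (int m - 2 * int i)) = (\<Sum>i<m. q * qpow q (int m - 1 - 2 * int i))"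
  proof (rule sum.cong)
    fix i
    have "int m - 2 * int i = 1 + (int m - 1 - 2 * int i)" by simp
    then show "qpow q (int m - 2 * int i) = q * qpow q (int m - 1 - 2 * int i)"
      using qpow_add[of 1 "int m - 1 - 2 * int i"] by (simp add: qpow_def[of q 1])
  qed simp
  finally show ?thesis by (simp add: qint_def sum_distrib_left)
qed

lemma qint_2: "qint q 2 = q + unit_inv q"
  using qint_Suc[of 1] qpow_minus_of_nat[of 1] by (simp add: numeral_2_eq_2 qint_1)

lemma qint_Suc_Suc: "qint q (Suc (Suc m)) + qint q m = qint q 2 * qint q (Suc m)"
proof -
  have "unit_inv q * qint q (Suc m) = (unit_inv q * q) * qint q m + unit_inv q * qpow q (- int m)"
    by (simp add: qint_Suc algebra_simps)
  also have "\<dots> = qint q m + qpow q (- int (Suc m))"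
    by (simp only: q_unit_inv qpow_minus_of_nat) simp
  finally show ?thesis
    using qint_Suc[of "Suc m"] by (simp add: qint_2 algebra_simps)
qed

text \<open>The identities between products of two quantum integers used below are instances of this one.  It holds because
the difference of the two products satisfies $f(a+1) = f(a)$, by the recursion \<open>qint_Suc_Suc\<close>; a proof by
the closed formula for $[m]$ would need $q - q^{-1} \neq 0$.\<close>

lemma qint_exchange: "qint q (Suc a) * qint q (a + d) = qint q a * qint q (Suc (a + d)) + qint q d"
proof (induction a)
  case 0
  then show ?case by (simp add: qint_0 qint_1)
next
  case (Suc a)
  have 1: "qint q (Suc (Suc a)) = qint q 2 * qint q (Suc a) - qint q a"
    using qint_Suc_Suc[of a] by (simp add: algebra_simps)
  have 2: "qint q (Suc (Suc (a + d))) = qint q 2 * qint q (Suc (a + d)) - qint q (a + d)"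
    using qint_Suc_Suc[of "a + d"] by (simp add: algebra_simps)
  show ?case
    using Suc by (simp add: 1 2 algebra_simps)
qed

end

section \<open>Types of webs\<close>

primrec source :: "'r web \<Rightarrow> nat list" where
  "source (Strands a) = a"
| "source (Cup k) = []"
| "source (Cap k) = [k, k]"
| "source (Merge a b c) = [a, b]"
| "source (Split a b c) = [c]"
| "source (Cross p a b) = [a, b]"
| "source (t \<^bold>\<circ> s) = source s"
| "source (s \<^bold>\<otimes> t) = source s @ source t"
| "source (Zero a b) = a"
| "source (s \<^bold>+ t) = source s"
| "source (r \<^bold>* s) = source s"

primrec target :: "'r web \<Rightarrow> nat list" where
  "target (Strands a) = a"
| "target (Cup k) = [k, k]"
| "target (Cap k) = []"
| "target (Merge a b c) = [c]"
| "target (Split a b c) = [a, b]"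
| "target (Cross p a b) = [b, a]"
| "target (t \<^bold>\<circ> s) = target t"
| "target (s \<^bold>\<otimes> t) = target s @ target t"
| "target (Zero a b) = b"
| "target (s \<^bold>+ t) = target s"
| "target (r \<^bold>* s) = target s"

text \<open>A web expression determines its source and target, so the typing judgement reduces to a predicate that
can be computed by recursion on the expression.\<close>

definition typed :: "bool \<Rightarrow> nat \<Rightarrow> 'r web \<Rightarrow> bool" where
  "typed K n t \<longleftrightarrow> web_in K n t (source t) (target t)"

lemma web_in_source_target: "web_in K n t a b \<Longrightarrow> source t = a \<and> target t = b"
  by (induction rule: web_in.induct) auto

lemma web_in_iff: "web_in K n t a b \<longleftrightarrow> typed K n t \<and> source t = a \<and> target t = b"
  using web_in_source_target unfolding typed_def by blast

lemma typed_simps: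
  fixes s t :: "'r web"
  shows "typed K n (Strands a :: 'r web) \<longleftrightarrow> set a \<subseteq> {1..n}"
    and "typed K n (Cup k :: 'r web) \<longleftrightarrow> k \<in> {1..n}"
    and "typed K n (Cap k :: 'r web) \<longleftrightarrow> k \<in> {1..n}"
    and "typed K n (Merge i j k :: 'r web) \<longleftrightarrow> admissible n i j k"
    and "typed K n (Split i j k :: 'r web) \<longleftrightarrow> admissible n i j k"
    and "typed K n (Cross p i j :: 'r web) \<longleftrightarrow> K \<and> i \<in> {1..n} \<and> j \<in> {1..n}"
    and "typed K n (t \<^bold>\<circ> s) \<longleftrightarrow> typed K n s \<and> typed K n t \<and> target s = source t"
    and "typed K n (s \<^bold>\<otimes> t) \<longleftrightarrow> typed K n s \<and> typed K n t"
    and "typed K n (Zero a b :: 'r web) \<longleftrightarrow> set a \<union> set b \<subseteq> {1..n}"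
    and "typed K n (s \<^bold>+ t) \<longleftrightarrow> typed K n s \<and> typed K n t \<and> source s = source t \<and> target s = target t"
    and "typed K n (r \<^bold>* s) \<longleftrightarrow> typed K n s"
proof -
  have typed: "web_in K n t a b \<Longrightarrow> typed K n t \<and> source t = a \<and> target t = b" for t :: "'r web" and a b
    using web_in_iff by blast
  have web_in: "typed K n t \<Longrightarrow> web_in K n t (source t) (target t)" for t :: "'r web"
    by (simp add: typed_def)
  show "typed K n (Strands a :: 'r web) \<longleftrightarrow> set a \<subseteq> {1..n}" "typed K n (Cup k :: 'r web) \<longleftrightarrow> k \<in>
      {1..n}" "typed K n (Cap k :: 'r web) \<longleftrightarrow> k \<in> {1..n}"
    "typed K n (Merge i j k :: 'r web) \<longleftrightarrow> admissible n i j k"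
    "typed K n (Split i j k :: 'r web) \<longleftrightarrow> admissible n i j k"
    "typed K n (Cross p i j :: 'r web) \<longleftrightarrow> K \<and> i \<in> {1..n} \<and> j \<in> {1..n}"
    unfolding typed_def by (subst web_in.simps; simp)+
  show "typed K n (Zero a b :: 'r web) \<longleftrightarrow> set a \<union> set b \<subseteq> {1..n}"
    unfolding typed_def by (subst web_in.simps; simp)
  show "typed K n (t \<^bold>\<circ> s) \<longleftrightarrow> typed K n s \<and> typed K n t \<and> target s = source t"
  proof
    assume "typed K n (t \<^bold>\<circ> s)"
    then obtain b where "web_in K n s (source s) b" "web_in K n t b (target t)"
      unfolding typed_def by (auto elim: web_in.cases)
    with typed show "typed K n s \<and> typed K n t \<and> target s = source t" by metis
  next
    assume "typed K n s \<and> typed K n t \<and> target s = source t"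
    with web_in show "typed K n (t \<^bold>\<circ> s)"
      unfolding typed_def source.simps target.simps by (metis web_in.intros(7))
  qed
  show "typed K n (s \<^bold>\<otimes> t) \<longleftrightarrow> typed K n s \<and> typed K n t"
  proof
    assume "typed K n (s \<^bold>\<otimes> t)"
    then obtain a b c d where "web_in K n s a b" "web_in K n t c d"
      unfolding typed_def by (auto elim: web_in.cases)
    with typed show "typed K n s \<and> typed K n t" by metis
  next
    assume "typed K n s \<and> typed K n t"
    with web_in show "typed K n (s \<^bold>\<otimes> t)"
      unfolding typed_def source.simps target.simps by (metis web_in.intros(8))
  qed
  show "typed K n (s \<^bold>+ t) \<longleftrightarrow> typed K n s \<and> typed K n t \<and> source s = source t \<and> target s = target t"
  proof
    assume "typed K n (s \<^bold>+ t)"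
    then have "web_in K n s (source s) (target s)" "web_in K n t (source s) (target s)"
      unfolding typed_def by (auto elim: web_in.cases)
    with typed show "typed K n s \<and> typed K n t \<and> source s = source t \<and> target s = target t" by metis
  next
    assume "typed K n s \<and> typed K n t \<and> source s = source t \<and> target s = target t"
    with web_in show "typed K n (s \<^bold>+ t)"
      unfolding typed_def source.simps target.simps by (metis web_in.intros(10))
  qed
  show "typed K n (r \<^bold>* s) \<longleftrightarrow> typed K n s"
    unfolding typed_def by (auto elim: web_in.cases intro: web_in.intros)
qed

lemma admissible_rotate: "admissible n b a c \<longleftrightarrow> admissible n a b c"
    "admissible n a c b \<longleftrightarrow> admissible n a b c"
  by (simp_all add: admissible_def add_mset_commute)

lemma admissible_vertex:
  assumes "1 \<le> j" "Suc j \<le> n"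
  shows "admissible n 1 j (Suc j)" "admissible n j 1 (Suc j)" "admissible n (Suc j) 1 j"
    "admissible n 1 (Suc j) j" "admissible n j (Suc j) 1" "admissible n (Suc j) j 1"
proof -
  show "admissible n 1 j (Suc j)"
    using assms by (auto simp: admissible_def intro!: bexI[of _ j])
  then show "admissible n j 1 (Suc j)" "admissible n (Suc j) 1 j"
    "admissible n 1 (Suc j) j" "admissible n j (Suc j) 1" "admissible n (Suc j) j 1"
    by (simp_all add: admissible_def add_mset_commute)
qed

lemma admissible_labels: "admissible n a b c \<Longrightarrow> {a, b, c} \<subseteq> {1..n}"
proof -
  assume "admissible n a b c"
  then obtain k where k: "k \<in> {1..<n}" "{#a, b, c#} = {#1, k, k + 1#}"
    by (auto simp: admissible_def)
  from k(2) have "{a, b, c} = {1, k, k + 1}"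
    by (metis set_mset_add_mset_insert set_mset_empty)
  with k(1) show ?thesis by simp
qed

lemma web_in_labels: "web_in K n t a b \<Longrightarrow> set a \<subseteq> {1..n} \<and> set b \<subseteq> {1..n}"
proof (induction rule: web_in.induct)
  case (4 a b c)
  then show ?case using admissible_labels[of n a b c] by simp
next
  case (5 a b c)
  then show ?case using admissible_labels[of n a b c] by simp
qed simp_all

lemma typed_labels:
  "typed K n t \<Longrightarrow> set (source t) \<subseteq> {1..n}" "typed K n t \<Longrightarrow> set (target t) \<subseteq> {1..n}"
  using web_in_labels unfolding typed_def by blast+

lemma web_rel_typed:
  assumes "web_rel n q a b s t" "1 \<le> n"
  shows "web_in K n s a b \<and> web_in K n t a b"
  using assms
proof cases
  case lollipop
  then show ?thesis
    using admissible_vertex[of 1 n] by (simp add: web_in_iff typed_simps numeral_2_eq_2)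
next
  case (bigon k)
  then show ?thesis
    using admissible_vertex[of "k - 1" n]
    by (auto simp: web_in_iff typed_simps merge0_def split0_def strand0_def)
next
  case (assoc k)
  then show ?thesis
    using admissible_vertex[of k n] admissible_vertex[of "Suc k" n]
    by (auto simp: web_in_iff typed_simps)
next
  case (switch k)
  have "admissible n (Suc 0) k (Suc k)" if "k < n"
    using switch that admissible_vertex[of k n] by simp
  moreover have "admissible n (Suc 0) (k - 1) k" if "k \<noteq> 1"
    using switch that admissible_vertex[of "k - 1" n] by simp
  moreover have "admissible n (Suc 0) (Suc 0) 2" if "2 \<le> n"
    using that admissible_vertex[of 1 n] by (simp add: numeral_2_eq_2)
  ultimately show ?thesis
    using switch
    by (auto simp: web_in_iff typed_simps web_H'_def web_Y_def web_C_def with_edge_def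
        merge0_def split0_def strand0_def cap0_def admissible_rotate)
qed (simp add: web_in_iff typed_simps)

lemma cat_eq_typed:
  assumes "\<And>a b s t. R a b s t \<Longrightarrow> web_in K n s a b \<and> web_in K n t a b"
    and "cat_eq K n R a b s t"
  shows "web_in K n s a b \<and> web_in K n t a b"
  using assms(2)
proof induction
  case (relation a b s t)
  then show ?case by (rule assms(1))
next
  case (rotate_right a b c)
  then show ?case
    using admissible_labels[of n a b c] by (simp add: web_in_iff typed_simps admissible_rotate)
next
  case (rotate_left a b c)
  then show ?case
    using admissible_labels[of n a b c] by (simp add: web_in_iff typed_simps admissible_rotate)
qed (auto simp: web_in_iff typed_simps dest: typed_labels[THEN subsetD])

section \<open>Webs up to equality as a linear monoidal category\<close>

locale sp_webs =
  fixes n :: nat and q :: "'r::comm_ring_1"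
  assumes n_pos: "1 \<le> n"
    and q_unit: "q dvd 1"
    and qint_unit: "j \<in> {1..n} \<Longrightarrow> qint q j dvd 1"
begin

abbreviation ty :: "'r web \<Rightarrow> bool" where
  "ty \<equiv> typed False n"

abbreviation web_equal :: "nat list \<Rightarrow> nat list \<Rightarrow> 'r web \<Rightarrow> 'r web \<Rightarrow> bool" where
  "web_equal \<equiv> cat_eq False n (web_rel n q)"

text \<open>Equality of morphisms, extended to all expressions by identifying all ill-typed ones.  In this form it is
a congruence for every operation, with no hypothesis on types.\<close>

definition eqv :: "'r web \<Rightarrow> 'r web \<Rightarrow> bool" where
  "eqv s t \<longleftrightarrow> \<not> ty s \<and> \<not> ty t \<or> web_equal (source s) (target s) s t"

text \<open>A representative of the class of \<open>t\<close>.  It turns equality of morphisms into equality in the logic, and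
makes the morphisms accessible to rewriting.\<close>

definition nf :: "'r web \<Rightarrow> 'r web" where
  "nf t = (SOME u. eqv t u)"

lemma web_equal_typed:
  "web_equal a b s t \<Longrightarrow> ty s \<and> ty t \<and> source s = a \<and> source t = a \<and> target s = b \<and> target t = b"
proof -
  assume "web_equal a b s t"
  then have "web_in False n s a b \<and> web_in False n t a b"
    by (rule cat_eq_typed[rotated]) (rule web_rel_typed[OF _ n_pos])
  then show ?thesis by (simp add: web_in_iff)
qed

lemma eqv_equivp: "equivp eqv"
proof (rule equivpI)
  show "reflp eqv"
    by (rule reflpI) (auto simp: eqv_def typed_def intro: cat_eq.refl)
  show "symp eqv"
    by (rule sympI) (metis eqv_def web_equal_typed cat_eq.sym)
  show "transp eqv"
  proof (rule transpI)
    fix s t u assume "eqv s t" "eqv t u"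
    then show "eqv s u"
      unfolding eqv_def by (metis cat_eq.trans web_equal_typed)
  qed
qed

lemma eqv_nf: "eqv t (nf t)"
  unfolding nf_def by (rule someI[of _ t]) (use eqv_equivp in \<open>blast elim: equivpE dest: reflpD\<close>)

lemma nf_eq_iff: "nf s = nf t \<longleftrightarrow> eqv s t"
proof
  assume "eqv s t"
  then have "eqv s = eqv t" using eqv_equivp by (simp add: equivp_def)
  then show "nf s = nf t" by (simp add: nf_def)
next
  assume "nf s = nf t"
  then show "eqv s t"
    using eqv_nf[of s] eqv_nf[of t] eqv_equivp by (metis equivp_symp equivp_transp)
qed

lemma web_equal_nf: "web_equal a b s t \<Longrightarrow> nf s = nf t"
  unfolding nf_eq_iff eqv_def using web_equal_typed by blast

lemma nf_web_equal: "nf s = nf t \<Longrightarrow> ty s \<Longrightarrow> source s = a \<Longrightarrow> target s = b \<Longrightarrow> web_equal a b s t"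
  unfolding nf_eq_iff eqv_def by blast

lemma nf_eqI:
  assumes "ty s \<longleftrightarrow> ty t" "ty s \<Longrightarrow> ty t \<Longrightarrow> web_equal (source s) (target s) s t"
  shows "nf s = nf t"
  using assms unfolding nf_eq_iff eqv_def by blast

definition cmp :: "'r web \<Rightarrow> 'r web \<Rightarrow> 'r web" (infixr "\<odot>" 70) where
  "t \<odot> s = nf (t \<^bold>\<circ> s)"

definition tens :: "'r web \<Rightarrow> 'r web \<Rightarrow> 'r web" (infixr "\<boxtimes>" 75) where
  "s \<boxtimes> t = nf (s \<^bold>\<otimes> t)"

definition sum_web :: "'r web \<Rightarrow> 'r web \<Rightarrow> 'r web" (infixl "\<oplus>" 60) where
  "s \<oplus> t = nf (s \<^bold>+ t)"

definition scl :: "'r \<Rightarrow> 'r web \<Rightarrow> 'r web" (infixr "\<star>" 65) where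
  "r \<star> t = nf (r \<^bold>* t)"

text \<open>Whiskering: \<open>t\<close> with the strands \<open>l\<close> to its left and \<open>r\<close> to its right.  Every web is written below as a
composite of whiskered vertices, cups and caps.\<close>

definition W :: "nat list \<Rightarrow> 'r web \<Rightarrow> nat list \<Rightarrow> 'r web" where
  "W l t r = Strands l \<boxtimes> t \<boxtimes> Strands r"

lemma nf_nf [simp]: "nf (nf t) = nf t"
  using eqv_nf eqv_equivp by (simp add: nf_eq_iff) (metis equivp_symp)

lemma eqv_congs:
  assumes "eqv s s'" "eqv t t'"
  shows "eqv (t \<^bold>\<circ> s) (t' \<^bold>\<circ> s')" "eqv (s \<^bold>\<otimes> t) (s' \<^bold>\<otimes> t')" "eqv (s \<^bold>+ t) (s' \<^bold>+ t')"
    "eqv (r \<^bold>* s) (r \<^bold>* s')"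
proof -
  have s: "ty s \<and> ty s' \<and> source s' = source s \<and> target s' = target s \<and> web_equal (source s)
      (target s) s s'
     \<or> \<not> ty s \<and> \<not> ty s'"
    using assms(1) web_equal_typed unfolding eqv_def by blast
  have t: "ty t \<and> ty t' \<and> source t' = source t \<and> target t' = target t \<and> web_equal (source t)
      (target t) t t'
     \<or> \<not> ty t \<and> \<not> ty t'"
    using assms(2) web_equal_typed unfolding eqv_def by blast
  show "eqv (t \<^bold>\<circ> s) (t' \<^bold>\<circ> s')"
    using s t unfolding eqv_def by (auto simp: typed_simps intro: cat_eq.comp_cong)
  show "eqv (s \<^bold>\<otimes> t) (s' \<^bold>\<otimes> t')"
    using s t unfolding eqv_def by (auto simp: typed_simps intro: cat_eq.tens_cong)
  show "eqv (s \<^bold>+ t) (s' \<^bold>+ t')"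
    using s t unfolding eqv_def by (auto simp: typed_simps intro: cat_eq.add_cong)
  show "eqv (r \<^bold>* s) (r \<^bold>* s')"
    using s t unfolding eqv_def by (auto simp: typed_simps intro: cat_eq.scale_cong)
qed

text \<open>The operations see only the classes of their arguments, so that representatives need not be taken inside.\<close>

lemma nf_ops [simp]:
  "nf s \<odot> t = s \<odot> t" "s \<odot> nf t = s \<odot> t" "nf (s \<odot> t) = s \<odot> t"
  "nf s \<boxtimes> t = s \<boxtimes> t" "s \<boxtimes> nf t = s \<boxtimes> t" "nf (s \<boxtimes> t) = s \<boxtimes> t"
  "nf s \<oplus> t = s \<oplus> t" "s \<oplus> nf t = s \<oplus> t" "nf (s \<oplus> t) = s \<oplus> t"
  "r \<star> nf t = r \<star> t" "nf (r \<star> t) = r \<star> t" "nf (W a t b) = W a t b" "W a (nf t) b = W a t b"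
proof -
  have "eqv (nf t) t" "eqv t t" for t
    using eqv_nf eqv_equivp by (metis equivp_symp, metis equivp_reflp)
  note congs = eqv_congs[OF this(1) this(2)] eqv_congs[OF this(2) this(1)]
  show "nf s \<odot> t = s \<odot> t" "s \<odot> nf t = s \<odot> t" "nf (s \<odot> t) = s \<odot> t"
    "nf s \<boxtimes> t = s \<boxtimes> t" and tens: "s \<boxtimes> nf t = s \<boxtimes> t" "nf (s \<boxtimes> t) = s \<boxtimes> t"
    and "nf s \<oplus> t = s \<oplus> t" "s \<oplus> nf t = s \<oplus> t" "nf (s \<oplus> t) = s \<oplus> t"
    "r \<star> nf t = r \<star> t" "nf (r \<star> t) = r \<star> t" for s t
    by (simp_all add: cmp_def tens_def sum_web_def scl_def nf_eq_iff congs)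
  show "nf (W a t b) = W a t b" "W a (nf t) b = W a t b"
    unfolding W_def by (simp add: tens) (metis congs nf_eq_iff tens_def)
qed

lemma nf_web:
  "nf (t \<^bold>\<circ> s) = t \<odot> s" "nf (s \<^bold>\<otimes> t) = s \<boxtimes> t" "nf (s \<^bold>+ t) = s \<oplus> t" "nf (r \<^bold>* t) = r \<star> t"
  by (simp_all add: cmp_def tens_def sum_web_def scl_def)

lemma nf_web_arg:
  "(t \<^bold>\<circ> s) \<odot> u = (t \<odot> s) \<odot> u" "u \<odot> (t \<^bold>\<circ> s) = u \<odot> (t \<odot> s)"
  "(t \<^bold>\<otimes> s) \<odot> u = (t \<boxtimes> s) \<odot> u" "u \<odot> (t \<^bold>\<otimes> s) = u \<odot> (t \<boxtimes> s)"
  "(t \<^bold>\<circ> s) \<boxtimes> u = (t \<odot> s) \<boxtimes> u" "u \<boxtimes> (t \<^bold>\<circ> s) = u \<boxtimes> (t \<odot> s)"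
  "(t \<^bold>\<otimes> s) \<boxtimes> u = (t \<boxtimes> s) \<boxtimes> u" "u \<boxtimes> (t \<^bold>\<otimes> s) = u \<boxtimes> (t \<boxtimes> s)"
  "W a (t \<^bold>\<circ> s) b = W a (t \<odot> s) b" "W a (t \<^bold>\<otimes> s) b = W a (t \<boxtimes> s) b"
  by (metis nf_ops nf_web)+

lemma cmp_assoc: "(u \<odot> t) \<odot> s = u \<odot> t \<odot> s"
proof -
  have "nf ((u \<^bold>\<circ> t) \<^bold>\<circ> s) = nf (u \<^bold>\<circ> (t \<^bold>\<circ> s))"
    by (rule nf_eqI) (auto simp: typed_simps web_in_iff intro!: cat_eq.sym[OF cat_eq.comp_assoc])
  then show ?thesis by (simp add: nf_web) (metis nf_ops nf_web)
qed

lemma tens_assoc: "(s \<boxtimes> t) \<boxtimes> u = s \<boxtimes> t \<boxtimes> u"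
proof -
  have "nf ((s \<^bold>\<otimes> t) \<^bold>\<otimes> u) = nf (s \<^bold>\<otimes> (t \<^bold>\<otimes> u))"
    using cat_eq.sym[OF cat_eq.tens_assoc, of False n s "source s" "target s" t "source t" "target
        t" u "source u" "target u"]
    by (intro nf_eqI) (auto simp: typed_simps web_in_iff)
  then show ?thesis by (simp add: nf_web) (metis nf_ops nf_web)
qed

text \<open>The hypothesis cannot be dropped: $(t \otimes t') \circ (s \otimes s')$ can be well typed although the two
factors of $t \circ s$ do not match.\<close>

lemma interchange:
  assumes "target s = source t"
  shows "(t \<odot> s) \<boxtimes> (t' \<odot> s') = (t \<boxtimes> t') \<odot> (s \<boxtimes> s')"
proof -
  have "nf ((t \<^bold>\<circ> s) \<^bold>\<otimes> (t' \<^bold>\<circ> s')) = nf ((t \<^bold>\<otimes> t') \<^bold>\<circ> (s \<^bold>\<otimes> s'))"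
    using cat_eq.interchange[of False n s "source s" "target s" t "target t" s' "source s'"
        "target s'" t' "target t'"] assms
    by (intro nf_eqI) (auto simp: typed_simps web_in_iff)
  then show ?thesis by (simp add: nf_web) (metis nf_ops nf_web)
qed

lemma cmp_strands: "source x = a \<Longrightarrow> x \<odot> Strands a = nf x"
  unfolding cmp_def
  by (rule nf_eqI)
    (auto simp: typed_simps web_in_iff dest: typed_labels[THEN subsetD] intro!: cat_eq.comp_id_right)

lemma strands_cmp: "target x = a \<Longrightarrow> Strands a \<odot> x = nf x"
  unfolding cmp_def
  by (rule nf_eqI)
    (auto simp: typed_simps web_in_iff dest: typed_labels[THEN subsetD] intro!: cat_eq.comp_id_left)

lemma strands_nil_tens: "Strands [] \<boxtimes> x = nf x"
  unfolding tens_def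
  by (rule nf_eqI) (auto simp: typed_simps web_in_iff intro!: cat_eq.tens_unit_left)

lemma tens_strands_nil: "x \<boxtimes> Strands [] = nf x"
  unfolding tens_def
  by (rule nf_eqI) (auto simp: typed_simps web_in_iff intro!: cat_eq.tens_unit_right)

lemma strands_tens: "Strands a \<boxtimes> Strands b = nf (Strands (a @ b))"
  unfolding tens_def
  by (rule nf_eqI) (auto simp: typed_simps web_in_iff intro!: cat_eq.tens_id)

lemma add_commute: "x \<oplus> y = y \<oplus> x"
  unfolding sum_web_def
  by (rule nf_eqI) (auto simp: typed_simps web_in_iff intro!: cat_eq.add_commute)

lemma add_assoc: "(x \<oplus> y) \<oplus> z = x \<oplus> (y \<oplus> z)"
proof -
  have "nf ((x \<^bold>+ y) \<^bold>+ z) = nf (x \<^bold>+ (y \<^bold>+ z))"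
    by (rule nf_eqI) (auto simp: typed_simps web_in_iff intro!: cat_eq.add_assoc)
  then show ?thesis by (simp add: nf_web) (metis nf_ops nf_web)
qed

lemma add_left_commute: "x \<oplus> (y \<oplus> z) = y \<oplus> (x \<oplus> z)"
  by (metis add_assoc add_commute)

lemma scl_one: "1 \<star> x = nf x"
  unfolding scl_def
  by (rule nf_eqI) (auto simp: typed_simps web_in_iff intro!: cat_eq.scale_one)

lemma scl_scl: "r \<star> r' \<star> x = (r * r') \<star> x"
proof -
  have "nf (r \<^bold>* r' \<^bold>* x) = nf ((r * r') \<^bold>* x)"
    by (rule nf_eqI) (auto simp: typed_simps web_in_iff intro!: cat_eq.scale_scale)
  then show ?thesis by (simp add: nf_web) (metis nf_ops nf_web)
qed

lemma scl_add_scalar: "(r + r') \<star> x = r \<star> x \<oplus> r' \<star> x"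
proof -
  have "nf ((r + r') \<^bold>* x) = nf (r \<^bold>* x \<^bold>+ r' \<^bold>* x)"
    by (rule nf_eqI) (auto simp: typed_simps web_in_iff intro!: cat_eq.scale_add_scalar)
  then show ?thesis by (simp add: nf_web) (metis nf_ops nf_web)
qed

lemma scl_add: "r \<star> (x \<oplus> y) = r \<star> x \<oplus> r \<star> y"
proof -
  have "nf (r \<^bold>* (x \<^bold>+ y)) = nf (r \<^bold>* x \<^bold>+ r \<^bold>* y)"
    by (rule nf_eqI) (auto simp: typed_simps web_in_iff intro!: cat_eq.scale_add)
  then show ?thesis by (simp add: nf_web) (metis nf_ops nf_web)
qed

lemma cmp_add_left: "(x \<oplus> y) \<odot> z = x \<odot> z \<oplus> y \<odot> z"
proof -
  have "nf ((x \<^bold>+ y) \<^bold>\<circ> z) = nf (x \<^bold>\<circ> z \<^bold>+ y \<^bold>\<circ> z)"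
    by (rule nf_eqI) (auto simp: typed_simps web_in_iff intro!: cat_eq.comp_add_left)
  then show ?thesis by (simp add: nf_web) (metis nf_ops nf_web)
qed

lemma cmp_add_right: "z \<odot> (x \<oplus> y) = z \<odot> x \<oplus> z \<odot> y"
proof -
  have "nf (z \<^bold>\<circ> (x \<^bold>+ y)) = nf (z \<^bold>\<circ> x \<^bold>+ z \<^bold>\<circ> y)"
    by (rule nf_eqI) (auto simp: typed_simps web_in_iff intro!: cat_eq.comp_add_right)
  then show ?thesis by (simp add: nf_web) (metis nf_ops nf_web)
qed

lemma cmp_scl_left: "(r \<star> x) \<odot> z = r \<star> (x \<odot> z)"
proof -
  have "nf ((r \<^bold>* x) \<^bold>\<circ> z) = nf (r \<^bold>* (x \<^bold>\<circ> z))"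
    by (rule nf_eqI) (auto simp: typed_simps web_in_iff intro!: cat_eq.comp_scale_left)
  then show ?thesis by (simp add: nf_web) (metis nf_ops nf_web)
qed

lemma cmp_scl_right: "z \<odot> (r \<star> x) = r \<star> (z \<odot> x)"
proof -
  have "nf (z \<^bold>\<circ> (r \<^bold>* x)) = nf (r \<^bold>* (z \<^bold>\<circ> x))"
    by (rule nf_eqI) (auto simp: typed_simps web_in_iff intro!: cat_eq.comp_scale_right)
  then show ?thesis by (simp add: nf_web) (metis nf_ops nf_web)
qed

lemma tens_add: "(x \<oplus> y) \<boxtimes> z = x \<boxtimes> z \<oplus> y \<boxtimes> z" "z \<boxtimes> (x \<oplus> y) = z \<boxtimes> x \<oplus> z \<boxtimes> y"
proof -
  have "nf ((x \<^bold>+ y) \<^bold>\<otimes> z) = nf (x \<^bold>\<otimes> z \<^bold>+ y \<^bold>\<otimes> z)"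
    by (rule nf_eqI) (auto simp: typed_simps web_in_iff intro!: cat_eq.tens_add_left)
  then show "(x \<oplus> y) \<boxtimes> z = x \<boxtimes> z \<oplus> y \<boxtimes> z" by (simp add: nf_web) (metis nf_ops nf_web)
  have "nf (z \<^bold>\<otimes> (x \<^bold>+ y)) = nf (z \<^bold>\<otimes> x \<^bold>+ z \<^bold>\<otimes> y)"
    by (rule nf_eqI) (auto simp: typed_simps web_in_iff intro!: cat_eq.tens_add_right)
  then show "z \<boxtimes> (x \<oplus> y) = z \<boxtimes> x \<oplus> z \<boxtimes> y" by (simp add: nf_web) (metis nf_ops nf_web)
qed

lemma tens_scl: "(r \<star> x) \<boxtimes> z = r \<star> (x \<boxtimes> z)" "z \<boxtimes> (r \<star> x) = r \<star> (z \<boxtimes> x)"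
proof -
  have "nf ((r \<^bold>* x) \<^bold>\<otimes> z) = nf (r \<^bold>* (x \<^bold>\<otimes> z))"
    by (rule nf_eqI) (auto simp: typed_simps web_in_iff intro!: cat_eq.tens_scale_left)
  then show "(r \<star> x) \<boxtimes> z = r \<star> (x \<boxtimes> z)" by (simp add: nf_web) (metis nf_ops nf_web)
  have "nf (z \<^bold>\<otimes> (r \<^bold>* x)) = nf (r \<^bold>* (z \<^bold>\<otimes> x))"
    by (rule nf_eqI) (auto simp: typed_simps web_in_iff intro!: cat_eq.tens_scale_right)
  then show "z \<boxtimes> (r \<star> x) = r \<star> (z \<boxtimes> x)" by (simp add: nf_web) (metis nf_ops nf_web)
qed

(* Labels are written as 1 and Suc j throughout, so 1 must not become Suc 0. *)
declare One_nat_def [simp del]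

lemma W_nil_left: "W [] x r = x \<boxtimes> Strands r"
  and W_nil_right: "W l x [] = Strands l \<boxtimes> x"
  and W_nil: "W [] x [] = nf x"
  by (simp_all add: W_def strands_nil_tens tens_strands_nil)

lemma W_W: "W l (W l' x r') r = W (l @ l') x (r' @ r)"
proof -
  have "W l (W l' x r') r = (Strands l \<boxtimes> Strands l') \<boxtimes> x \<boxtimes> (Strands r' \<boxtimes> Strands r)"
    by (simp add: W_def tens_assoc)
  then show ?thesis by (simp add: W_def strands_tens)
qed

lemma strands_idem: "Strands a \<odot> Strands a = nf (Strands a)"
  by (rule cmp_strands) simp

lemma W_cmp: "W l (x \<odot> y) r = W l x r \<odot> W l y r"
proof -
  have "(x \<odot> y) \<boxtimes> Strands r = (x \<boxtimes> Strands r) \<odot> (y \<boxtimes> Strands r)"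
  proof (cases "target y = source x")
    case True
    then show ?thesis using interchange[of y x "Strands r" "Strands r"] strands_idem by simp
  next
    case False
    \<comment> \<open>Both sides are ill typed.\<close>
    then have "nf ((x \<^bold>\<circ> y) \<^bold>\<otimes> Strands r) = nf ((x \<^bold>\<otimes> Strands r) \<^bold>\<circ> (y \<^bold>\<otimes> Strands r))"
      by (intro nf_eqI) (auto simp: typed_simps)
    then show ?thesis by (simp add: nf_web nf_web_arg)
  qed
  then show ?thesis
    using interchange[of "Strands l" "Strands l" "x \<boxtimes> Strands r" "y \<boxtimes> Strands r"] strands_idem
    by (simp add: W_def)
qed

lemma W_add: "W l (x \<oplus> y) r = W l x r \<oplus> W l y r"
  and W_scl: "W l (a \<star> x) r = a \<star> W l x r"
  by (simp_all add: W_def tens_add tens_scl)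

lemma W_strands: "W l (Strands m) r = nf (Strands (l @ m @ r))"
  by (simp add: W_def strands_tens)

text \<open>Two webs side by side can be slid past each other.  For whiskered generators this is the
content of the interchange law.\<close>

lemma exchange:
  "W (l @ target x @ m) y r \<odot> W l x (m @ source y @ r)
   = W l x (m @ target y @ r) \<odot> W (l @ source x @ m) y r"
proof -
  let ?y = "Strands m \<^bold>\<otimes> y"
  have "(Strands (target x) \<boxtimes> ?y) \<odot> (x \<boxtimes> Strands (source ?y)) = x \<boxtimes> ?y"
    by (subst interchange[symmetric]) (simp_all add: strands_cmp cmp_strands)
  moreover have "(x \<boxtimes> Strands (target ?y)) \<odot> (Strands (source x) \<boxtimes> ?y) = x \<boxtimes> ?y"
    by (subst interchange[symmetric]) (simp_all add: strands_cmp cmp_strands)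
  ultimately have "W (target x) ?y [] \<odot> W [] x (source ?y) = W [] x (target ?y) \<odot> W (source x) ?y []"
    by (simp add: W_nil_left W_nil_right)
  then have "W l (W (target x) ?y [] \<odot> W [] x (source ?y)) r
      = W l (W [] x (target ?y) \<odot> W (source x) ?y []) r"
    by simp
  moreover have "W a ?y b = W (a @ m) y b" for a b
    using W_W[of a m y "[]" b] by (simp add: W_nil_right tens_def)
  ultimately show ?thesis by (simp add: W_cmp W_W)
qed

lemma W_strands_cmp: "a = l @ target x @ r \<Longrightarrow> Strands a \<odot> W l x r = W l x r"
  and W_cmp_strands: "a = l @ source x @ r \<Longrightarrow> W l x r \<odot> Strands a = W l x r"
proof -
  assume "a = l @ target x @ r"
  then have "nf (Strands a) = W l (Strands (target x)) r"
    by (simp add: W_strands)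
  then show "Strands a \<odot> W l x r = W l x r"
    by (metis W_cmp nf_ops(1) nf_ops(13) strands_cmp)
next
  assume "a = l @ source x @ r"
  then have "nf (Strands a) = W l (Strands (source x)) r"
    by (simp add: W_strands)
  then show "W l x r \<odot> Strands a = W l x r"
    by (metis W_cmp nf_ops(2) nf_ops(13) cmp_strands)
qed

lemma W_strands_cmp': "a = l @ target x @ r \<Longrightarrow> Strands a \<odot> W l x r \<odot> y = W l x r \<odot> y"
  by (metis W_strands_cmp cmp_assoc)

text \<open>Products are nested to the right; this lets an equation rewrite an initial part of a longer product.\<close>

lemma precomp: "x \<odot> y = z \<Longrightarrow> x \<odot> y \<odot> w = z \<odot> w"
  by (metis cmp_assoc)

lemma precomp3: "x \<odot> y \<odot> z = u \<Longrightarrow> x \<odot> y \<odot> z \<odot> w = u \<odot> w"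
  by (metis cmp_assoc)

lemma whisker: "x = y \<Longrightarrow> W l x r = W l y r"
  by simp

lemma nf_typed: "ty (nf x) \<longleftrightarrow> ty x"
  and source_nf: "ty x \<Longrightarrow> source (nf x) = source x"
  and target_nf: "ty x \<Longrightarrow> target (nf x) = target x"
  using eqv_nf[of x] web_equal_typed unfolding eqv_def by blast+

lemma typed_ops:
  "ty (x \<odot> y) \<longleftrightarrow> ty x \<and> ty y \<and> target y = source x"
  "ty (x \<boxtimes> y) \<longleftrightarrow> ty x \<and> ty y"
  "ty (x \<oplus> y) \<longleftrightarrow> ty x \<and> ty y \<and> source x = source y \<and> target x = target y"
  "ty (r \<star> x) \<longleftrightarrow> ty x"
  "ty (W a x b) \<longleftrightarrow> ty x \<and> set a \<subseteq> {1..n} \<and> set b \<subseteq> {1..n}"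
  by (auto simp: cmp_def tens_def sum_web_def scl_def W_def nf_typed typed_simps)

lemma source_target_ops:
  "ty (x \<odot> y) \<Longrightarrow> source (x \<odot> y) = source y" "ty (x \<odot> y) \<Longrightarrow> target (x \<odot> y) = target x"
  "ty (x \<boxtimes> y) \<Longrightarrow> source (x \<boxtimes> y) = source x @ source y"
  "ty (x \<boxtimes> y) \<Longrightarrow> target (x \<boxtimes> y) = target x @ target y"
  "ty (x \<oplus> y) \<Longrightarrow> source (x \<oplus> y) = source x" "ty (x \<oplus> y) \<Longrightarrow> target (x \<oplus> y) = target x"
  "ty (r \<star> x) \<Longrightarrow> source (r \<star> x) = source x" "ty (r \<star> x) \<Longrightarrow> target (r \<star> x) = target x"
  by (auto simp: cmp_def tens_def sum_web_def scl_def nf_typed source_nf target_nf)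

lemma source_target_W:
  "ty (W a x b) \<Longrightarrow> source (W a x b) = a @ source x @ b"
  "ty (W a x b) \<Longrightarrow> target (W a x b) = a @ target x @ b"
  by (auto simp: W_def source_target_ops typed_ops typed_simps)

text \<open>Being zero, without mention of the type; this makes it compatible with all the operations.\<close>

definition null :: "'r web \<Rightarrow> bool" where
  "null x \<longleftrightarrow> x = 0 \<star> x"

lemma null_scl_zero: "null (0 \<star> x)"
  by (simp add: null_def scl_scl)

lemma null_ops:
  "null x \<Longrightarrow> null (x \<odot> y)" "null y \<Longrightarrow> null (x \<odot> y)" "null x \<Longrightarrow> null (W l x r)"
  "null x \<Longrightarrow> null (r' \<star> x)" "null x \<Longrightarrow> null y \<Longrightarrow> null (x \<oplus> y)"
proof -
  show "null x \<Longrightarrow> null (x \<odot> y)" by (metis null_def cmp_scl_left null_scl_zero)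
  show "null y \<Longrightarrow> null (x \<odot> y)" by (metis null_def cmp_scl_right null_scl_zero)
  show "null x \<Longrightarrow> null (W l x r)" by (metis null_def W_scl null_scl_zero)
  show "null x \<Longrightarrow> null (r' \<star> x)" by (metis null_def scl_scl mult_zero_right null_scl_zero)
  show "null x \<Longrightarrow> null y \<Longrightarrow> null (x \<oplus> y)" by (metis null_def scl_add)
qed

lemma scl_zero:
  assumes "ty x" shows "0 \<star> x = nf (Zero (source x) (target x))"
proof -
  have "0 \<star> x = 1 \<star> x \<oplus> (-1) \<star> x" by (metis add.right_inverse scl_add_scalar)
  also have "\<dots> = nf (x \<^bold>+ (-1) \<^bold>* x)" by (simp add: scl_one nf_web) (metis nf_ops(8) nf_web(4))
  also have "\<dots> = nf (Zero (source x) (target x))"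
    using assms by (intro web_equal_nf[OF cat_eq.add_minus]) (simp add: web_in_iff)
  finally show ?thesis .
qed

lemma null_Zero: "null (nf (Zero a b))"
proof (cases "ty (Zero a b)")
  case True
  then show ?thesis using scl_zero[OF True] by (metis null_scl_zero source.simps(9) target.simps(9))
next
  case False
  then have "nf (Zero a b) = nf (0 \<^bold>* Zero a b)" by (intro nf_eqI) (auto simp: typed_simps)
  then show ?thesis by (simp add: null_def nf_web scl_scl)
qed

lemma add_null:
  assumes "null y" "ty x" "ty y" "source x = source y" "target x = target y"
  shows "x \<oplus> y = nf x"
proof -
  have "y = nf (Zero (source x) (target x))"
    using scl_zero[of y] assms unfolding null_def by simp
  then have "x \<oplus> y = nf (x \<^bold>+ Zero (source x) (target x))" by (simp add: nf_web)
  also have "\<dots> = nf x" using assms by (intro web_equal_nf[OF cat_eq.add_zero]) (simp add: web_in_iff)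
  finally show ?thesis .
qed

lemmas linear = cmp_add_left cmp_add_right cmp_scl_left cmp_scl_right W_add W_scl scl_add scl_scl
lemmas add_ac = add_assoc add_commute add_left_commute

section \<open>Cups, caps and vertices with possibly erased legs\<close>

text \<open>The object of a strand labelled \<open>j\<close>, which is the unit object for an erased strand.\<close>

definition obj :: "nat \<Rightarrow> nat list" where
  "obj j = (if j = 0 then [] else [j])"

definition cup0 :: "nat \<Rightarrow> 'r web" where
  "cup0 k = (if k = 0 then Strands [] else Cup k)"

lemma obj_simps [simp]: "obj 0 = []" "obj 1 = [1]" "obj (Suc j) = [Suc j]"
  by (simp_all add: obj_def)

text \<open>The labels admit a vertex as far as erased edges are concerned: a vertex with an erased leg is a strand.\<close>

definition legs :: "nat \<Rightarrow> nat \<Rightarrow> nat \<Rightarrow> bool" where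
  "legs a b c \<longleftrightarrow> (a = 0 \<longrightarrow> b = c) \<and> (b = 0 \<longrightarrow> a = c) \<and> (c = 0 \<longrightarrow> a = b)"

lemma legs_cases:
  assumes "legs a b c"
  obtains (first) "a = 0" "b = c" | (second) "b = 0" "a = c" | (third) "c = 0" "a = b" "a \<noteq> 0"
  | (none) "a \<noteq> 0" "b \<noteq> 0" "c \<noteq> 0"
  using assms unfolding legs_def by blast

lemma cup0_cap0_source_target [simp]:
  "source (cup0 k) = []" "target (cup0 k) = obj k @ obj k"
  "target (cap0 k) = []" "source (cap0 k) = obj k @ obj k"
  by (simp_all add: cup0_def cap0_def obj_def)

lemma merge0_split0_source_target [simp]:
  assumes "legs a b c"
  shows "source (merge0 a b c) = obj a @ obj b" "target (merge0 a b c) = obj c"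
    "source (split0 a b c) = obj c" "target (split0 a b c) = obj a @ obj b"
  using assms by (cases rule: legs_cases; simp add: merge0_def split0_def strand0_def obj_def)+

lemma zigzag_left: "W [] (cap0 k) (obj k) \<odot> W (obj k) (cup0 k) [] = nf (Strands (obj k))"
proof (cases "k = 0")
  case True
  then show ?thesis by (simp add: cap0_def cup0_def W_nil strands_idem)
next
  case False
  have "nf ((Cap k \<^bold>\<otimes> Strands [k]) \<^bold>\<circ> (Strands [k] \<^bold>\<otimes> Cup k)) = nf (Strands [k])"
  proof (cases "k \<in> {1..n}")
    case True
    then show ?thesis by (rule web_equal_nf[OF cat_eq.zigzag_left])
  qed (rule nf_eqI; simp add: typed_simps)
  with False show ?thesis
    by (simp add: cap0_def cup0_def obj_def W_nil_left W_nil_right nf_web nf_web_arg)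
qed

lemma zigzag_right: "W (obj k) (cap0 k) [] \<odot> W [] (cup0 k) (obj k) = nf (Strands (obj k))"
proof (cases "k = 0")
  case True
  then show ?thesis by (simp add: cap0_def cup0_def W_nil strands_idem)
next
  case False
  have "nf ((Strands [k] \<^bold>\<otimes> Cap k) \<^bold>\<circ> (Cup k \<^bold>\<otimes> Strands [k])) = nf (Strands [k])"
  proof (cases "k \<in> {1..n}")
    case True
    then show ?thesis by (rule web_equal_nf[OF cat_eq.zigzag_right])
  qed (rule nf_eqI; simp add: typed_simps)
  with False show ?thesis
    by (simp add: cap0_def cup0_def obj_def W_nil_left W_nil_right nf_web nf_web_arg)
qed

text \<open>The rotation axioms for vertices, extended to vertices with an erased leg: there the vertex is a strand,
cup or cap, and the rotation is a zigzag.\<close>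

lemma rotate_right:
  assumes "legs a b c"
  shows "W [] (merge0 a b c) (obj b) \<odot> W (obj a) (cup0 b) [] = nf (split0 c b a)"
  using assms
proof (cases rule: legs_cases)
  case first
  then show ?thesis
    by (simp add: merge0_def split0_def cup0_def strand0_def W_nil W_nil_left obj_def
        strands_tens strands_nil_tens tens_strands_nil cmp_strands strands_cmp)
next
  case second
  then show ?thesis
    by (simp add: merge0_def split0_def cup0_def strand0_def W_nil W_strands obj_def strands_idem)
next
  case third
  then show ?thesis
    using zigzag_left[of a] by (simp add: merge0_def split0_def strand0_def obj_def cap0_def)
next
  case none
  have "nf ((Merge a b c \<^bold>\<otimes> Strands [b]) \<^bold>\<circ> (Strands [a] \<^bold>\<otimes> Cup b)) = nf (Split c b a)"
  proof (cases "admissible n a b c")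
    case True
    then show ?thesis by (rule web_equal_nf[OF cat_eq.rotate_right])
  qed (rule nf_eqI; simp add: typed_simps admissible_rotate)
  with none show ?thesis
    by (simp add: merge0_def split0_def cup0_def obj_def W_nil_left W_nil_right nf_web nf_web_arg)
qed

lemma rotate_left:
  assumes "legs a b c"
  shows "W (obj a) (merge0 a b c) [] \<odot> W [] (cup0 a) (obj b) = nf (split0 a c b)"
using assms
proof (cases rule: legs_cases)
  case first
  then show ?thesis
    by (simp add: merge0_def split0_def cup0_def strand0_def W_nil W_strands obj_def strands_idem)
next
  case second
  then show ?thesis
    by (simp add: merge0_def split0_def cup0_def strand0_def W_nil W_nil_right obj_def
        strands_tens strands_nil_tens tens_strands_nil cmp_strands strands_cmp)
next
  case third
  then show ?thesis
    using zigzag_right[of a] by (simp add: merge0_def split0_def strand0_def obj_def cap0_def)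
next
  case none
  have "nf ((Strands [a] \<^bold>\<otimes> Merge a b c) \<^bold>\<circ> (Cup a \<^bold>\<otimes> Strands [b])) = nf (Split a c b)"
  proof (cases "admissible n a b c")
    case True
    then show ?thesis by (rule web_equal_nf[OF cat_eq.rotate_left])
  qed (rule nf_eqI; simp add: typed_simps admissible_rotate)
  with none show ?thesis
    by (simp add: merge0_def split0_def cup0_def obj_def W_nil_left W_nil_right nf_web nf_web_arg)
qed

text \<open>Straightening the bent leg of a rotated vertex by a zigzag gives the vertex back.\<close>

lemma unrotate_right:
  assumes abc: "legs a b c"
  shows "W (obj c) (cap0 b) [] \<odot> W [] (split0 c b a) (obj b) = nf (merge0 a b c)"
proof -
  have 1: "W [] (split0 c b a) (obj b) = W [] (merge0 a b c) (obj b @ obj b)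
      \<odot> W (obj a) (cup0 b) (obj b)"
    using whisker[OF rotate_right[OF abc], of "[]" "obj b"] by (simp add: W_cmp W_W)
  have 2: "W (obj c) (cap0 b) [] \<odot> W [] (merge0 a b c) (obj b @ obj b)
      = W [] (merge0 a b c) [] \<odot> W (obj a @ obj b) (cap0 b) []"
    using exchange[of "[]" "merge0 a b c" "[]" "cap0 b" "[]"] abc by simp
  have 3: "W (obj a @ obj b) (cap0 b) [] \<odot> W (obj a) (cup0 b) (obj b) = nf (Strands (obj a @ obj b))"
    using whisker[OF zigzag_right[of b], of "obj a" "[]"] by (simp add: W_cmp W_W W_strands)
  show ?thesis
    using abc by (simp only: 1 precomp[OF 2] cmp_assoc 3) (simp add: W_nil cmp_strands)
qed

lemma unrotate_left:
  assumes abc: "legs a b c"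
  shows "W [] (cap0 a) (obj c) \<odot> W (obj a) (split0 a c b) [] = nf (merge0 a b c)"
proof -
  have 1: "W (obj a) (split0 a c b) [] = W (obj a @ obj a) (merge0 a b c) []
      \<odot> W (obj a) (cup0 a) (obj b)"
    using whisker[OF rotate_left[OF abc], of "obj a" "[]"] by (simp add: W_cmp W_W)
  have 2: "W [] (cap0 a) (obj c) \<odot> W (obj a @ obj a) (merge0 a b c) []
      = W [] (merge0 a b c) [] \<odot> W [] (cap0 a) (obj a @ obj b)"
    using exchange[of "[]" "cap0 a" "[]" "merge0 a b c" "[]"] abc by simp
  have 3: "W [] (cap0 a) (obj a @ obj b) \<odot> W (obj a) (cup0 a) (obj b) = nf (Strands (obj a @ obj b))"
    using whisker[OF zigzag_left[of a], of "[]" "obj b"] by (simp add: W_cmp W_W W_strands)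
  show ?thesis
    using abc by (simp only: 1 precomp[OF 2] cmp_assoc 3) (simp add: W_nil cmp_strands)
qed

section \<open>Turning vertices by caps and cups\<close>

lemma legs_permute:
  assumes "legs a b c"
  shows "legs a c b" "legs b a c" "legs b c a" "legs c a b" "legs c b a"
  using assms unfolding legs_def by blast+

text \<open>Both sides are the vertex with its three legs bent down; they differ only in the leg that goes around.\<close>

lemma cap_cyclic:
  assumes abc: "legs a b c"
  shows "cap0 c \<odot> W [] (merge0 a b c) (obj c) = cap0 a \<odot> W (obj a) (merge0 b c a) []"
proof -
  note perm = legs_permute[OF abc]
  have 1: "W [] (merge0 a b c) (obj c) = W [] (cap0 a) (obj c @ obj c)
      \<odot> W (obj a) (split0 a c b) (obj c)"
    using whisker[OF unrotate_left[OF abc], of "[]" "obj c"] by (simp add: W_cmp W_W)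
  have 2: "W (obj a) (merge0 b c a) [] = W (obj a @ obj a) (cap0 c) []
      \<odot> W (obj a) (split0 a c b) (obj c)"
    using whisker[OF unrotate_right[OF perm(3)], of "obj a" "[]"] by (simp add: W_cmp W_W)
  have 3: "cap0 c \<odot> W [] (cap0 a) (obj c @ obj c) = cap0 a \<odot> W (obj a @ obj a) (cap0 c) []"
    using exchange[of "[]" "cap0 a" "[]" "cap0 c" "[]"] by (simp add: W_nil)
  show ?thesis by (simp only: 1 2 precomp[OF 3] cmp_assoc)
qed

lemma cup_cyclic:
  assumes abc: "legs a b c"
  shows "W [] (split0 c b a) (obj a) \<odot> cup0 a = W (obj c) (split0 b a c) [] \<odot> cup0 c"
proof -
  note perm = legs_permute[OF abc]
  have 1: "W [] (split0 c b a) (obj a) = W (obj c) (merge0 c a b) (obj a)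
      \<odot> W [] (cup0 c) (obj a @ obj a)"
    using whisker[OF rotate_left[OF perm(4)], of "[]" "obj a"] by (simp add: W_cmp W_W)
  have 2: "W (obj c) (split0 b a c) [] = W (obj c) (merge0 c a b) (obj a)
      \<odot> W (obj c @ obj c) (cup0 a) []"
    using whisker[OF rotate_right[OF perm(4)], of "obj c" "[]"] by (simp add: W_cmp W_W)
  have 3: "W [] (cup0 c) (obj a @ obj a) \<odot> cup0 a = W (obj c @ obj c) (cup0 a) [] \<odot> cup0 c"
    using exchange[of "[]" "cup0 c" "[]" "cup0 a" "[]"] by (simp add: W_nil)
  show ?thesis by (simp only: 1 2 3 cmp_assoc)
qed

text \<open>Bending down the top leg of a merging vertex turns it into the splitting vertex below two nested caps.
This is how relations between merges are carried over to relations between splits.\<close>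

lemma cap_merge:
  assumes abc: "legs a b c"
  shows "cap0 c \<odot> W [] (merge0 a b c) (obj c)
    = cap0 a \<odot> W (obj a) (cap0 b) (obj a) \<odot> W (obj a @ obj b) (split0 b a c) []"
proof -
  have "W (obj a) (merge0 b c a) [] = W (obj a) (cap0 b) (obj a) \<odot> W (obj a @ obj b) (split0 b a c) []"
    using whisker[OF unrotate_left[OF legs_permute(3)[OF abc]], of "obj a" "[]"]
        by (simp add: W_cmp W_W)
  with cap_cyclic[OF abc] show ?thesis by simp
qed

lemma cap_merge':
  assumes abc: "legs a b c"
  shows "cap0 c \<odot> W (obj c) (merge0 a b c) []
    = cap0 b \<odot> W (obj b) (cap0 a) (obj b) \<odot> W [] (split0 b a c) (obj a @ obj b)"
proof -
  have "W [] (merge0 c a b) (obj b) = W (obj b) (cap0 a) (obj b) \<odot> W [] (split0 b a c) (obj a @ obj b)"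
    using whisker[OF unrotate_right[OF legs_permute(4)[OF abc]], of "[]" "obj b"]
        by (simp add: W_cmp W_W)
  with cap_cyclic[OF legs_permute(4)[OF abc]] show ?thesis by simp
qed

text \<open>Bending down the leftmost top endpoint is injective, since a cup bends it up again.\<close>

lemma cap_cancel:
  assumes "source G = source G'" "target G = obj x @ r" "target G' = obj x @ r"
    and eq: "W [] (cap0 x) r \<odot> W (obj x) G [] = W [] (cap0 x) r \<odot> W (obj x) G' []"
  shows "nf G = nf G'"
proof -
  have unbend: "W (obj x) (W [] (cap0 x) r \<odot> W (obj x) G []) [] \<odot> W [] (cup0 x) (source G) = nf G"
    if G: "target G = obj x @ r" for G
  proof -
    have 1: "W (obj x @ obj x) G [] \<odot> W [] (cup0 x) (source G) = W [] (cup0 x) (obj x @ r) \<odot> G"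
      using exchange[of "[]" "cup0 x" "[]" G "[]"] G by (simp add: W_nil)
    have 2: "W (obj x) (cap0 x) r \<odot> W [] (cup0 x) (obj x @ r) = nf (Strands (obj x @ r))"
      using whisker[OF zigzag_right[of x], of "[]" r] by (simp add: W_cmp W_W W_strands)
    show ?thesis
      using G by (simp add: W_cmp W_W cmp_assoc 1 precomp[OF 2] strands_cmp)
  qed
  show ?thesis using unbend[OF assms(2)] unbend[OF assms(3)] eq assms(1) by metis
qed

section \<open>Strands labelled 1 next to another strand\<close>

text \<open>The vertices through which a strand $1$ joins or leaves a strand \<open>j\<close> on its left or right.\<close>

definition mL :: "nat \<Rightarrow> 'r web" where "mL j = merge0 1 j (Suc j)"
definition mR :: "nat \<Rightarrow> 'r web" where "mR j = merge0 j 1 (Suc j)"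
definition sL :: "nat \<Rightarrow> 'r web" where "sL j = split0 1 j (Suc j)"
definition sR :: "nat \<Rightarrow> 'r web" where "sR j = split0 j 1 (Suc j)"
definition cu :: "'r web" where "cu = Cup 1"
definition ca :: "'r web" where "ca = Cap 1"

lemma legs_Suc: "legs 1 j (Suc j)" "legs j 1 (Suc j)" "legs (Suc j) 1 j" "legs 1 (Suc j) j"
  "legs j (Suc j) 1" "legs (Suc j) j 1"
  by (auto simp: legs_def)

lemma source_target_vertices [simp]:
  "source (mL j) = 1 # obj j" "target (mL j) = [Suc j]" "source (mR j) = obj j @ [1]" "target (mR
      j) = [Suc j]"
  "target (sL j) = 1 # obj j" "source (sL j) = [Suc j]" "target (sR j) = obj j @ [1]" "source (sR
      j) = [Suc j]"
  "source cu = []" "target cu = [1, 1]" "source ca = [1, 1]" "target ca = []"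
  by (simp_all add: mL_def mR_def sL_def sR_def cu_def ca_def legs_Suc)

lemma cap0_1: "cap0 1 = ca" and cup0_1: "cup0 1 = cu"
  by (simp_all add: cap0_def cup0_def ca_def cu_def)

lemma typed_vertices [simp]:
  "ty (mL j) \<longleftrightarrow> Suc j \<le> n" "ty (mR j) \<longleftrightarrow> Suc j \<le> n" "ty (sL j) \<longleftrightarrow> Suc j \<le> n" "ty (sR j) \<longleftrightarrow> Suc j \<le> n"
  "ty cu" "ty ca"
proof -
  have "admissible n 1 j (Suc j) \<longleftrightarrow> Suc j \<le> n" if "j \<noteq> 0"
    using that admissible_vertex(1)[of j n] admissible_labels[of n 1 j "Suc j"] by auto
  moreover have "admissible n j 1 (Suc j) \<longleftrightarrow> admissible n 1 j (Suc j)"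
    by (rule admissible_rotate)
  ultimately show "ty (mL j) \<longleftrightarrow> Suc j \<le> n" "ty (mR j) \<longleftrightarrow> Suc j \<le> n" "ty (sL j) \<longleftrightarrow> Suc j \<le> n" "ty (sR
      j) \<longleftrightarrow> Suc j \<le> n"
    using n_pos by (simp_all add: mL_def mR_def sL_def sR_def merge0_def split0_def strand0_def
        typed_simps)
  show "ty cu" "ty ca" using n_pos by (simp_all add: cu_def ca_def typed_simps)
qed

lemma cap0_labels: "ty (cap0 j) \<longleftrightarrow> j \<le> n"
  by (auto simp: cap0_def typed_simps)

lemma obj_labels: "set (obj j) \<subseteq> {1..n} \<longleftrightarrow> j \<le> n"
  by (auto simp: obj_def)

lemma web_rel_nf: "web_rel n q a b s t \<Longrightarrow> nf s = nf t"
  by (rule web_equal_nf) (rule cat_eq.relation)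

lemma merge_assoc:
  assumes "Suc (Suc j) \<le> n"
  shows "mR (Suc j) \<odot> W [] (mL j) [1] = mL (Suc j) \<odot> W [1] (mR j) []"
proof (cases "j = 0")
  case True
  then show ?thesis
    by (simp add: mL_def mR_def merge0_def strand0_def W_strands One_nat_def[symmetric])
next
  case False
  then have "nf (Merge (j + 1) 1 (j + 2) \<^bold>\<circ> (Merge 1 j (j + 1) \<^bold>\<otimes> Strands [1]))
     = nf (Merge 1 (j + 1) (j + 2) \<^bold>\<circ> (Strands [1] \<^bold>\<otimes> Merge j 1 (j + 1)))"
    using assms by (intro web_rel_nf[OF web_rel.assoc]) auto
  with False show ?thesis
    by (simp add: mL_def mR_def merge0_def W_nil_left W_nil_right nf_web nf_web_arg flip: Suc_eq_plus1)
qed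

lemma bigon_left:
  assumes "Suc j \<le> n"
  shows "mL j \<odot> sL j = qint q (Suc j) \<star> Strands [Suc j]"
proof -
  have "nf (merge0 1 (Suc j - 1) (Suc j) \<^bold>\<circ> split0 1 (Suc j - 1) (Suc j)) = nf (qint q (Suc j) \<^bold>*
      Strands [Suc j])"
    using assms by (intro web_rel_nf[OF web_rel.bigon]) auto
  then show ?thesis by (simp add: mL_def sL_def nf_web)
qed

text \<open>The mirror image of the bigon relation is the same relation turned by 180 degrees: capped off, both
become the two splitting vertices side by side below nested caps.\<close>

lemma bigon_right:
  assumes "Suc j \<le> n"
  shows "mR j \<odot> sR j = qint q (Suc j) \<star> Strands [Suc j]"
proof -
  let ?c = "Suc j"
  have "W [] (cap0 ?c) [] \<odot> W (obj ?c) (mR j \<odot> sR j) []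
      = W [] (cap0 ?c) [] \<odot> W (obj ?c) (qint q (Suc j) \<star> Strands [Suc j]) []"
  proof -
    have 1: "cap0 ?c \<odot> W [?c] (mR j) [] = ca \<odot> W [1] (cap0 j) [1] \<odot> W [] (sL j) (obj j @ [1])"
      using cap_merge'[OF legs_Suc(2), of j] by (simp add: mR_def sL_def cap0_1)
    have 2: "W [] (sL j) (obj j @ [1]) \<odot> W [?c] (sR j) [] = W (1 # obj j) (sR j) [] \<odot> W [] (sL j) [?c]"
      using exchange[of "[]" "sL j" "[]" "sR j" "[]"] by simp
    have 3: "cap0 ?c \<odot> W [] (mL j) [?c] = ca \<odot> W [1] (cap0 j) [1] \<odot> W (1 # obj j) (sR j) []"
      using cap_merge[OF legs_Suc(1), of j] by (simp add: mL_def sR_def cap0_1)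
    have 4: "W [] (mL j) [?c] \<odot> W [] (sL j) [?c] = qint q ?c \<star> W [] (Strands [?c]) [?c]"
      using whisker[OF bigon_left[OF assms], of "[]" "[?c]"] by (simp add: W_cmp W_scl)
    have "cap0 ?c \<odot> W [?c] (mR j) [] \<odot> W [?c] (sR j) [] = cap0 ?c \<odot> W [] (mL j) [?c] \<odot> W [] (sL j) [?c]"
      by (simp add: precomp[OF 1] precomp[OF 3] cmp_assoc 2)
    then show ?thesis by (simp add: W_nil W_cmp 4 linear W_strands cmp_strands)
  qed
  then have "nf (mR j \<odot> sR j) = nf (qint q (Suc j) \<star> Strands [Suc j])"
    using assms by (intro cap_cancel[where r = "[]" and x = ?c])
      (auto simp: typed_ops typed_simps source_target_ops)
  then show ?thesis by simp
qed

text \<open>The triple application of \<open>cap_cancel\<close> to three nested caps.\<close>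

lemma nested_cap_cancel:
  assumes ty: "ty X" "ty Y" "source X = source Y" "target X = 1 # obj j @ [1]" "target Y = 1 # obj
      j @ [1]"
    and eq: "ca \<odot> W [1] (cap0 j) [1] \<odot> W (1 # obj j) ca (obj j @ [1]) \<odot> W (1 # obj j @ [1]) X []
      = ca \<odot> W [1] (cap0 j) [1] \<odot> W (1 # obj j) ca (obj j @ [1]) \<odot> W (1 # obj j @ [1]) Y []"
  shows "nf X = nf Y"
proof -
  let ?f = "\<lambda>Z. W [] ca (obj j @ [1]) \<odot> W [1] Z []"
  let ?g = "\<lambda>Z. W [] (cap0 j) [1] \<odot> W (obj j) (?f Z) []"
  have j: "j \<le> n" using typed_labels(2)[OF ty(1)] ty by (auto simp: obj_def split: if_splits)
  have f: "ty (?f Z) \<and> source (?f Z) = 1 # source Z \<and> target (?f Z) = obj j @ [1]"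
    if "ty Z" "target Z = 1 # obj j @ [1]" for Z
  proof -
    have "ty (W [] ca (obj j @ [1]))" "ty (W [1] Z [])"
      using that j n_pos by (simp_all add: typed_ops obj_labels)
    moreover from this have "ty (?f Z)" using that by (simp add: typed_ops source_target_W)
    ultimately show ?thesis using that by (simp add: source_target_ops source_target_W)
  qed
  have g: "ty (?g Z) \<and> source (?g Z) = obj j @ 1 # source Z \<and> target (?g Z) = [1]"
    if Z: "ty Z" "target Z = 1 # obj j @ [1]" for Z
  proof -
    have "ty (W [] (cap0 j) [1])" "ty (W (obj j) (?f Z) [])"
      using f[OF Z] j n_pos by (simp_all add: typed_ops(5) obj_labels cap0_labels)
    moreover from this have "ty (?g Z)" using f[OF Z] by (simp add: typed_ops(1) source_target_W)
    ultimately show ?thesis using f[OF Z] by (simp add: source_target_ops(1,2) source_target_W)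
  qed
  have "nf (?g X) = nf (?g Y)"
    using g[of X] g[of Y] ty eq
    by (intro cap_cancel[where x = 1 and r = "[]"]) (simp_all add: cap0_1 W_nil W_cmp W_W)
  then have "nf (?f X) = nf (?f Y)"
    using f[of X] f[of Y] ty by (intro cap_cancel[where x = j and r = "[1]"]) simp_all
  then show "nf X = nf Y"
    using ty by (intro cap_cancel[where x = 1 and r = "obj j @ [1]"]) (simp_all add: cap0_1)
qed

text \<open>The associativity relation turned by 180 degrees: bending down the top endpoint of each of its two sides
gives three nested caps on top of the corresponding side of the claim.\<close>

lemma split_coassoc:
  assumes d: "Suc (Suc j) \<le> n"
  shows "W [] (sL j) [1] \<odot> sR (Suc j) = W [1] (sR j) [] \<odot> sL (Suc j)"
proof -
  let ?k = "Suc j" and ?d = "Suc (Suc j)"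
  let ?L = "W [] (sL j) [1] \<odot> sR ?k" and ?R = "W [1] (sR j) [] \<odot> sL ?k"
  have nest: "cap0 ?d \<odot> W [] (mR ?k) [?d] \<odot> W [] (mL j) [1, ?d]
     = ca \<odot> W [1] (cap0 j) [1] \<odot> W (1 # obj j) ca (obj j @ [1]) \<odot> W (1 # obj j @ [1]) ?R []"
  proof -
    have 1: "cap0 ?d \<odot> W [] (mR ?k) [?d] = cap0 ?k \<odot> W [?k] ca [?k] \<odot> W [?k, 1] (sL ?k) []"
      using cap_merge[OF legs_Suc(2), of ?k] by (simp add: mR_def sL_def cap0_1)
    have 2: "W [?k, 1] (sL ?k) [] \<odot> W [] (mL j) [1, ?d] = W [] (mL j) [1, 1, ?k]
        \<odot> W (1 # obj j @ [1]) (sL ?k) []"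
      using exchange[of "[]" "mL j" "[1]" "sL ?k" "[]"] by simp
    have 3: "W [?k] ca [?k] \<odot> W [] (mL j) [1, 1, ?k] = W [] (mL j) [?k] \<odot> W (1 # obj j) ca [?k]"
      using exchange[of "[]" "mL j" "[]" "ca" "[?k]"] by simp
    have 4: "cap0 ?k \<odot> W [] (mL j) [?k] = ca \<odot> W [1] (cap0 j) [1] \<odot> W (1 # obj j) (sR j) []"
      using cap_merge[OF legs_Suc(1), of j] by (simp add: mL_def sR_def cap0_1)
    have 5: "W (1 # obj j) (sR j) [] \<odot> W (1 # obj j) ca [?k] = W (1 # obj j) ca (obj j @ [1])
        \<odot> W (1 # obj j @ [1, 1]) (sR j) []"
      using exchange[of "1 # obj j" "ca" "[]" "sR j" "[]"] by simp
    show ?thesis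
      by (simp add: precomp[OF 1] 2 precomp[OF 3] precomp[OF 4] precomp[OF 5] cmp_assoc W_cmp W_W)
  qed
  have nest': "cap0 ?d \<odot> W [] (mL ?k) [?d] \<odot> W [1] (mR j) [?d]
     = ca \<odot> W [1] (cap0 j) [1] \<odot> W (1 # obj j) ca (obj j @ [1]) \<odot> W (1 # obj j @ [1]) ?L []"
  proof -
    have 1: "cap0 ?d \<odot> W [] (mL ?k) [?d] = ca \<odot> W [1] (cap0 ?k) [1] \<odot> W [1, ?k] (sR ?k) []"
      using cap_merge[OF legs_Suc(1), of ?k] by (simp add: mL_def sR_def cap0_1)
    have 2: "W [1, ?k] (sR ?k) [] \<odot> W [1] (mR j) [?d] = W [1] (mR j) [?k, 1]
        \<odot> W (1 # obj j @ [1]) (sR ?k) []"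
      using exchange[of "[1]" "mR j" "[]" "sR ?k" "[]"] by simp
    have 3: "W [1] (cap0 ?k) [1] \<odot> W [1] (mR j) [?k, 1] = W [1] (cap0 j) [1]
        \<odot> W (1 # obj j) ca (obj j @ [1]) \<odot> W (1 # obj j @ [1]) (sL j) [1]"
      using whisker[OF cap_merge[OF legs_Suc(2), of j], of "[1]" "[1]"]
      by (simp add: mR_def sL_def cap0_1 W_cmp W_W)
    show ?thesis
      by (simp add: precomp[OF 1] 2 precomp[OF 3] cmp_assoc W_cmp W_W)
  qed
  have "W [] (mR ?k) [?d] \<odot> W [] (mL j) [1, ?d] = W [] (mL ?k) [?d] \<odot> W [1] (mR j) [?d]"
    using whisker[OF merge_assoc[OF assms], of "[]" "[?d]"] by (simp add: W_cmp W_W)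
  with nest nest' have eq: "ca \<odot> W [1] (cap0 j) [1] \<odot> W (1 # obj j) ca (obj j @ [1])
      \<odot> W (1 # obj j @ [1]) ?L []
      = ca \<odot> W [1] (cap0 j) [1] \<odot> W (1 # obj j) ca (obj j @ [1]) \<odot> W (1 # obj j @ [1]) ?R []"
    by simp
  have "ty (W [] (sL j) [1])" "ty (W [1] (sR j) [])"
    using assms by (simp_all add: typed_ops)
  note W_st = source_target_W[OF this(1)] source_target_W[OF this(2)]
  have ty: "ty ?L" "ty ?R"
    using assms by (simp_all add: typed_ops W_st)
  have "nf ?L = nf ?R"
    by (rule nested_cap_cancel[OF ty _ _ _ eq])
      (simp_all only: source_target_ops(1,2)[OF ty(1)] source_target_ops(1,2)[OF ty(2)] W_st
        source_target_vertices, simp_all)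
  then show ?thesis by simp
qed

section \<open>The switching relation turned by a quarter\<close>

lemma obj_2 [simp]: "obj 2 = [2]"
  by (simp add: obj_def)

text \<open>Kept as an expression instead of the representative of its class, so that its source and target can be
computed.\<close>

definition V :: "'r web" where "V = sL 1 \<^bold>\<circ> mL 1"

lemma source_target_V [simp]: "source V = [1, 1]" "target V = [1, 1]"
  by (simp_all add: V_def)

lemma W_V: "W l V r = W l (sL 1) r \<odot> W l (mL 1) r"
  by (simp add: V_def nf_web_arg W_cmp)

lemma lollipop:
  assumes "2 \<le> n" shows "null (mL 1 \<odot> cu)"
proof -
  have "nf (Merge 1 1 2 \<^bold>\<circ> Cup 1) = nf (Zero [] [2])"
    using assms by (intro web_rel_nf[OF web_rel.lollipop])
  then have "mL 1 \<odot> cu = nf (Zero [] [2])"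
    by (simp add: mL_def cu_def merge0_def nf_web)
  then show ?thesis by (simp add: null_Zero)
qed

text \<open>Turning the vertex makes the cap on its top legs a lollipop.\<close>

lemma lollipop_flipped:
  assumes "2 \<le> n" shows "null (ca \<odot> sL 1)"
proof -
  have 1: "nf (sL 1) = W [1] (merge0 1 2 1) [] \<odot> W [] cu [2]"
    using rotate_left[OF legs_Suc(4), of 1] by (simp add: sL_def cup0_1)
  have 2: "ca \<odot> W [1] (merge0 1 2 1) [] = cap0 2 \<odot> W [] (mL 1) [2]"
    using cap_cyclic[OF legs_Suc(1), of 1] by (simp add: mL_def cap0_1)
  have "ca \<odot> sL 1 = ca \<odot> nf (sL 1)" by simp
  also have "\<dots> = cap0 2 \<odot> W [] (mL 1 \<odot> cu) [2]"
    by (simp only: 1 precomp[OF 2] W_cmp cmp_assoc)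
  finally show ?thesis using lollipop[OF assms] by (simp add: null_ops)
qed

text \<open>The quarter turn taking $\mathrm{Hom}(k\otimes k, 1\otimes 1)$, where the switching relation lives, to
$\mathrm{End}(1\otimes k)$: the top left endpoint is bent down to the left and the bottom right endpoint is
bent up.\<close>

definition turn :: "nat \<Rightarrow> 'r web \<Rightarrow> 'r web" where
  "turn k X = W [] ca [1, k] \<odot> W [1] X [k] \<odot> W [1, k] (cup0 k) []"

lemma turn_linear: "turn k (X \<oplus> Y) = turn k X \<oplus> turn k Y" "turn k (r \<star> X) = r \<star> turn k X"
  by (simp_all add: turn_def linear)

text \<open>The cap moves the left vertex and the cup the right one to the edge \<open>i\<close>, which becomes a zigzag.\<close>

lemma turn_H':
  assumes legs: "legs 1 k i" and k: "1 \<le> k"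
  shows "turn k (W [] (merge0 k i 1) [1] \<odot> W [k] (split0 i 1 k) []) = split0 1 k i \<odot> merge0 1 k i"
proof -
  have [simp]: "obj k = [k]" using k by (simp add: obj_def)
  note perm = legs_permute[OF legs]
  have a: "W [] ca [1, k] \<odot> W [1] (merge0 k i 1) [1, k]
      = W [] (cap0 i) [1, k] \<odot> W [] (merge0 1 k i) (obj i @ [1, k])"
    using whisker[OF cap_cyclic[OF legs], of "[]" "[1, k]"] by (simp add: W_cmp W_W cap0_1)
  have b: "W [1, k] (split0 i 1 k) [k] \<odot> W [1, k] (cup0 k) []
      = W (1 # k # obj i) (split0 1 k i) [] \<odot> W [1, k] (cup0 i) []"
    using whisker[OF cup_cyclic[OF perm(2)], of "[1, k]" "[]"] by (simp add: W_cmp W_W)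
  have c: "W [] (merge0 1 k i) (obj i @ [1, k]) \<odot> W (1 # k # obj i) (split0 1 k i) []
      = W (obj i @ obj i) (split0 1 k i) [] \<odot> W [] (merge0 1 k i) (obj i @ obj i)"
    using exchange[of "[]" "merge0 1 k i" "obj i" "split0 1 k i" "[]"] legs by simp
  have d: "W [] (cap0 i) [1, k] \<odot> W (obj i @ obj i) (split0 1 k i) [] = split0 1 k i
      \<odot> W [] (cap0 i) (obj i)"
    using exchange[of "[]" "cap0 i" "[]" "split0 1 k i" "[]"] legs by (simp add: W_nil)
  have e: "W [] (merge0 1 k i) (obj i @ obj i) \<odot> W [1, k] (cup0 i) [] = W (obj i) (cup0 i) []
      \<odot> merge0 1 k i"
    using exchange[of "[]" "merge0 1 k i" "[]" "cup0 i" "[]"] legs by (simp add: W_nil)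
  show ?thesis
    unfolding turn_def using legs
    by (simp add: W_cmp W_W cmp_assoc precomp[OF a] b precomp[OF c] precomp[OF d] e
        precomp[OF zigzag_left] strands_cmp)
qed

lemma turn_C:
  assumes k: "1 \<le> k"
  shows "turn k (cu \<odot> cap0 k) = nf (Strands [1, k])"
proof -
  have [simp]: "obj k = [k]" using k by (simp add: obj_def)
  have a: "W [1] (cap0 k) [k] \<odot> W [1, k] (cup0 k) [] = nf (Strands [1, k])"
    using whisker[OF zigzag_left[of k], of "[1]" "[]"] by (simp add: W_cmp W_W W_strands)
  have b: "W [] ca [1, k] \<odot> W [1] cu [k] = nf (Strands [1, k])"
    using whisker[OF zigzag_left[of 1], of "[]" "[k]"] by (simp add: W_cmp W_W W_strands cap0_1 cup0_1)
  show ?thesis unfolding turn_def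
    by (simp add: W_cmp W_W cmp_assoc a W_cmp_strands b)
qed

lemma turn_V: "turn 1 V = W [] (merge0 1 2 1) [1] \<odot> W [1] (split0 2 1 1) []"
proof -
  have a: "W [] ca [1, 1] \<odot> W [1] (sL 1) [1] = W [] (merge0 1 2 1) [1]"
    using whisker[OF unrotate_left[OF legs_Suc(4), of 1], of "[]" "[1]"]
    by (simp add: W_cmp W_W cap0_1 sL_def)
  have b: "W [1] (mL 1) [1] \<odot> W [1, 1] cu [] = W [1] (split0 2 1 1) []"
    using whisker[OF rotate_right[OF legs_Suc(1), of 1], of "[1]" "[]"]
    by (simp add: W_cmp W_W cup0_1 mL_def)
  show ?thesis by (simp add: turn_def W_V cmp_assoc precomp[OF a] b cup0_1)
qed

text \<open>The edge labelled \<open>j\<close> absorbs a strand $1$ after a cup; in this way the vertices at which the label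
decreases upwards are expressed by the other ones.\<close>

lemma split_decreasing: "nf (split0 1 (Suc j) j) = W [1] (mL j) [] \<odot> W [] cu (obj j)"
  using rotate_left[OF legs_Suc(1), of j] by (simp add: mL_def cup0_1)

lemma merge_decreasing: "nf (merge0 1 (Suc j) j) = W [] ca (obj j) \<odot> W [1] (sL j) []"
  using unrotate_left[OF legs_Suc(4), of j] by (simp add: sL_def cap0_1)

text \<open>The edge labelled \<open>j\<close> of $Y$ is straightened by a zigzag; what is left of the two bends acts on $V$ alone.\<close>

lemma turn_Y:
  "turn (Suc j) (V \<odot> W [1] (cap0 j) [1] \<odot> W [] (sL j) (obj j @ [1]) \<odot> W [Suc j] (sR j) [])
   = W [1] (mL j) [] \<odot> W [] (turn 1 V) (obj j) \<odot> W [1] (sL j) []"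
proof -
  let ?k = "Suc j" let ?s = "split0 1 ?k j"
  have b: "W [1, ?k] (sR j) [?k] \<odot> W [1, ?k] (cup0 ?k) []
      = W (1 # ?k # obj j) ?s [] \<odot> W [1, ?k] (cup0 j) []"
    using whisker[OF cup_cyclic[OF legs_Suc(3), of j], of "[1, ?k]" "[]"]
        by (simp add: W_cmp W_W sR_def)
  have c: "W [1] (sL j) (obj j @ [1, ?k]) \<odot> W (1 # ?k # obj j) ?s []
      = W (1 # 1 # obj j @ obj j) ?s [] \<odot> W [1] (sL j) (obj j @ obj j)"
    using exchange[of "[1]" "sL j" "obj j" ?s "[]"] by (simp add: legs_Suc)
  have d: "W [1] (sL j) (obj j @ obj j) \<odot> W [1, ?k] (cup0 j) [] = W (1 # 1 # obj j) (cup0 j) []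
      \<odot> W [1] (sL j) []"
    using exchange[of "[1]" "sL j" "[]" "cup0 j" "[]"] by simp
  have e: "W [1, 1] (cap0 j) [1, ?k] \<odot> W (1 # 1 # obj j @ obj j) ?s [] = W [1, 1] ?s []
      \<odot> W [1, 1] (cap0 j) (obj j)"
    using exchange[of "[1, 1]" "cap0 j" "[]" ?s "[]"] by (simp add: legs_Suc)
  have f: "W [1, 1] (cap0 j) (obj j) \<odot> W (1 # 1 # obj j) (cup0 j) [] = nf (Strands (1 # 1 # obj j))"
    using whisker[OF zigzag_left[of j], of "[1, 1]" "[]"] by (simp add: W_cmp W_W W_strands)
  have g: "W [1, 1] ?s [] = W [1, 1, 1] (mL j) [] \<odot> W [1, 1] cu (obj j)"
    using whisker[OF split_decreasing, of "[1, 1]" j "[]"] by (simp add: W_cmp W_W)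
  have h: "W [1] V [?k] \<odot> W [1, 1, 1] (mL j) [] = W [1, 1, 1] (mL j) [] \<odot> W [1] V (1 # obj j)"
    using exchange[of "[1]" V "[]" "mL j" "[]"] by simp
  have i: "W [] ca [1, ?k] \<odot> W [1, 1, 1] (mL j) [] = W [1] (mL j) [] \<odot> W [] ca (1 # 1 # obj j)"
    using exchange[of "[]" ca "[1]" "mL j" "[]"] by simp
  show ?thesis
    unfolding turn_def
    by (simp add: W_cmp W_W cmp_assoc b precomp[OF c] d precomp[OF e] precomp[OF f] W_strands_cmp
        g precomp[OF h] precomp[OF i] cup0_1)
qed

definition inv_qint :: "nat \<Rightarrow> 'r" where "inv_qint m = unit_inv (qint q m)"

lemma inv_qint: "j \<in> {1..n} \<Longrightarrow> qint q j * inv_qint j = 1"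
  unfolding inv_qint_def using qint_unit by (rule unit_inv_right)

lemma switch_nf:
  assumes j: "Suc j \<le> n" and n: "2 \<le> n"
  shows "nf (web_H' n (Suc j) (Suc (Suc j)))
    = V \<odot> W [1] (cap0 j) [1] \<odot> W [] (sL j) (obj j @ [1]) \<odot> W [Suc j] (sR j) []
      \<oplus> (- (qint q (n - Suc j) * inv_qint (n - j))) \<star> (W [] (merge0 (Suc j) j 1) [1]
          \<odot> W [Suc j] (split0 j 1 (Suc j)) [])
      \<oplus> (qint q (n - Suc j) * inv_qint n) \<star> (cu \<odot> cap0 (Suc j))"
proof -
  let ?k = "Suc j"
  have tens: "sL j \<boxtimes> sR j = W [] (sL j) (obj j @ [1]) \<odot> W [?k] (sR j) []"
  proof -
    have "sL j \<boxtimes> sR j = (sL j \<odot> Strands [?k]) \<boxtimes> (Strands (obj j @ [1]) \<odot> sR j)"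
      by (simp add: cmp_strands strands_cmp)
    also have "\<dots> = (sL j \<boxtimes> Strands (obj j @ [1])) \<odot> (Strands [?k] \<boxtimes> sR j)"
      by (rule interchange) simp
    finally show ?thesis by (simp add: W_nil_left W_nil_right)
  qed
  have Y: "nf (web_Y n ?k) = V \<odot> W [1] (cap0 j) [1] \<odot> W [] (sL j) (obj j @ [1]) \<odot> W [?k] (sR j) []"
    using n unfolding tens[symmetric]
    by (simp add: web_Y_def with_edge_def nf_web nf_web_arg V_def sL_def sR_def mL_def
        split0_def[of 1 1] merge0_def[of 1 1]
        W_def cmp_assoc flip:)
  have H: "nf (web_H' n ?k j) = W [] (merge0 ?k j 1) [1] \<odot> W [?k] (split0 j 1 ?k) []"
    using j by (simp add: web_H'_def with_edge_def nf_web nf_web_arg W_nil_left W_nil_right)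
  have C: "nf (web_C ?k) = cu \<odot> cap0 ?k"
    by (simp add: web_C_def nf_web cu_def cap0_def)
  have nj: "n - Suc j + 1 = n - j" using j by simp
  have "nf (web_H' n ?k (?k + 1)) = nf (web_Y n ?k
      \<^bold>+ (- (qint q (n - ?k) * unit_inv (qint q (n - ?k + 1)))) \<^bold>* web_H' n ?k (?k - 1)
      \<^bold>+ (qint q (n - ?k) * unit_inv (qint q n)) \<^bold>* web_C ?k)"
    using j by (intro web_rel_nf[OF web_rel.switch]) auto
  also have "\<dots> = nf (web_Y n ?k) \<oplus> (- (qint q (n - ?k) * inv_qint (n - j))) \<star> nf (web_H' n ?k j)
      \<oplus> (qint q (n - ?k) * inv_qint n) \<star> nf (web_C ?k)"
    by (simp add: nf_web nj inv_qint_def) (metis nf_ops nf_web)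
  finally show ?thesis by (simp add: Y H C flip: Suc_eq_plus1)
qed

text \<open>The coefficient $[n-1]/[n]$ in the quarter turn of $V$.\<close>

abbreviation (input) turn_coeff :: 'r where "turn_coeff \<equiv> qint q (n - 1) * inv_qint n"

text \<open>The quarter turn of $V$ is the web $H'_2$ of the switching relation for $k = 1$.\<close>

lemma turn_1_V:
  assumes n: "2 \<le> n"
  shows "turn 1 V = V \<oplus> (- turn_coeff) \<star> Strands [1, 1] \<oplus> turn_coeff \<star> (cu \<odot> ca)"
proof -
  have "nf (web_H' n (Suc 0) (Suc (Suc 0))) = turn 1 V"
    using n by (simp add: turn_V web_H'_def with_edge_def nf_web nf_web_arg W_nil_left W_nil_right
        flip: One_nat_def)
  moreover have "W [] (merge0 1 0 1) [1] = nf (Strands [1, 1])" "W [1] (split0 0 1 1) [] = nf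
      (Strands [1, 1])"
    "W [1] (cap0 0) [1] = nf (Strands [1, 1])" "W [] (sL 0) [1] = nf (Strands [1, 1])" "W [1] (sR
        0) [] = nf (Strands [1, 1])"
    by (simp_all add: merge0_def split0_def cap0_def sL_def sR_def strand0_def W_strands flip:
        One_nat_def)
  ultimately show ?thesis
    using switch_nf[of 0] n
    by (simp add: strands_idem cmp_strands cap0_1 flip: One_nat_def)
qed

text \<open>The web through the edge $j + 2$ is zero by convention if that label exceeds \<open>n\<close>.\<close>

definition merge_split :: "nat \<Rightarrow> 'r web" where
  "merge_split j = (if Suc (Suc j) \<le> n then sL (Suc j)
      \<odot> mL (Suc j) else nf (Zero [1, Suc j] [1, Suc j]))"

text \<open>The excess of the coefficient $[n-1]/[n]$ in the quarter turn of $V$ over the coefficient $[n-j-1]/[n-j]$ in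
the switching relation; see \<open>coefficient_UU\<close>.\<close>

definition switch_coeff :: "nat \<Rightarrow> 'r" where "switch_coeff j = qint q j * inv_qint n * inv_qint (n - j)"

lemma coefficient_id:
  assumes "Suc j \<le> n"
  shows "qint q (n - Suc j) * inv_qint n - turn_coeff * qint q (Suc j) = - qint q j"
proof -
  have "qint q (Suc j) * qint q (n - 1) = qint q j * qint q n + qint q (n - Suc j)"
    using qint_exchange[OF q_unit, of j "n - Suc j"] assms by (simp add: Suc_diff_le flip: One_nat_def)
  then have "inv_qint n * (qint q (Suc j) * qint q (n - 1)) = inv_qint n * (qint q j * qint q n +
      qint q (n - Suc j))"
    by simp
  also have "\<dots> = qint q j * (qint q n * inv_qint n) + qint q (n - Suc j) * inv_qint n"
    by (simp add: algebra_simps)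
  finally show ?thesis using inv_qint[of n] n_pos by (simp add: algebra_simps)
qed

lemma coefficient_UU:
  assumes "Suc j \<le> n"
  shows "turn_coeff - qint q (n - Suc j) * inv_qint (n - j) = switch_coeff j"
proof -
  have 1: "qint q (n - j) * qint q (n - 1) = qint q (n - Suc j) * qint q n + qint q j"
    using qint_exchange[OF q_unit, of "n - Suc j" j] assms by (simp add: Suc_diff_Suc flip: One_nat_def)
  have 2: "qint q (n - j) * inv_qint (n - j) = 1" "qint q n * inv_qint n = 1"
    using inv_qint assms by auto
  have "switch_coeff j = (qint q (n - j) * qint q (n - 1) - qint q (n - Suc j) * qint q n) *
      inv_qint n * inv_qint (n - j)"
    by (simp add: switch_coeff_def 1)
  also have "\<dots> = (qint q (n - j) * inv_qint (n - j)) * turn_coeff - (qint q n * inv_qint n) *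
      (qint q (n - Suc j) * inv_qint (n - j))"
    by (simp only: algebra_simps)
  finally show ?thesis by (simp add: 2)
qed

text \<open>The quarter turn of the switching relation for $k = j + 1$.  It contains the quarter turn of $V$, which
\<open>turn_1_V\<close> expresses by $V$, the identity and $U$; the coefficients combine to quantum integers by
\<open>coefficient_id\<close> and \<open>coefficient_UU\<close>.\<close>

lemma switch_turned:
  assumes j: "Suc j \<le> n" and n: "2 \<le> n"
  shows "merge_split j = W [1] (mL j) [] \<odot> W [] V (obj j) \<odot> W [1] (sL j) []
     \<oplus> switch_coeff j \<star> (W [1] (mL j) [] \<odot> W [] (cu \<odot> ca) (obj j) \<odot> W [1] (sL j) [])
     \<oplus> (- qint q j) \<star> Strands [1, Suc j]"
proof -
  let ?k = "Suc j" and ?W = "\<lambda>X. W [1] (mL j) [] \<odot> W [] X (obj j) \<odot> W [1] (sL j) []"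
  have merge_split: "merge_split j = turn ?k (nf (web_H' n ?k (Suc ?k)))"
  proof (cases "Suc ?k \<le> n")
    case True
    then have "nf (web_H' n ?k (Suc ?k)) = W [] (merge0 ?k (Suc ?k) 1) [1]
        \<odot> W [?k] (split0 (Suc ?k) 1 ?k) []"
      by (simp add: web_H'_def with_edge_def nf_web nf_web_arg W_nil_left W_nil_right)
    then show ?thesis
      using True turn_H'[OF legs_Suc(1)[of ?k]] by (simp add: merge_split_def sL_def mL_def)
  next
    case False
    let ?Z = "Zero [?k, ?k] [1, 1]"
    have "nf (web_H' n ?k (Suc ?k)) = nf ?Z" using False by (simp add: web_H'_def with_edge_def)
    moreover have "null (turn ?k (nf ?Z))" unfolding turn_def by (intro null_ops null_Zero)
    moreover have ty: "ty (W [1] ?Z [?k])" "ty (W [] ca [1, ?k])" "ty (W [1, ?k] (cup0 ?k) [])"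
      using j n by (auto simp: typed_ops typed_simps cup0_def)
    have "ty (W [1] ?Z [?k] \<odot> W [1, ?k] (cup0 ?k) [])" using ty
        by (simp add: typed_ops(1) source_target_W)
    then have "ty (turn ?k ?Z)" "source (turn ?k ?Z) = [1, ?k]" "target (turn ?k ?Z) = [1, ?k]"
      using ty unfolding turn_def by (simp_all add: typed_ops(1) source_target_W source_target_ops)
    ultimately show ?thesis
      using False scl_zero[of "turn ?k ?Z"] by (simp add: merge_split_def null_def turn_def)
  qed
  have U: "split0 1 ?k j \<odot> merge0 1 ?k j = ?W (cu \<odot> ca)"
  proof -
    have "split0 1 ?k j \<odot> merge0 1 ?k j = nf (split0 1 ?k j) \<odot> nf (merge0 1 ?k j)" by simp
    then show ?thesis by (simp only: split_decreasing merge_decreasing W_cmp cmp_assoc)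
  qed
  have S: "?W (Strands [1, 1]) = qint q ?k \<star> Strands [1, ?k]"
    using whisker[OF bigon_left[OF j], of "[1]" "[]"]
    by (simp add: W_strands W_strands_cmp W_cmp W_scl)
  have C: "turn ?k (cu \<odot> cap0 ?k) = nf (Strands [1, ?k])"
    by (rule turn_C) simp
  have H: "turn ?k (W [] (merge0 ?k j 1) [1] \<odot> W [?k] (split0 j 1 ?k) []) = ?W (cu \<odot> ca)"
    using turn_H'[OF legs_Suc(4)[of j]] U by simp
  have "merge_split j = ?W (turn 1 V) \<oplus> (- (qint q (n - Suc j) * inv_qint (n - j))) \<star> ?W (cu \<odot> ca)
      \<oplus> (qint q (n - Suc j) * inv_qint n) \<star> Strands [1, ?k]"
    by (simp add: merge_split switch_nf[OF j n] turn_linear turn_Y C H)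
  also have "?W (turn 1 V) = ?W V \<oplus> (- turn_coeff * qint q ?k) \<star> Strands [1, ?k]
      \<oplus> turn_coeff \<star> ?W (cu \<odot> ca)"
    by (simp add: turn_1_V[OF n] linear S del: One_nat_def)
  finally have "merge_split j = ?W V \<oplus> (turn_coeff - qint q (n - Suc j) * inv_qint (n - j)) \<star> ?W
      (cu \<odot> ca)
      \<oplus> (qint q (n - Suc j) * inv_qint n - turn_coeff * qint q ?k) \<star> Strands [1, ?k]"
    by (simp only: diff_conv_add_uminus scl_add_scalar add_ac mult_minus_left)
  then show ?thesis by (simp only: coefficient_id[OF j] coefficient_UU[OF j])
qed

section \<open>Moving and absorbing pairs of strands labelled 1\<close>

text \<open>A form of typing whose rules compute the type of a composite from those of its factors.\<close>

definition hom :: "'r web \<Rightarrow> nat list \<Rightarrow> nat list \<Rightarrow> bool" where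
  "hom x a b \<longleftrightarrow> ty x \<and> source x = a \<and> target x = b"

lemma hom_cmp: "hom y a b \<Longrightarrow> hom x b c \<Longrightarrow> hom (x \<odot> y) a c"
  by (simp add: hom_def typed_ops source_target_ops(1,2))

lemma hom_W:
  "hom x a b \<Longrightarrow> a' = l @ a @ r \<Longrightarrow> b' = l @ b @ r \<Longrightarrow> set l \<subseteq> {1..n} \<Longrightarrow> set r \<subseteq> {1..n} \<Longrightarrow> hom (W l x r) a' b'"
  by (simp add: hom_def typed_ops source_target_W)

lemma hom_vertices:
  "Suc j \<le> n \<Longrightarrow> hom (mL j) (1 # obj j) [Suc j]" "Suc j \<le> n \<Longrightarrow> hom (mR j) (obj j @ [1]) [Suc j]"
  "Suc j \<le> n \<Longrightarrow> hom (sL j) [Suc j] (1 # obj j)" "Suc j \<le> n \<Longrightarrow> hom (sR j) [Suc j] (obj j @ [1])"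
  "hom cu [] [1, 1]" "hom ca [1, 1] []" "2 \<le> n \<Longrightarrow> hom V [1, 1] [1, 1]"
  "set a \<subseteq> {1..n} \<Longrightarrow> hom (Strands a) a a"
  by (simp_all add: hom_def V_def typed_simps)

lemmas hom_intros = hom_cmp hom_W hom_vertices

lemma null_eq: "null x \<Longrightarrow> hom x a b \<Longrightarrow> hom y a b \<Longrightarrow> x = 0 \<star> y"
  using scl_zero[of x] scl_zero[of y] by (simp add: hom_def null_def)

lemma scl_cancel: "s * r = 1 \<Longrightarrow> r \<star> x = r \<star> y \<Longrightarrow> nf x = nf y"
  by (metis scl_scl scl_one)

text \<open>Subtraction of two terms; the typing hypotheses enter because $x - x$ is zero only of the type of $x$.\<close>

lemma move_terms:
  assumes Q: "Q = P \<oplus> a \<star> X \<oplus> c \<star> Y" and "hom P s t" "hom X s t" "hom Y s t"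
  shows "nf P = Q \<oplus> (- a) \<star> X \<oplus> (- c) \<star> Y"
proof -
  have "Q \<oplus> (- a) \<star> X \<oplus> (- c) \<star> Y = (P \<oplus> (a + - a) \<star> X) \<oplus> (c + - c) \<star> Y"
    by (simp only: Q scl_add_scalar add_ac)
  also have "\<dots> = (P \<oplus> 0 \<star> X) \<oplus> 0 \<star> Y" by simp
  also have "P \<oplus> 0 \<star> X = nf P"
    using assms by (intro add_null null_scl_zero) (auto simp: hom_def typed_ops source_target_ops)
  also have "nf P \<oplus> 0 \<star> Y = nf P"
    unfolding nf_ops
    using assms by (intro add_null null_scl_zero) (auto simp: hom_def typed_ops source_target_ops)
  finally show ?thesis by simp
qed

lemma inv_qint': "j \<in> {1..n} \<Longrightarrow> inv_qint j * qint q j = 1"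
  using inv_qint[of j] by (simp add: mult.commute)

text \<open>Pulling the quarter turn of $V$ around the cup gives $V$ on the other side of it, by zigzags;
\<open>turn_1_V\<close> expresses the quarter turn by $V$ and adds the two webs without a vertex.\<close>

lemma V_cu:
  assumes n: "2 \<le> n"
  shows "W [1] V [] \<odot> W [] cu [1] = W [] V [1] \<odot> W [1] cu [] \<oplus> turn_coeff \<star> W [] cu [1]
      \<oplus> (- turn_coeff) \<star> W [1] cu []"
proof -
  have a: "W [1, 1, 1] cu [] \<odot> W [] cu [1] = W [] cu [1, 1, 1] \<odot> W [1] cu []"
    using exchange[of "[]" cu "[1]" cu "[]"] by simp
  have b: "W [1, 1] V [1] \<odot> W [] cu [1, 1, 1] = W [] cu [1, 1, 1] \<odot> W [] V [1]"
    using exchange[of "[]" cu "[]" V "[1]"] by simp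
  have c: "W [1] ca [1, 1] \<odot> W [] cu [1, 1, 1] = nf (Strands [1, 1, 1])"
    using whisker[OF zigzag_right[of 1], of "[]" "[1, 1]"]
        by (simp add: W_cmp W_W W_strands cap0_1 cup0_1)
  have d: "W [1] ca [] \<odot> W [] cu [1] = nf (Strands [1])"
    using zigzag_right[of 1] by (simp add: cap0_1 cup0_1)
  have "W [1] (turn 1 V) [] \<odot> W [] cu [1] = W [] V [1] \<odot> W [1] cu []"
    by (simp add: turn_def W_cmp W_W cmp_assoc cup0_1 a precomp[OF b] precomp[OF c] W_strands_cmp')
  moreover have "W [1] (turn 1 V) [] \<odot> W [] cu [1]
      = W [1] V [] \<odot> W [] cu [1] \<oplus> (- turn_coeff) \<star> W [] cu [1] \<oplus> turn_coeff \<star> W [1] cu []"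
    by (simp add: turn_1_V[OF n] linear W_cmp W_W W_strands W_strands_cmp cmp_assoc d W_cmp_strands)
  ultimately have "W [] V [1] \<odot> W [1] cu [] = W [1] V [] \<odot> W [] cu [1]
      \<oplus> (- turn_coeff) \<star> W [] cu [1] \<oplus> turn_coeff \<star> W [1] cu []"
    by simp
  then have "nf (W [1] V [] \<odot> W [] cu [1]) = W [] V [1] \<odot> W [1] cu []
      \<oplus> (- (- turn_coeff)) \<star> W [] cu [1] \<oplus> (- turn_coeff) \<star> W [1] cu []"
    by (rule move_terms[where s = "[1]" and t = "[1, 1, 1]"]) (rule hom_intros | simp add: n n_pos)+
  then show ?thesis by simp
qed

lemma ca_V:
  assumes n: "2 \<le> n"
  shows "W [1] ca [] \<odot> W [] V [1] = W [] ca [1] \<odot> W [1] V [] \<oplus> turn_coeff \<star> W [1] ca []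
      \<oplus> (- turn_coeff) \<star> W [] ca [1]"
proof -
  have a: "W [1] ca [] \<odot> W [] ca [1, 1, 1] = W [] ca [1] \<odot> W [1, 1, 1] ca []"
    using exchange[of "[]" ca "[1]" ca "[]"] by simp
  have b: "W [1, 1, 1] ca [] \<odot> W [1] V [1, 1] = W [1] V [] \<odot> W [1, 1, 1] ca []"
    using exchange[of "[1]" V "[]" ca "[]"] by simp
  have c: "W [1, 1, 1] ca [] \<odot> W [1, 1] cu [1] = nf (Strands [1, 1, 1])"
    using whisker[OF zigzag_right[of 1], of "[1, 1]" "[]"]
        by (simp add: W_cmp W_W W_strands cap0_1 cup0_1)
  have d: "W [1] ca [] \<odot> W [] cu [1] = nf (Strands [1])"
    using zigzag_right[of 1] by (simp add: cap0_1 cup0_1)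
  have "W [1] ca [] \<odot> W [] (turn 1 V) [1] = W [] ca [1] \<odot> W [1] V []"
    by (simp add: turn_def W_cmp W_W cmp_assoc cup0_1 precomp[OF a] precomp[OF b] c W_cmp_strands)
  moreover have "W [1] ca [] \<odot> W [] (turn 1 V) [1]
      = W [1] ca [] \<odot> W [] V [1] \<oplus> (- turn_coeff) \<star> W [1] ca [] \<oplus> turn_coeff \<star> W [] ca [1]"
    by (simp add: turn_1_V[OF n] linear W_cmp W_W W_strands W_cmp_strands cmp_assoc precomp[OF d]
        W_strands_cmp)
  ultimately have "W [] ca [1] \<odot> W [1] V [] = W [1] ca [] \<odot> W [] V [1]
      \<oplus> (- turn_coeff) \<star> W [1] ca [] \<oplus> turn_coeff \<star> W [] ca [1]"
    by simp
  then have "nf (W [1] ca [] \<odot> W [] V [1]) = W [] ca [1] \<odot> W [1] V []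
      \<oplus> (- (- turn_coeff)) \<star> W [1] ca [] \<oplus> (- turn_coeff) \<star> W [] ca [1]"
    by (rule move_terms[where s = "[1, 1, 1]" and t = "[1]"]) (rule hom_intros | simp add: n n_pos)+
  then show ?thesis by simp
qed

lemma mL_0: "W l (mL 0) r = nf (Strands (l @ [1] @ r))" and sL_0: "W l (sL 0) r = nf (Strands (l @
    [1] @ r))"
  and mR_0: "W l (mR 0) r = nf (Strands (l @ [1] @ r))" and sR_0: "W l (sR 0) r = nf (Strands (l @
      [1] @ r))"
  by (simp_all add: mL_def sL_def mR_def sR_def merge0_def split0_def strand0_def W_strands flip:
      One_nat_def)

text \<open>For $j = 0$ this is the bigon relation.  In the step from \<open>j\<close> to $j + 1$, a bigon is inserted into the
strand $j + 1$; associativity pulls its right strand out to the top, leaving the case \<open>j\<close> to its left.\<close>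

lemma merge_V:
  assumes "Suc (Suc j) \<le> n"
  shows "mL (Suc j) \<odot> W [1] (mL j) [] \<odot> W [] V (obj j) = qint q 2 \<star> (mL (Suc j) \<odot> W [1] (mL j) [])"
  using assms
proof (induction j)
  case 0
  have "mL 1 \<odot> V = (mL 1 \<odot> sL 1) \<odot> mL 1" by (simp add: V_def nf_web_arg cmp_assoc)
  also have "\<dots> = qint q 2 \<star> mL 1"
    using 0 by (simp add: bigon_left linear strands_cmp flip: One_nat_def)
  finally show ?case
    by (simp add: mL_0 strands_cmp cmp_strands W_nil flip: One_nat_def)
next
  case (Suc j)
  let ?k = "Suc j"
  let ?A = "mL (Suc ?k) \<odot> W [1] (mL ?k) []"
  have j: "Suc ?k \<le> n" "?k \<le> n" using Suc.prems by auto
  have 1: "W [1] (mL ?k) [] \<odot> W [1, 1] (mR j) [] = W [1] (mR ?k) [] \<odot> W [1] (mL j) [1]"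
    using whisker[OF merge_assoc[OF j(1)], of "[1]" "[]"] by (simp add: W_cmp W_W)
  have 2: "mL (Suc ?k) \<odot> W [1] (mR ?k) [] = mR (Suc ?k) \<odot> W [] (mL ?k) [1]"
    using merge_assoc[OF Suc.prems] by simp
  have 3: "W [1, 1] (mR j) [] \<odot> W [1, 1] (sR j) [] = qint q ?k \<star> nf (Strands [1, 1, ?k])"
    using whisker[OF bigon_right[OF j(2)], of "[1, 1]" "[]"] by (simp add: W_cmp W_scl W_strands)
  have A: "qint q ?k \<star> ?A = mR (Suc ?k) \<odot> W [] (mL ?k) [1] \<odot> W [1] (mL j) [1] \<odot> W [1, 1] (sR j) []"
  proof -
    have "mR (Suc ?k) \<odot> W [] (mL ?k) [1] \<odot> W [1] (mL j) [1] \<odot> W [1, 1] (sR j) []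
        = mL (Suc ?k) \<odot> W [1] (mL ?k) [] \<odot> W [1, 1] (mR j) [] \<odot> W [1, 1] (sR j) []"
      by (simp only: precomp[OF 1] precomp[OF 2[symmetric]] cmp_assoc)
    then show ?thesis by (simp add: 3 linear W_cmp_strands)
  qed
  have 4: "W [1, 1] (sR j) [] \<odot> W [] V [?k] = W [] V (obj j @ [1]) \<odot> W [1, 1] (sR j) []"
    using exchange[of "[]" V "[]" "sR j" "[]"] by simp
  have 5: "W [] (mL ?k) [1] \<odot> W [1] (mL j) [1]
      \<odot> W [] V (obj j @ [1]) = qint q 2 \<star> (W [] (mL ?k) [1] \<odot> W [1] (mL j) [1])"
    using whisker[OF Suc.IH[OF j(1)], of "[]" "[1]"] by (simp add: W_cmp W_W linear)
  have "qint q ?k \<star> (?A \<odot> W [] V [?k]) = (qint q ?k \<star> ?A) \<odot> W [] V [?k]"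
    by (simp only: linear)
  also have "\<dots> = qint q 2 \<star> (qint q ?k \<star> ?A)"
    unfolding A by (simp only: cmp_assoc 4 precomp3[OF 5] linear)
  also have "\<dots> = qint q ?k \<star> qint q 2 \<star> ?A" by (simp add: scl_scl mult.commute)
  finally have "nf (?A \<odot> W [] V [?k]) = nf (qint q 2 \<star> ?A)"
    using inv_qint'[of ?k] j by (intro scl_cancel[of "inv_qint ?k" "qint q ?k"]) auto
  then show ?case by (simp add: cmp_assoc)
qed

text \<open>The proof of \<open>merge_V\<close> turned upside down.\<close>

lemma split_V:
  assumes "Suc (Suc j) \<le> n"
  shows "W [] V (obj j) \<odot> W [1] (sL j) [] \<odot> sL (Suc j) = qint q 2 \<star> (W [1] (sL j) [] \<odot> sL (Suc j))"
  using assms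
proof (induction j)
  case 0
  have "V \<odot> sL 1 = sL 1 \<odot> (mL 1 \<odot> sL 1)" by (simp add: V_def nf_web_arg cmp_assoc)
  also have "\<dots> = qint q 2 \<star> sL 1"
    using 0 by (simp add: bigon_left linear cmp_strands flip: One_nat_def)
  finally show ?case
    by (simp add: sL_0 strands_cmp W_nil flip: One_nat_def)
next
  case (Suc j)
  let ?k = "Suc j"
  let ?A = "W [1] (sL ?k) [] \<odot> sL (Suc ?k)"
  have j: "Suc ?k \<le> n" "?k \<le> n" using Suc.prems by auto
  have 1: "W [1, 1] (sR j) [] \<odot> W [1] (sL ?k) [] = W [1] (sL j) [1] \<odot> W [1] (sR ?k) []"
    using whisker[OF split_coassoc[OF j(1)], of "[1]" "[]"] by (simp add: W_cmp W_W)
  have 2: "W [1] (sR ?k) [] \<odot> sL (Suc ?k) = W [] (sL ?k) [1] \<odot> sR (Suc ?k)"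
    using split_coassoc[OF Suc.prems] by simp
  have 3: "W [1, 1] (mR j) [] \<odot> W [1, 1] (sR j) [] = qint q ?k \<star> nf (Strands [1, 1, ?k])"
    using whisker[OF bigon_right[OF j(2)], of "[1, 1]" "[]"] by (simp add: W_cmp W_scl W_strands)
  have A: "qint q ?k \<star> ?A = W [1, 1] (mR j) [] \<odot> W [1] (sL j) [1] \<odot> W [] (sL ?k) [1] \<odot> sR (Suc ?k)"
  proof -
    have "W [1, 1] (mR j) [] \<odot> W [1] (sL j) [1] \<odot> W [] (sL ?k) [1] \<odot> sR (Suc ?k)
        = W [1, 1] (mR j) [] \<odot> W [1, 1] (sR j) [] \<odot> W [1] (sL ?k) [] \<odot> sL (Suc ?k)"
      by (simp only: precomp[OF 1] 2 cmp_assoc)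
    then show ?thesis by (simp add: precomp[OF 3] linear W_strands_cmp')
  qed
  have 4: "W [] V [?k] \<odot> W [1, 1] (mR j) [] = W [1, 1] (mR j) [] \<odot> W [] V (obj j @ [1])"
    using exchange[of "[]" V "[]" "mR j" "[]"] by simp
  have 5: "W [] V (obj j @ [1]) \<odot> W [1] (sL j) [1]
      \<odot> W [] (sL ?k) [1] = qint q 2 \<star> (W [1] (sL j) [1] \<odot> W [] (sL ?k) [1])"
    using whisker[OF Suc.IH[OF j(1)], of "[]" "[1]"] by (simp add: W_cmp W_W linear)
  have "qint q ?k \<star> (W [] V [?k] \<odot> ?A) = W [] V [?k] \<odot> (qint q ?k \<star> ?A)"
    by (simp only: linear)
  also have "\<dots> = qint q 2 \<star> (qint q ?k \<star> ?A)"
    unfolding A by (simp only: cmp_assoc precomp[OF 4] precomp3[OF 5] linear)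
  also have "\<dots> = qint q ?k \<star> qint q 2 \<star> ?A" by (simp add: scl_scl mult.commute)
  finally have "nf (W [] V [?k] \<odot> ?A) = nf (qint q 2 \<star> ?A)"
    using inv_qint'[of ?k] j by (intro scl_cancel[of "inv_qint ?k" "qint q ?k"]) auto
  then show ?case by simp
qed

text \<open>Up to the factor $[2]$ a vertex $V$ can be inserted, and its lower half makes the cup a lollipop.\<close>

lemma merge_cu:
  assumes j: "Suc (Suc j) \<le> n"
  shows "null (mL (Suc j) \<odot> W [1] (mL j) [] \<odot> W [] cu (obj j))" (is "null ?x")
proof -
  have 2: "inv_qint 2 * qint q 2 = 1" using inv_qint'[of 2] j by auto
  have "?x = inv_qint 2 \<star> ((qint q 2 \<star> (mL (Suc j) \<odot> W [1] (mL j) [])) \<odot> W [] cu (obj j))"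
    by (simp add: linear 2 scl_one cmp_assoc)
  also have "\<dots> = inv_qint 2 \<star> (mL (Suc j) \<odot> W [1] (mL j) [] \<odot> W [] (sL 1) (obj j) \<odot> W [] (mL 1
      \<odot> cu) (obj j))"
    by (simp only: merge_V[OF j, symmetric] W_V W_cmp cmp_assoc)
  finally show ?thesis
    using j by (simp add: null_ops lollipop)
qed

lemma ca_split:
  assumes j: "Suc (Suc j) \<le> n"
  shows "null (W [] ca (obj j) \<odot> W [1] (sL j) [] \<odot> sL (Suc j))" (is "null ?x")
proof -
  have 2: "inv_qint 2 * qint q 2 = 1" using inv_qint'[of 2] j by auto
  have "?x = inv_qint 2 \<star> (W [] ca (obj j) \<odot> (qint q 2 \<star> (W [1] (sL j) [] \<odot> sL (Suc j))))"
    by (simp add: linear 2 scl_one)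
  also have "\<dots> = inv_qint 2 \<star> (W [] (ca \<odot> sL 1) (obj j) \<odot> W [] (mL 1) (obj j) \<odot> W [1] (sL j) []
      \<odot> sL (Suc j))"
    by (simp only: split_V[OF j, symmetric] W_V W_cmp cmp_assoc)
  finally show ?thesis
    using j by (simp add: null_ops lollipop_flipped)
qed

section \<open>Triangles\<close>

text \<open>The web $H_j$ on $1 \otimes (j + 1)$.\<close>

definition H :: "nat \<Rightarrow> 'r web" where "H j = W [] (mL j) [1] \<odot> W [1] (sR j) []"

text \<open>The vertices at which an edge \<open>j\<close> and a pair $1$, $j + 1$ meet: \<open>open_left\<close> and \<open>open_right\<close> lead from
\<open>j\<close> to $1 \otimes (j+1)$ and to $(j+1) \otimes 1$, and \<open>close_left\<close> leads from $1 \otimes (j+1)$ to \<open>j\<close>.\<close>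

definition open_left :: "nat \<Rightarrow> 'r web" where "open_left j = W [1] (mL j) [] \<odot> W [] cu (obj j)"
definition close_left :: "nat \<Rightarrow> 'r web" where "close_left j = W [] ca (obj j) \<odot> W [1] (sL j) []"
definition open_right :: "nat \<Rightarrow> 'r web" where "open_right j = W [] (mR j) [1] \<odot> W (obj j) cu []"

text \<open>The upper part of the recursion for the crossing.\<close>

definition under_merge :: "nat \<Rightarrow> 'r web \<Rightarrow> 'r web" where
  "under_merge k X = W [] (mL k) [1] \<odot> W [1] X []"

lemma under_merge_linear: "under_merge k (X \<oplus> Y) = under_merge k X
    \<oplus> under_merge k Y" "under_merge k (r \<star> X) = r \<star> under_merge k X"
  and under_merge_cmp: "under_merge k (X \<odot> Y) = under_merge k X \<odot> W [1] Y []"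
  by (simp_all add: under_merge_def linear W_cmp cmp_assoc)

lemma hom_open_right: "Suc j \<le> n \<Longrightarrow> hom (open_right j) (obj j) [Suc j, 1]"
  and hom_close_left: "Suc j \<le> n \<Longrightarrow> hom (close_left j) [1, Suc j] (obj j)"
  and hom_open_left: "Suc j \<le> n \<Longrightarrow> hom (open_left j) (obj j) [1, Suc j]"
  and hom_H: "Suc j \<le> n \<Longrightarrow> hom (H j) [1, Suc j] [Suc j, 1]"
  unfolding open_right_def close_left_def open_left_def H_def
  using n_pos by - ((rule hom_intros | simp add: obj_labels)+)

lemma hom_under_merge: "Suc k \<le> n \<Longrightarrow> hom X a (obj k @ [1]) \<Longrightarrow> hom (under_merge k X) (1 # a) [Suc k, 1]"
  unfolding under_merge_def using n_pos by - ((rule hom_intros | simp add: obj_labels | assumption)+)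

text \<open>Coassociativity makes a bigon out of the left strands.\<close>

lemma H_split:
  assumes "Suc (Suc j) \<le> n"
  shows "H j \<odot> sL (Suc j) = qint q (Suc j) \<star> sR (Suc j)"
proof -
  have "W [] (mL j) [1] \<odot> W [] (sL j) [1] = qint q (Suc j) \<star> nf (Strands [Suc j, 1])"
    using whisker[OF bigon_left[of j], of "[]" "[1]"] assms by (simp add: W_cmp W_scl W_strands)
  then show ?thesis
    by (simp add: H_def cmp_assoc split_coassoc[OF assms, symmetric] precomp linear strands_cmp)
qed

lemma under_merge_H_V:
  assumes "Suc (Suc j) \<le> n"
  shows "under_merge (Suc j) (H j) \<odot> W [] V [Suc j] = qint q 2 \<star> under_merge (Suc j) (H j)"
proof -
  have 1: "W [1, 1] (sR j) [] \<odot> W [] V [Suc j] = W [] V (obj j @ [1]) \<odot> W [1, 1] (sR j) []"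
    using exchange[of "[]" V "[]" "sR j" "[]"] by simp
  have 2: "W [] (mL (Suc j)) [1] \<odot> W [1] (mL j) [1] \<odot> W [] V (obj j @ [1])
      = qint q 2 \<star> (W [] (mL (Suc j)) [1] \<odot> W [1] (mL j) [1])"
    using whisker[OF merge_V[OF assms], of "[]" "[1]"] by (simp add: W_cmp W_W linear)
  show ?thesis
    by (simp add: under_merge_def H_def W_cmp W_W cmp_assoc 1 precomp3[OF 2] linear)
qed

text \<open>The two merging vertices of \<open>under_merge\<close> and $H_j$ follow each other and receive the cup.\<close>

lemma under_merge_H_cu:
  assumes "Suc (Suc j) \<le> n"
  shows "null (under_merge (Suc j) (H j) \<odot> W [] cu [Suc j])"
proof -
  have 1: "W [1, 1] (sR j) [] \<odot> W [] cu [Suc j] = W [] cu (obj j @ [1]) \<odot> sR j"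
    using exchange[of "[]" cu "[]" "sR j" "[]"] by (simp add: W_nil)
  have "under_merge (Suc j) (H j) \<odot> W [] cu [Suc j]
      = W [] (mL (Suc j) \<odot> W [1] (mL j) [] \<odot> W [] cu (obj j)) [1] \<odot> sR j"
    by (simp add: under_merge_def H_def W_cmp W_W cmp_assoc 1)
  then show ?thesis using merge_cu[OF assms] by (simp only: null_ops)
qed

text \<open>Associativity makes a bigon out of the lower part.\<close>

lemma under_merge_open_right:
  assumes "Suc (Suc j) \<le> n"
  shows "under_merge (Suc j) (open_right j) \<odot> sL j = qint q (Suc j) \<star> open_right (Suc j)"
proof -
  have 1: "W (1 # obj j) cu [] \<odot> sL j = W [] (sL j) [1, 1] \<odot> W [Suc j] cu []"
    using exchange[of "[]" "sL j" "[]" cu "[]"] by (simp add: W_nil)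
  have 2: "W [] (mL (Suc j)) [1] \<odot> W [1] (mR j) [1] = W [] (mR (Suc j)) [1] \<odot> W [] (mL j) [1, 1]"
    using whisker[OF merge_assoc[OF assms], of "[]" "[1]"] by (simp add: W_cmp W_W)
  have 3: "W [] (mL j) [1, 1] \<odot> W [] (sL j) [1, 1] = qint q (Suc j) \<star> nf (Strands [Suc j, 1, 1])"
    using whisker[OF bigon_left[of j], of "[]" "[1, 1]"] assms by (simp add: W_cmp W_scl W_strands)
  show ?thesis
    by (simp add: under_merge_def open_right_def W_cmp W_W cmp_assoc 1 precomp[OF 2] precomp[OF 3]
        linear W_strands_cmp)
qed

text \<open>This is $[n+1]/[n-j+1]$; for $j = 0$ it is $1$ even if $[n+1]$ is not invertible.\<close>

definition triangle_coeff :: "nat \<Rightarrow> 'r" where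
  "triangle_coeff j = (if j = 0 then 1 else qint q (Suc n) * inv_qint (Suc n - j))"

lemma two_minus_turn_coeff: "qint q 2 - turn_coeff = qint q (Suc n) * inv_qint n"
proof -
  have "qint q (Suc n) + qint q (n - 1) = qint q 2 * qint q n"
    using qint_Suc_Suc[OF q_unit, of "n - 1"] n_pos by simp
  then have "(qint q (Suc n) + qint q (n - 1)) * inv_qint n = qint q 2 * (qint q n * inv_qint n)"
    by (simp add: mult.assoc)
  then show ?thesis using inv_qint[of n] n_pos by (simp add: algebra_simps)
qed

lemma triangle_coeff_Suc:
  assumes "Suc (Suc j) \<le> n"
  shows "triangle_coeff (Suc j) = (qint q 2 - turn_coeff + switch_coeff j) * triangle_coeff j"
proof (cases "j = 0")
  case True
  then show ?thesis by (simp add: two_minus_turn_coeff triangle_coeff_def switch_coeff_def qint_0)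
next
  case False
  have 1: "qint q (Suc (n - j)) * qint q n = qint q (n - j) * qint q (Suc n) + qint q j"
    using qint_exchange[OF q_unit, of "n - j" j] assms by simp
  have 2: "qint q (n - j) * inv_qint (n - j) = 1" "qint q n * inv_qint n = 1"
    "qint q (Suc (n - j)) * inv_qint (Suc (n - j)) = 1"
    using inv_qint assms False by auto
  have "qint q (Suc n) * inv_qint n + switch_coeff j
      = qint q (Suc n) * (qint q (n - j) * inv_qint (n - j)) * inv_qint n + switch_coeff j"
    by (simp add: 2)
  also have "\<dots> = (qint q (n - j) * qint q (Suc n) + qint q j) * inv_qint n * inv_qint (n - j)"
    by (simp only: switch_coeff_def algebra_simps)
  also have "\<dots> = qint q (Suc (n - j)) * (qint q n * inv_qint n) * inv_qint (n - j)"
    by (simp only: 1[symmetric]) (simp only: mult_ac)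
  finally have "qint q (Suc n) * inv_qint n + switch_coeff j = qint q (Suc (n - j)) * inv_qint (n - j)"
    by (simp add: 2)
  moreover have "qint q (Suc (n - j)) * inv_qint (n - j) * (qint q (Suc n) * inv_qint (Suc (n - j)))
      = (qint q (Suc (n - j)) * inv_qint (Suc (n - j))) * (qint q (Suc n) * inv_qint (n - j))"
    by (simp only: mult_ac)
  ultimately show ?thesis
    using False assms by (simp add: two_minus_turn_coeff triangle_coeff_def 2 Suc_diff_le)
qed

text \<open>By \<open>H_split\<close>, $[j+1]$ times the triangle for $j + 1$ contains $H_j$ above the web \<open>merge_split j\<close>,
which the switching relation expands.  The identity contributes zero by \<open>under_merge_H_cu\<close>.  The other two
webs contain the triangle for \<open>j\<close>: for $U$ directly, for $V$ after it has moved around the cup.\<close>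

lemma H_open_left: "Suc j \<le> n \<Longrightarrow> H j \<odot> open_left j = triangle_coeff j \<star> open_right j"
proof (induction j)
  case 0
  then show ?case
    by (simp add: H_def open_left_def open_right_def triangle_coeff_def mL_0 mR_0 sR_0
        W_strands_cmp scl_one W_nil strands_cmp
        cmp_assoc flip: One_nat_def)
next
  case (Suc j)
  let ?k = "Suc j"
  let ?T = "\<lambda>X. under_merge ?k (H j \<odot> X) \<odot> W [] cu [?k]"
  have j: "Suc ?k \<le> n" "?k \<le> n" "2 \<le> n" using Suc.prems by auto
  have IH: "H j \<odot> W [1] (mL j) [] \<odot> W [] cu (obj j) = triangle_coeff j \<star> open_right j"
    using Suc.IH j by (simp add: open_left_def)
  have topR: "under_merge ?k (H j \<odot> W [1] (mL j) [] \<odot> W [] cu (obj j))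
      \<odot> sL j = (triangle_coeff j * qint q ?k) \<star> open_right ?k"
    by (simp add: IH under_merge_linear under_merge_open_right[OF j(1)] linear)
  have s: "W [1, 1] (sL j) [] \<odot> W [] cu [?k] = W [] cu (1 # obj j) \<odot> sL j"
    using exchange[of "[]" cu "[]" "sL j" "[]"] by (simp add: W_nil)
  have zz: "W [1] ca (obj j) \<odot> W [] cu (1 # obj j) = nf (Strands (1 # obj j))"
    using whisker[OF zigzag_right[of 1], of "[]" "obj j"]
        by (simp add: W_cmp W_W W_strands cap0_1 cup0_1)
  \<comment> \<open>The contributions of the three terms of the switching relation.\<close>
  have S: "?T (Strands [1, ?k]) = 0 \<star> open_right ?k"
  proof (rule null_eq)
    have "?T (Strands [1, ?k]) = under_merge ?k (H j) \<odot> W [] cu [?k]"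
      by (simp add: under_merge_cmp W_strands cmp_assoc strands_cmp W_strands_cmp)
    then show "null (?T (Strands [1, ?k]))" using under_merge_H_cu[OF j(1)] by simp
    show "hom (open_right ?k) [?k] [Suc ?k, 1]" using hom_open_right[OF j(1)] by simp
    show "hom (?T (Strands [1, ?k])) [?k] [Suc ?k, 1]"
      using j n_pos by - ((rule hom_cmp hom_under_merge hom_H hom_W hom_vertices | simp)+)
  qed
  have UU: "?T (W [1] (mL j) [] \<odot> W [] (cu \<odot> ca) (obj j)
      \<odot> W [1] (sL j) []) = (triangle_coeff j * qint q ?k) \<star> open_right ?k"
    using topR by (simp add: under_merge_cmp W_cmp W_W cmp_assoc s precomp[OF zz] strands_cmp)
  have VV: "?T (W [1] (mL j) [] \<odot> W [] V (obj j)
      \<odot> W [1] (sL j) []) = ((qint q 2 - turn_coeff) * triangle_coeff j * qint q ?k) \<star> open_right ?k"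
  proof -
    let ?Q = "under_merge ?k (H j) \<odot> W [1, 1] (mL j) []"
    have 1: "W [1] V (obj j) \<odot> W [] cu (1 # obj j)
        = W [] V (1 # obj j) \<odot> W [1] cu (obj j) \<oplus> turn_coeff \<star> W [] cu (1 # obj j)
            \<oplus> (- turn_coeff) \<star> W [1] cu (obj j)"
      using whisker[OF V_cu[OF j(3)], of "[]" "obj j"] by (simp add: W_cmp W_W linear)
    have 2: "W [1, 1] (mL j) [] \<odot> W [] V (1 # obj j) = W [] V [?k] \<odot> W [1, 1] (mL j) []"
      using exchange[of "[]" V "[]" "mL j" "[]"] by simp
    have 3: "W [1, 1] (mL j) [] \<odot> W [] cu (1 # obj j) = W [] cu [?k] \<odot> mL j"
      using exchange[of "[]" cu "[]" "mL j" "[]"] by (simp add: W_nil)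
    \<comment> \<open>The contributions of the three terms of \<open>V_cu\<close>.\<close>
    have Q: "?Q \<odot> W [1] cu (obj j) \<odot> sL j = (triangle_coeff j * qint q ?k) \<star> open_right ?k"
      using topR by (simp add: under_merge_cmp W_cmp W_W cmp_assoc)
    have Q12: "?Q \<odot> W [] V (1 # obj j) \<odot> W [1] cu (obj j)
        \<odot> sL j = qint q 2 \<star> (triangle_coeff j * qint q ?k) \<star> open_right ?k"
      using Q by (simp add: cmp_assoc precomp[OF 2] precomp[OF under_merge_H_V[OF j(1)]] linear)
    have Qcu: "?Q \<odot> W [] cu (1 # obj j) \<odot> sL j = 0 \<star> open_right ?k"
    proof (rule null_eq)
      have "?Q \<odot> W [] cu (1 # obj j) \<odot> sL j = (under_merge ?k (H j) \<odot> W [] cu [?k]) \<odot> mL j \<odot> sL j"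
        by (simp add: cmp_assoc precomp[OF 3])
      then show "null (?Q \<odot> W [] cu (1 # obj j) \<odot> sL j)"
        using under_merge_H_cu[OF j(1)] by (simp only: null_ops)
      show "hom (open_right ?k) [?k] [Suc ?k, 1]" using hom_open_right[OF j(1)] by simp
      show "hom (?Q \<odot> W [] cu (1 # obj j) \<odot> sL j) [?k] [Suc ?k, 1]"
        using j n_pos by - ((rule hom_cmp hom_under_merge hom_H hom_W hom_vertices | simp add:
            obj_labels)+)
    qed
    have "?T (W [1] (mL j) [] \<odot> W [] V (obj j) \<odot> W [1] (sL j) [])
       = ?Q \<odot> (W [1] V (obj j) \<odot> W [] cu (1 # obj j)) \<odot> sL j"
      by (simp add: under_merge_cmp W_cmp W_W cmp_assoc s)
    also have "\<dots> = qint q 2 \<star> (triangle_coeff j * qint q ?k) \<star> open_right ?k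
        \<oplus> turn_coeff \<star> 0 \<star> open_right ?k \<oplus> (- turn_coeff) \<star> (triangle_coeff j * qint q ?k) \<star>
        open_right ?k"
      unfolding 1 by (simp only: cmp_add_left cmp_add_right cmp_scl_left cmp_scl_right cmp_assoc
          Q[unfolded cmp_assoc] Q12[unfolded cmp_assoc] Qcu[unfolded cmp_assoc])
    also have "\<dots> = (qint q 2 * (triangle_coeff j * qint q ?k) + turn_coeff * 0 + (- turn_coeff) *
        (triangle_coeff j * qint q ?k)) \<star> open_right ?k"
      by (simp only: scl_scl scl_add_scalar)
    finally show ?thesis by (simp add: algebra_simps)
  qed
  have "qint q ?k \<star> (H ?k \<odot> open_left ?k) = W [] (mL ?k) [1] \<odot> W [1] (qint q ?k \<star> sR ?k) []
      \<odot> W [1] (mL ?k) [] \<odot> W [] cu [?k]"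
    by (simp add: H_def open_left_def linear cmp_assoc)
  also have "\<dots> = ?T (merge_split j)"
    using j by (simp add: H_split[symmetric] merge_split_def under_merge_def W_cmp W_W cmp_assoc)
  also have "\<dots> = ((qint q 2 - turn_coeff) * triangle_coeff j * qint q ?k) \<star> open_right ?k
      \<oplus> switch_coeff j \<star> (triangle_coeff j * qint q ?k) \<star> open_right ?k
      \<oplus> (- qint q j) \<star> 0 \<star> open_right ?k"
    by (simp only: switch_turned[OF j(2,3)] cmp_add_left cmp_add_right cmp_scl_left cmp_scl_right
        under_merge_linear UU VV S)
  also have "\<dots> = ((qint q 2 - turn_coeff) * triangle_coeff j * qint q ?k + switch_coeff j *
      (triangle_coeff j * qint q ?k) + (- qint q j) * 0) \<star> open_right ?k"
    by (simp only: scl_scl scl_add_scalar)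
  also have "\<dots> = (qint q ?k * triangle_coeff ?k) \<star> open_right ?k"
    by (simp add: triangle_coeff_Suc[OF j(1)] algebra_simps)
  finally have "nf (H ?k \<odot> open_left ?k) = nf (triangle_coeff ?k \<star> open_right ?k)"
    using inv_qint'[of ?k] j by (intro scl_cancel[of "inv_qint ?k" "qint q ?k"]) (auto simp: scl_scl)
  then show ?case by (simp add: H_def)
qed

section \<open>The formula for the crossing\<close>

text \<open>The web $I_{k+1}$ on $1 \otimes k$, which is zero for $k = n$.\<close>

definition I_plus :: "nat \<Rightarrow> 'r web" where
  "I_plus k = (if Suc k \<le> n then sR k \<odot> mL k else nf (Zero [1, k] [k, 1]))"

definition q_inv :: 'r where "q_inv = unit_inv q"

text \<open>The number $q^{n-k+1}/[n-k+1]$, $k = j + 1$, that occurs in the coefficient of $I_{k-1}$; for $j = 0$ it is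
the coefficient of $U$ in $\beta_1$.\<close>

definition cap_coeff :: "nat \<Rightarrow> 'r" where "cap_coeff j = q ^ (n - j) * inv_qint (n - j)"

lemma qint_add: "qint q (a + b) = q ^ b * qint q a + q_inv ^ a * qint q b"
proof (induction b)
  case 0
  then show ?case by (simp add: qint_0)
next
  case (Suc b)
  have "qint q (a + Suc b) = q * qint q (a + b) + q_inv ^ (a + b)"
    using qint_Suc[OF q_unit, of "a + b"] qpow_minus_of_nat[OF q_unit, of "a + b"]
        by (simp add: q_inv_def)
  moreover have "qint q (Suc b) = q * qint q b + q_inv ^ b"
    using qint_Suc[OF q_unit, of b] qpow_minus_of_nat[OF q_unit, of b] by (simp add: q_inv_def)
  ultimately show ?case by (simp add: Suc.IH power_add algebra_simps)
qed

lemma coefficient_H: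
  "qint q k + (- q_inv) * qint q (Suc k) + (- q_inv) * (qint q 2 * qint q k) + (- q_inv) * (-
      q_inv) * qint q k
    = - q_inv * qint q (Suc k)"
proof -
  have "q_inv * (qint q 2 * qint q k) = (q_inv * q) * qint q k + q_inv * q_inv * qint q k"
    by (simp add: qint_2[OF q_unit] q_inv_def algebra_simps)
  then show ?thesis using q_unit_inv[OF q_unit] by (simp add: q_inv_def algebra_simps)
qed

text \<open>With $m = n - k$ this follows from three relations: $[n+1] = q^{m+1}[k] + q^{-k}[m+1]$,
$1 + q^{m+1}[m] = q^m[m+1]$ and $[m] + [k][n+1] = [k+1][n]$.\<close>

lemma coefficient_I:
  assumes "Suc (Suc j) \<le> n"
  defines "k \<equiv> Suc j"
  shows "switch_coeff k * triangle_coeff k + cap_coeff 0 * triangle_coeff k + cap_coeff j * ((qint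
      q 2 - turn_coeff) * qint q k) - cap_coeff j * cap_coeff 0 * qint q k
    = qint q (Suc k) * cap_coeff k"
proof -
  define m where "m = n - k"
  have n: "n = m + k" "n - j = Suc m" "Suc n - k = Suc m" "1 \<le> m" "n - k = m" using assms
      by (auto simp: m_def)
  define iN where "iN = inv_qint n"
  define iM where "iM = inv_qint m"
  define iM1 where "iM1 = inv_qint (Suc m)"
  have inv: "qint q n * iN = 1" "qint q m * iM = 1" "qint q (Suc m) * iM1 = 1"
    using inv_qint n assms(1) by (auto simp: iN_def iM_def iM1_def k_def)
  have A: "q ^ n * (qint q (Suc n) - q ^ Suc m * qint q k) = q ^ m * qint q (Suc m)"
  proof -
    have "qint q (Suc n) - q ^ Suc m * qint q k = q_inv ^ k * qint q (Suc m)"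
      using qint_add[of k "Suc m"] by (simp add: n(1) add.commute)
    moreover have "q ^ n * (q_inv ^ k * qint q (Suc m)) = q ^ m * (q ^ k * q_inv ^ k) * qint q (Suc m)"
      by (simp add: n(1) power_add mult_ac)
    ultimately show ?thesis using q_power_inv[OF q_unit, of k] by (simp add: q_inv_def)
  qed
  have B: "1 + q ^ Suc m * qint q m = q ^ m * qint q (Suc m)"
  proof -
    have "q ^ m * qint q (Suc m) = q ^ Suc m * qint q m + q ^ m * q_inv ^ m"
      using qint_add[of m "Suc 0"] qint_1[of q] by (simp add: algebra_simps)
    then show ?thesis using q_power_inv[OF q_unit, of m] by (simp add: q_inv_def)
  qed
  have C: "qint q m + qint q k * qint q (Suc n) = qint q (Suc k) * qint q n"
    using qint_exchange[OF q_unit, of k m] by (simp add: n(1) add.commute)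
  have "switch_coeff k * triangle_coeff k + cap_coeff 0 * triangle_coeff k + cap_coeff j * ((qint
      q 2 - turn_coeff) * qint q k) - cap_coeff j * cap_coeff 0 * qint q k
    = iN * iM1 * (qint q k * qint q (Suc n) * iM + q ^ Suc m * (qint q k * qint q (Suc n))
        + q ^ n * (qint q (Suc n) - q ^ Suc m * qint q k))"
    unfolding two_minus_turn_coeff switch_coeff_def triangle_coeff_def cap_coeff_def n(2,3,5)
        iN_def iM_def iM1_def
    by (simp add: k_def algebra_simps)
  also have "qint q k * qint q (Suc n) * iM + q ^ Suc m * (qint q k * qint q (Suc n))
      = qint q k * qint q (Suc n) * iM * (1 + q ^ Suc m * qint q m)"
  proof -
    have "qint q k * qint q (Suc n) * iM * (1 + q ^ Suc m * qint q m)
      = qint q k * qint q (Suc n) * iM + q ^ Suc m * (qint q k * qint q (Suc n)) * (qint q m * iM)"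
      by (simp add: algebra_simps)
    then show ?thesis by (simp add: inv)
  qed
  also have "iN * iM1 * (qint q k * qint q (Suc n) * iM * (1 + q ^ Suc m * qint q m)
        + q ^ n * (qint q (Suc n) - q ^ Suc m * qint q k))
      = iN * q ^ m * (qint q (Suc m) * iM1) * (qint q k * qint q (Suc n) * iM + 1)"
    unfolding A B by (simp add: algebra_simps)
  also have "\<dots> = iN * q ^ m * (qint q k * qint q (Suc n) * iM + qint q m * iM)"
    by (simp add: inv)
  also have "\<dots> = iN * q ^ m * iM * (qint q m + qint q k * qint q (Suc n))"
    by (simp add: algebra_simps)
  also have "\<dots> = (qint q n * iN) * (qint q (Suc k) * (q ^ m * iM))"
    unfolding C by (simp add: algebra_simps)
  finally show ?thesis by (simp add: inv cap_coeff_def n(5) iM_def)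
qed

lemma H_merge_split:
  assumes k: "Suc k \<le> n"
  shows "H k \<odot> merge_split k = qint q (Suc k) \<star> I_plus (Suc k)"
proof (cases "Suc (Suc k) \<le> n")
  case True
  then show ?thesis by (simp add: merge_split_def I_plus_def H_split precomp cmp_assoc[symmetric]
      linear)
next
  case False
  let ?Z = "Zero [1, Suc k] [Suc k, 1]"
  have Z: "hom ?Z [1, Suc k] [Suc k, 1]" "hom (Zero [1, Suc k] [1, Suc k]) [1, Suc k] [1, Suc k]"
    using k n_pos by (simp_all add: hom_def typed_simps)
  have "H k \<odot> merge_split k = 0 \<star> ?Z"
    using False hom_cmp[OF Z(2) hom_H[OF k]] Z(1)
    by (intro null_eq) (auto simp: merge_split_def intro: null_ops(2)[OF null_Zero, simplified])
  moreover have "qint q (Suc k) \<star> I_plus (Suc k) = 0 \<star> ?Z"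
    using False Z(1) null_ops(4)[OF null_Zero]
    by (intro null_eq[of _ "[1, Suc k]" "[Suc k, 1]"]) (auto simp: I_plus_def hom_def typed_ops
        source_target_ops)
  ultimately show ?thesis by simp
qed

lemma open_close_left: "open_left k \<odot> close_left k = W [1] (mL k) [] \<odot> W [] (cu \<odot> ca) (obj k)
    \<odot> W [1] (sL k) []"
  by (simp add: open_left_def close_left_def W_cmp cmp_assoc)

text \<open>The nine webs in the expansion of $[k+1]\beta_{k+1}$: \<open>X\<close> runs over the webs of $\beta_k$ and \<open>Y\<close> over those of
$\beta_1$.\<close>

lemma crossing_terms:
  assumes j: "Suc (Suc j) \<le> n"
  defines "k \<equiv> Suc j"
  defines "T \<equiv> \<lambda>X Y. under_merge k X \<odot> W [] Y [k] \<odot> W [1] (sL k) []"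
  shows
    "T (sR k \<odot> mL k) V = qint q (Suc k) \<star> I_plus (Suc k)
        \<oplus> (- (switch_coeff k * triangle_coeff k)) \<star> (open_right k \<odot> close_left k) \<oplus> qint q k \<star> H k"
    "T (sR k \<odot> mL k) (Strands [1, 1]) = qint q (Suc k) \<star> H k"
    "T (sR k \<odot> mL k) (cu \<odot> ca) = triangle_coeff k \<star> (open_right k \<odot> close_left k)"
    "T (H j) V = (qint q 2 * qint q k) \<star> H k"
    "T (H j) (Strands [1, 1]) = qint q k \<star> H k"
    "T (H j) (cu \<odot> ca) = 0 \<star> (open_right k \<odot> close_left k)"
    "T (open_right j \<odot> close_left j) V = ((qint q 2 - turn_coeff) * qint q k) \<star> (open_right k
        \<odot> close_left k)"
    "T (open_right j \<odot> close_left j) (Strands [1, 1]) = 0 \<star> (open_right k \<odot> close_left k)"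
    "T (open_right j \<odot> close_left j) (cu \<odot> ca) = qint q k \<star> (open_right k \<odot> close_left k)"
proof -
  have k: "Suc k \<le> n" "k \<le> n" "2 \<le> n" "obj k = [k]" "1 \<le> k" using j by (auto simp: k_def)
  have hom_RL: "hom (open_right k \<odot> close_left k) [1, Suc k] [Suc k, 1]"
    by (rule hom_cmp[OF hom_close_left[OF k(1)] hom_open_right[OF k(1)]])
  have RL: "hom (open_right j \<odot> close_left j) [1, k] (obj k @ [1])"
    using hom_cmp[OF hom_close_left hom_open_right] k by (simp add: k_def)
  have topI: "under_merge k (sR k \<odot> mL k) = H k \<odot> W [1] (mL k) []"
    by (simp add: under_merge_def H_def W_cmp cmp_assoc)
  let ?VV = "W [1] (mL k) [] \<odot> W [] V [k] \<odot> W [1] (sL k) []"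
  have strands: "W [] (Strands [1, 1]) [k] \<odot> W [1] (sL k) [] = W [1] (sL k) []"
    by (simp add: W_strands W_strands_cmp k(4))
  \<comment> \<open>The switching relation is solved for the term containing \<open>V\<close>.\<close>
  have "nf ?VV = merge_split k \<oplus> (- switch_coeff k) \<star> (open_left k \<odot> close_left k)
      \<oplus> (- (- qint q k)) \<star> Strands [1, Suc k]"
  proof (rule move_terms)
    show "merge_split k = ?VV \<oplus> switch_coeff k \<star> (open_left k \<odot> close_left k)
        \<oplus> (- qint q k) \<star> Strands [1, Suc k]"
      using switch_turned[OF k(1,3)] by (simp add: open_close_left k(4))
    show "hom ?VV [1, Suc k] [1, Suc k]" "hom (Strands [1, Suc k]) [1, Suc k] [1, Suc k]"
      using k n_pos by - (rule hom_intros | simp)+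
    show "hom (open_left k \<odot> close_left k) [1, Suc k] [1, Suc k]"
      by (rule hom_cmp[OF hom_close_left[OF k(1)] hom_open_left[OF k(1)]])
  qed
  then have VV: "?VV = merge_split k \<oplus> (- switch_coeff k) \<star> (open_left k \<odot> close_left k)
      \<oplus> qint q k \<star> Strands [1, Suc k]"
    by simp
  have "H k \<odot> open_left k \<odot> close_left k = triangle_coeff k \<star> (open_right k \<odot> close_left k)"
    by (simp add: precomp[OF H_open_left[OF k(1)]] linear)
  moreover have "H k \<odot> Strands [1, Suc k] = H k"
    by (simp add: H_def cmp_assoc W_cmp_strands)
  ultimately show "T (sR k \<odot> mL k) V
      = qint q (Suc k) \<star> I_plus (Suc k) \<oplus> (- (switch_coeff k * triangle_coeff k)) \<star> (open_right k
          \<odot> close_left k) \<oplus> qint q k \<star> H k"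
    by (simp add: T_def topI cmp_assoc VV linear H_merge_split[OF k(1)])
  have "W [1] (mL k) [] \<odot> W [1] (sL k) [] = qint q (Suc k) \<star> nf (Strands [1, Suc k])"
    using whisker[OF bigon_left[OF k(1)], of "[1]" "[]"] by (simp add: W_cmp W_scl W_strands)
  then show "T (sR k \<odot> mL k) (Strands [1, 1]) = qint q (Suc k) \<star> H k"
    by (simp add: T_def topI cmp_assoc strands linear) (simp add: H_def cmp_assoc W_cmp_strands)
  show "T (sR k \<odot> mL k) (cu \<odot> ca) = triangle_coeff k \<star> (open_right k \<odot> close_left k)"
    using precomp[OF H_open_left[OF k(1)], of "close_left k"]
        by (simp add: T_def topI cmp_assoc open_close_left k(4) linear)
  have topH: "under_merge k (H j) \<odot> W [1] (sL k) [] = qint q k \<star> H k"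
    using H_split[OF j] by (simp add: k_def under_merge_cmp[symmetric] under_merge_linear) (simp
        add: under_merge_def H_def)
  show "T (H j) V = (qint q 2 * qint q k) \<star> H k"
    unfolding T_def using under_merge_H_V[OF j] topH by (simp add: k_def precomp linear)
  show "T (H j) (Strands [1, 1]) = qint q k \<star> H k"
    unfolding T_def by (simp add: strands topH)
  show "T (H j) (cu \<odot> ca) = 0 \<star> (open_right k \<odot> close_left k)"
  proof (rule null_eq[OF _ _ hom_RL])
    have "T (H j) (cu \<odot> ca) = (under_merge k (H j) \<odot> W [] cu [k]) \<odot> W [] ca [k] \<odot> W [1] (sL k) []"
      by (simp add: T_def W_cmp cmp_assoc)
    then show "null (T (H j) (cu \<odot> ca))" using under_merge_H_cu[OF j] by (simp only: null_ops k_def)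
    show "hom (T (H j) (cu \<odot> ca)) [1, Suc k] [Suc k, 1]"
      unfolding T_def using k n_pos by - (rule hom_cmp hom_under_merge hom_H hom_W hom_vertices |
          simp add: k_def)+
  qed
  have topRL: "under_merge k (open_right j \<odot> close_left j) = under_merge k (open_right j)
      \<odot> W [1] ca (obj j) \<odot> W [1, 1] (sL j) []"
    by (simp add: under_merge_cmp close_left_def W_cmp W_W)
  have topR: "under_merge k (open_right j) \<odot> sL j \<odot> close_left k = qint q k \<star> (open_right k
      \<odot> close_left k)"
    using precomp[OF under_merge_open_right[OF j], of "close_left k"] by (simp add: k_def linear)
  let ?Z = "W [1, 1] (sL j) [] \<odot> W [1] (sL k) []"
  have ca_Z: "W [] ca (1 # obj j) \<odot> ?Z = sL j \<odot> close_left k"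
  proof -
    have "W [] ca (1 # obj j) \<odot> W [1, 1] (sL j) [] = sL j \<odot> W [] ca [k]"
      using exchange[of "[]" ca "[]" "sL j" "[]"] by (simp add: W_nil k_def)
    from precomp[OF this] show ?thesis by (simp add: close_left_def k(4) cmp_assoc)
  qed
  show "T (open_right j \<odot> close_left j) V = ((qint q 2 - turn_coeff) * qint q k) \<star> (open_right k
      \<odot> close_left k)"
  proof -
    have 1: "W [1, 1] (sL j) [] \<odot> W [] V [k] = W [] V (1 # obj j) \<odot> W [1, 1] (sL j) []"
      using exchange[of "[]" V "[]" "sL j" "[]"] by (simp add: k_def)
    have 2: "W [1] ca (obj j) \<odot> W [] V (1 # obj j)
        = W [] ca (1 # obj j) \<odot> W [1] V (obj j) \<oplus> turn_coeff \<star> W [1] ca (obj j)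
            \<oplus> (- turn_coeff) \<star> W [] ca (1 # obj j)"
      using whisker[OF ca_V[OF k(3)], of "[]" "obj j"] by (simp add: W_cmp W_W linear)
    have 3: "W [1] V (obj j) \<odot> ?Z = qint q 2 \<star> ?Z"
      using whisker[OF split_V[OF j], of "[1]" "[]"] by (simp add: W_cmp W_W linear k_def)
    have 4: "under_merge k (open_right j) \<odot> W [1] ca (obj j) \<odot> ?Z = 0 \<star> (open_right k \<odot> close_left k)"
    proof (rule null_eq[OF _ _ hom_RL])
      have "null (W [1] (W [] ca (obj j) \<odot> W [1] (sL j) [] \<odot> sL k) [])"
        unfolding k_def by (rule null_ops(3)[OF ca_split[OF j]])
      then have "null (W [1] ca (obj j) \<odot> ?Z)" by (simp add: W_cmp W_W)
      then show "null (under_merge k (open_right j) \<odot> W [1] ca (obj j) \<odot> ?Z)" by (rule null_ops(2))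
      show "hom (under_merge k (open_right j) \<odot> W [1] ca (obj j) \<odot> ?Z) [1, Suc k] [Suc k, 1]"
        using k n_pos by - (rule hom_cmp hom_under_merge hom_open_right hom_W hom_vertices | simp
            add: k_def obj_labels)+
    qed
    have "T (open_right j \<odot> close_left j) V = under_merge k (open_right j) \<odot> (W [1] ca (obj j)
        \<odot> W [] V (1 # obj j)) \<odot> ?Z"
      by (simp add: T_def topRL cmp_assoc precomp[OF 1])
    also have "\<dots> = qint q 2 \<star> qint q k \<star> (open_right k \<odot> close_left k)
        \<oplus> turn_coeff \<star> 0 \<star> (open_right k \<odot> close_left k)
        \<oplus> (- turn_coeff) \<star> qint q k \<star> (open_right k \<odot> close_left k)"
      unfolding 2 by (simp only: cmp_add_left cmp_add_right cmp_scl_left cmp_scl_right cmp_assoc 3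
          4 ca_Z topR)
    also have "\<dots> = (qint q 2 * qint q k + turn_coeff * 0 + (- turn_coeff) * qint q k) \<star>
        (open_right k \<odot> close_left k)"
      by (simp only: scl_scl scl_add_scalar)
    finally show ?thesis by (simp add: algebra_simps)
  qed
  show "T (open_right j \<odot> close_left j) (Strands [1, 1]) = 0 \<star> (open_right k \<odot> close_left k)"
  proof (rule null_eq[OF _ _ hom_RL])
    have "T (open_right j \<odot> close_left j) (Strands [1, 1]) = under_merge k (open_right j)
        \<odot> W [1] (W [] ca (obj j) \<odot> W [1] (sL j) [] \<odot> sL k) []"
      by (simp add: T_def topRL cmp_assoc strands W_cmp W_W)
    then show "null (T (open_right j \<odot> close_left j) (Strands [1, 1]))"
      using ca_split[OF j] by (simp only: null_ops k_def)
    show "hom (T (open_right j \<odot> close_left j) (Strands [1, 1])) [1, Suc k] [Suc k, 1]"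
      unfolding T_def using k n_pos
      by - (rule RL hom_cmp hom_under_merge hom_W hom_vertices | simp)+
  qed
  show "T (open_right j \<odot> close_left j) (cu \<odot> ca) = qint q k \<star> (open_right k \<odot> close_left k)"
  proof -
    have 1: "W [1, 1] (sL j) [] \<odot> W [] cu [k] = W [] cu (1 # obj j) \<odot> sL j"
      using exchange[of "[]" cu "[]" "sL j" "[]"] by (simp add: W_nil k_def)
    have 2: "W [1] ca (obj j) \<odot> W [] cu (1 # obj j) = nf (Strands (1 # obj j))"
      using whisker[OF zigzag_right[of 1], of "[]" "obj j"]
          by (simp add: W_cmp W_W W_strands cap0_1 cup0_1)
    have 3: "Strands (1 # obj j) \<odot> sL j \<odot> X = sL j \<odot> X" for X
      by (simp add: cmp_assoc[symmetric] strands_cmp)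
    have "T (open_right j \<odot> close_left j) (cu \<odot> ca) = under_merge k (open_right j) \<odot> sL j
        \<odot> W [] ca [k] \<odot> W [1] (sL k) []"
      by (simp add: T_def topRL W_cmp cmp_assoc precomp[OF 1] precomp[OF 2] 3)
    then show ?thesis
      using topR by (simp add: close_left_def k(4))
  qed
qed

lemma scl_web: "r \<star> (t \<^bold>\<circ> s) = r \<star> (t \<odot> s)"
  by (metis nf_ops nf_web)

lemma nf_web_V: "nf (web_V n) = (if 2 \<le> n then nf V else nf (Zero [1, 1] [1, 1]))"
  by (simp add: web_V_def with_edge_def V_def sL_def mL_def split0_def merge0_def)

lemma nf_beta1:
  "nf (beta1 n q) = q_inv \<star> Strands [1, 1] \<oplus> cap_coeff 0 \<star> (cu \<odot> ca) \<oplus> (- 1) \<star> nf (web_V n)"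
proof -
  have "qpow q (- 1) = q_inv" "qpow q (int n) * unit_inv (qint q n) = cap_coeff 0"
    using qpow_minus_of_nat[OF q_unit, of 1] qpow_of_nat[of q n]
    by (simp_all add: q_inv_def cap_coeff_def inv_qint_def)
  then show ?thesis
    unfolding beta1_def nf_web(3)
    by (simp add: web_U_def cu_def ca_def) (metis nf_ops nf_web)
qed

lemma crossing:
  "Suc j \<le> n \<Longrightarrow> (- 1) ^ Suc j \<star> beta n q (Suc j)
     = I_plus (Suc j) \<oplus> (- q_inv) \<star> H j \<oplus> (- cap_coeff j) \<star> (open_right j \<odot> close_left j)"
proof (induction j)
  case 0
  have V: "nf (web_V n) = I_plus 1"
    by (simp add: nf_web_V I_plus_def V_def nf_web sL_def sR_def split0_def)
  have "(- 1) \<star> beta n q 1 = (- 1) \<star> nf (beta1 n q)" by (simp add: One_nat_def)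
  also have "\<dots> = (- q_inv) \<star> Strands [1, 1] \<oplus> (- cap_coeff 0) \<star> (cu \<odot> ca) \<oplus> nf (web_V n)"
    by (simp add: nf_beta1 linear scl_one)
  also have "\<dots> = I_plus 1 \<oplus> (- q_inv) \<star> Strands [1, 1] \<oplus> (- cap_coeff 0) \<star> (cu \<odot> ca)"
    by (simp only: V add_ac)
  finally show ?case
    by (simp add: H_def open_right_def close_left_def mL_0 mR_0 sL_0 sR_0 W_nil strands_idem
        W_strands_cmp strands_cmp
        cmp_strands flip: One_nat_def)
next
  case (Suc j)
  let ?k = "Suc j"
  let ?T = "\<lambda>X Y. under_merge ?k X \<odot> W [] Y [?k] \<odot> W [1] (sL ?k) []"
  let ?I = "sR ?k \<odot> mL ?k" and ?S = "Strands [1, 1]" and ?U = "cu \<odot> ca"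
  let ?P = "I_plus (Suc ?k)" and ?H = "H ?k" and ?N = "open_right ?k \<odot> close_left ?k"
  have j: "Suc ?k \<le> n" "2 \<le> n" using Suc.prems by auto
  note terms = crossing_terms[OF j(1)]
  let ?X = "W [] (mL ?k) [1] \<odot> W [1] (beta n q ?k) [] \<odot> W [] (beta1 n q) [?k] \<odot> W [1] (sL ?k) []"
  have "(- 1) ^ Suc ?k \<star> beta n q (Suc ?k) = (- 1) ^ Suc ?k \<star> nf (beta n q (Suc ?k))"
    by simp
  also have "nf (beta n q (Suc ?k)) = inv_qint (Suc ?k) \<star> ?X"
    by (simp add: Let_def nf_web nf_web_arg scl_web inv_qint_def mL_def sL_def merge0_def split0_def
        W_nil_left W_nil_right flip: Suc_eq_plus1)
  also have "(- 1) ^ Suc ?k \<star> inv_qint (Suc ?k) \<star> ?X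
      = inv_qint (Suc ?k) \<star> ?T ((- 1) ^ ?k \<star> beta n q ?k) ((- 1) \<star> nf (beta1 n q))"
    by (simp add: under_merge_def linear cmp_assoc mult_ac)
  also have "(- 1) ^ ?k \<star> beta n q ?k = ?I \<oplus> (- q_inv) \<star> H j \<oplus> (- cap_coeff j) \<star> (open_right j
      \<odot> close_left j)"
    using Suc.IH j by (simp add: I_plus_def)
  also have "(- 1) \<star> nf (beta1 n q) = (- q_inv) \<star> ?S \<oplus> (- cap_coeff 0) \<star> ?U \<oplus> V"
    using j by (simp add: nf_beta1 nf_web_V linear scl_one)
  also have "?T (?I \<oplus> (- q_inv) \<star> H j \<oplus> (- cap_coeff j) \<star> (open_right j
      \<odot> close_left j)) ((- q_inv) \<star> ?S \<oplus> (- cap_coeff 0) \<star> ?U \<oplus> V)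
     = ?T ?I V \<oplus> (- q_inv) \<star> ?T ?I ?S \<oplus> (- cap_coeff 0) \<star> ?T ?I ?U
      \<oplus> (- q_inv) \<star> ?T (H j) V \<oplus> (- q_inv) \<star> (- q_inv) \<star> ?T (H j) ?S
          \<oplus> (- q_inv) \<star> (- cap_coeff 0) \<star> ?T (H j) ?U
      \<oplus> (- cap_coeff j) \<star> ?T (open_right j \<odot> close_left j) V
          \<oplus> (- cap_coeff j) \<star> (- q_inv) \<star> ?T (open_right j \<odot> close_left j) ?S
      \<oplus> (- cap_coeff j) \<star> (- cap_coeff 0) \<star> ?T (open_right j \<odot> close_left j) ?U"
    by (simp only: linear under_merge_linear add_ac mult.commute)
  also have "\<dots> = qint q (Suc ?k) \<star> ?P
      \<oplus> (qint q ?k + (- q_inv) * qint q (Suc ?k) + (- q_inv) * (qint q 2 * qint q ?k) + (- q_inv)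
          * (- q_inv) * qint q ?k) \<star> ?H
      \<oplus> (- (switch_coeff ?k * triangle_coeff ?k) + (- cap_coeff 0) * triangle_coeff ?k + (- q_inv)
          * (- cap_coeff 0) * 0 + (- cap_coeff j) * ((qint q 2 - turn_coeff) * qint q ?k)
          + (- cap_coeff j) * (- q_inv) * 0 + (- cap_coeff j) * (- cap_coeff 0) * qint q ?k) \<star> ?N"
    unfolding terms by (simp only: scl_scl scl_add_scalar add_ac mult.assoc)
  also have "- (switch_coeff ?k * triangle_coeff ?k) + (- cap_coeff 0) * triangle_coeff ?k + (-
      q_inv) * (- cap_coeff 0) * 0 + (- cap_coeff j) * ((qint q 2 - turn_coeff) * qint q ?k)
          + (- cap_coeff j) * (- q_inv) * 0 + (- cap_coeff j) * (- cap_coeff 0) * qint q ?k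
      = - (switch_coeff ?k * triangle_coeff ?k + cap_coeff 0 * triangle_coeff ?k + cap_coeff j *
          ((qint q 2 - turn_coeff) * qint q ?k) - cap_coeff j * cap_coeff 0 * qint q ?k)"
    by (simp add: algebra_simps)
  also have "inv_qint (Suc ?k) \<star> (qint q (Suc ?k) \<star> ?P
      \<oplus> (qint q ?k + (- q_inv) * qint q (Suc ?k) + (- q_inv) * (qint q 2 * qint q ?k) + (- q_inv)
          * (- q_inv) * qint q ?k) \<star> ?H
      \<oplus> (- (switch_coeff ?k * triangle_coeff ?k + cap_coeff 0 * triangle_coeff ?k + cap_coeff j *
          ((qint q 2 - turn_coeff) * qint q ?k) - cap_coeff j * cap_coeff 0 * qint q ?k)) \<star> ?N)
    = (inv_qint (Suc ?k) * qint q (Suc ?k)) \<star> ?P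
        \<oplus> ((inv_qint (Suc ?k) * qint q (Suc ?k)) * - q_inv) \<star> ?H
      \<oplus> ((inv_qint (Suc ?k) * qint q (Suc ?k)) * - cap_coeff ?k) \<star> ?N"
    unfolding coefficient_H coefficient_I[OF j(1)]
    by (simp add: scl_add scl_scl mult_ac)
  also have "\<dots> = nf ?P \<oplus> (- q_inv) \<star> ?H \<oplus> (- cap_coeff ?k) \<star> ?N"
    using inv_qint'[of "Suc ?k"] j by (simp add: scl_one)
  finally show ?case by simp
qed

lemma split_decreasing_right: "nf (split0 (Suc j) 1 j) = open_right j"
  using rotate_right[OF legs_Suc(2), of j] by (simp add: open_right_def mR_def cup0_1)

lemma crossing_web_equal:
  assumes j: "Suc j \<le> n"
  shows "web_equal [1, Suc j] [Suc j, 1] ((- 1) ^ Suc j \<^bold>* beta n q (Suc j))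
    (web_I n (Suc j) (Suc (Suc j)) \<^bold>+ (- q_inv) \<^bold>* web_H n (Suc j) j \<^bold>+ (- cap_coeff j) \<^bold>* web_I n
        (Suc j) j)"
    (is "web_equal ?a ?b ?s (?I1 \<^bold>+ _ \<^bold>* ?H \<^bold>+ _ \<^bold>* ?I0)")
proof -
  let ?t = "?I1 \<^bold>+ (- q_inv) \<^bold>* ?H \<^bold>+ (- cap_coeff j) \<^bold>* ?I0"
  have I1: "nf ?I1 = I_plus (Suc j)"
    by (simp add: web_I_def with_edge_def I_plus_def nf_web sR_def mL_def)
  have H: "nf ?H = H j"
    using j by (simp add: web_H_def with_edge_def H_def nf_web nf_web_arg W_nil_left W_nil_right
        mL_def sR_def)
  have I0: "nf ?I0 = open_right j \<odot> close_left j"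
  proof -
    have "nf ?I0 = nf (split0 (Suc j) 1 j) \<odot> nf (merge0 1 (Suc j) j)"
      using j by (simp add: web_I_def with_edge_def nf_web)
    then show ?thesis by (simp only: split_decreasing_right merge_decreasing close_left_def)
  qed
  have t: "nf ?t = I_plus (Suc j) \<oplus> (- q_inv) \<star> H j \<oplus> (- cap_coeff j) \<star> (open_right j \<odot> close_left j)"
    unfolding I1[symmetric] H[symmetric] I0[symmetric] by (simp add: nf_web) (metis nf_ops nf_web)
  have "hom (I_plus (Suc j)) ?a ?b"
  proof (cases "Suc (Suc j) \<le> n")
    case True
    then show ?thesis
      using hom_cmp[OF hom_vertices(1)[OF True] hom_vertices(4)[OF True]] by (simp add: I_plus_def)
  next
    case False
    then show ?thesis
      using j n_pos by (simp add: I_plus_def hom_def nf_typed source_nf target_nf typed_simps)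
  qed
  moreover have "hom (H j) ?a ?b" by (rule hom_H[OF j])
  moreover have "hom (open_right j \<odot> close_left j) ?a ?b"
      by (rule hom_cmp[OF hom_close_left[OF j] hom_open_right[OF j]])
  ultimately have "hom (nf ?t) ?a ?b"
    unfolding t by (simp add: hom_def typed_ops source_target_ops)
  then have "ty ?t" "source ?t = ?a" "target ?t = ?b"
    by (auto simp: hom_def nf_typed source_nf target_nf)
  moreover have "nf ?s = nf ?t"
    using crossing[OF j] t by (simp add: nf_web)
  ultimately show ?thesis by (metis cat_eq.sym nf_web_equal)
qed

end

section \<open>Webs with crossings\<close>

lemma web_in_mono: "web_in K n t a b \<Longrightarrow> (K \<Longrightarrow> K') \<Longrightarrow> web_in K' n t a b"
  by (induction rule: web_in.induct) (auto simp del: One_nat_def intro: web_in.intros)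

text \<open>An equality of flat webs is an equality of webs with crossings.\<close>

lemma cat_eq_mono:
  assumes "cat_eq K n R a b s t" "K \<Longrightarrow> K'" "\<And>a b s t. R a b s t \<Longrightarrow> R' a b s t"
  shows "cat_eq K' n R' a b s t"
  using assms(1)
proof induction
  case (relation a b s t)
  then show ?case by (intro cat_eq.relation assms(3))
next
  case (sym a b s t)
  show ?case using sym.IH by (rule cat_eq.sym)
next
  case (trans a b s t u)
  show ?case using trans.IH by (rule cat_eq.trans)
qed (blast intro: cat_eq.intros(2,5-) web_in_mono assms(2))+

lemma web_eq_imp_tangle_eq: "web_eq n q a b s t \<Longrightarrow> tangle_eq n q a b s t"
  unfolding web_eq_def tangle_eq_def by (erule cat_eq_mono) auto

text \<open>The crossing and \<open>beta\<close> obey the same recursion.\<close>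

lemma cross_under_eq_beta:
  assumes "1 \<le> n" "Suc j \<le> n"
  shows "tangle_eq n q [1, Suc j] [Suc j, 1] (Cross Under 1 (Suc j)) (beta n q (Suc j))"
  using assms(2)
proof (induction j)
  case 0
  then show ?case
    using cross_rel.under_1_1[of n q] unfolding tangle_eq_def by (auto intro: cat_eq.relation)
next
  case (Suc j)
  let ?k = "Suc j"
  let ?eq = "cat_eq True n (\<lambda>a b s t. web_rel n q a b s t \<or> cross_rel n q a b s t)"
  have IH: "?eq [1, ?k] [?k, 1] (Cross Under 1 ?k) (beta n q ?k)"
    using Suc.IH Suc.prems unfolding tangle_eq_def by simp
  have b1: "?eq [1, 1] [1, 1] (Cross Under 1 1) (beta1 n q)"
    using cross_rel.under_1_1 by (auto intro: cat_eq.relation)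
  have "admissible n 1 ?k (Suc ?k)" using admissible_vertex(1)[of ?k n] Suc.prems by simp
  then have vertex: "?eq [1, ?k] [Suc ?k] (Merge 1 ?k (Suc ?k)) (Merge 1 ?k (Suc ?k))"
    "?eq [Suc ?k] [1, ?k] (Split 1 ?k (Suc ?k)) (Split 1 ?k (Suc ?k))"
    by (auto intro: cat_eq.refl web_in.intros)
  have strand: "?eq [i] [i] (Strands [i]) (Strands [i])" if "1 \<le> i" "i \<le> n" for i
    using that by (intro cat_eq.refl web_in.intros) auto
  have "?eq [1, Suc ?k] [Suc ?k, 1] (Cross Under 1 (Suc ?k))
     (unit_inv (qint q (?k + 1)) \<^bold>*
       ((Merge 1 ?k (?k + 1) \<^bold>\<otimes> Strands [1]) \<^bold>\<circ> (Strands [1] \<^bold>\<otimes> Cross Under 1 ?k)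
         \<^bold>\<circ> (Cross Under 1 1 \<^bold>\<otimes> Strands [?k]) \<^bold>\<circ> (Strands [1] \<^bold>\<otimes> Split 1 ?k (?k + 1))))"
    using cross_rel.under_1_Suc[of ?k n q] Suc.prems by (intro cat_eq.relation) simp
  moreover have "?eq [1, Suc ?k] [Suc ?k, 1] \<dots> (beta n q (Suc ?k))"
  proof -
    have "?eq ([1] @ [Suc ?k]) ([1] @ [1, ?k]) (Strands [1] \<^bold>\<otimes> Split 1 ?k (Suc ?k)) (Strands [1]
        \<^bold>\<otimes> Split 1 ?k (Suc ?k))"
      using strand[of 1] assms(1) vertex by (intro cat_eq.tens_cong) auto
    moreover have "?eq ([1, 1] @ [?k]) ([1, 1] @ [?k]) (Cross Under 1 1 \<^bold>\<otimes> Strands [?k]) (beta1 n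
        q \<^bold>\<otimes> Strands [?k])"
      using b1 strand[of ?k] Suc.prems by (intro cat_eq.tens_cong) auto
    moreover have "?eq ([1] @ [1, ?k]) ([1] @ [?k, 1]) (Strands [1] \<^bold>\<otimes> Cross Under 1 ?k) (Strands
        [1] \<^bold>\<otimes> beta n q ?k)"
      using strand[of 1] assms(1) IH by (intro cat_eq.tens_cong) auto
    moreover have "?eq ([1, ?k] @ [1]) ([Suc ?k] @ [1]) (Merge 1 ?k (Suc ?k) \<^bold>\<otimes> Strands [1])
        (Merge 1 ?k (Suc ?k) \<^bold>\<otimes> Strands [1])"
      using strand[of 1] assms(1) vertex by (intro cat_eq.tens_cong) auto
    ultimately show ?thesis
      by (simp add: Let_def) (intro cat_eq.scale_cong cat_eq.comp_cong; assumption)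
  qed
  ultimately show ?case unfolding tangle_eq_def by (rule cat_eq.trans)
qed

theorem theorem1p2:
  fixes n k :: nat and q :: "'r::idom"
  assumes "1 \<le> n"
    and "q dvd 1"
    and "\<And>j. j \<in> {1..n} \<Longrightarrow> qint q j dvd 1"
    and "1 \<le> k" and "k \<le> n"
  shows "web_eq n q [1, k] [k, 1]
           ((- 1) ^ k \<^bold>* beta n q k)
           (web_I n k (k + 1) \<^bold>+ (- qpow q (- 1)) \<^bold>* web_H n k (k - 1)
             \<^bold>+ (- (qpow q (int n - int k + 1) * unit_inv (qint q (n - k + 1)))) \<^bold>* web_I n k (k - 1))
       \<and> (\<forall>(X :: 'a topology) A. oriented_surface X A \<longrightarrow>
            holds_locally n q X A
              ((- 1) ^ k \<^bold>* Cross Under 1 k)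
              (web_I n k (k + 1) \<^bold>+ (- qpow q (- 1)) \<^bold>* web_H n k (k - 1)
                \<^bold>+ (- (qpow q (int n - int k + 1) * unit_inv (qint q (n - k + 1)))) \<^bold>* web_I n k (k - 1)))"
    (is "web_eq n q ?a ?b ?s ?t \<and> _")
proof
  interpret sp_webs n q using assms by unfold_locales
  obtain j where j: "k = Suc j" using assms(4) by (cases k) auto
  have "int n - int k + 1 = int (n - j)" "n - k + 1 = n - j" using j assms(5) by auto
  then have "qpow q (int n - int k + 1) * unit_inv (qint q (n - k + 1)) = cap_coeff j"
    by (simp only: cap_coeff_def inv_qint_def qpow_of_nat)
  moreover have "qpow q (- 1) = q_inv"
    using qpow_minus_of_nat[OF q_unit, of 1] by (simp add: q_inv_def)
  ultimately show flat: "web_eq n q ?a ?b ?s ?t"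
    using crossing_web_equal[of j] j assms(5) unfolding web_eq_def by (simp flip: Suc_eq_plus1)
  show "\<forall>(X :: 'a topology) A. oriented_surface X A \<longrightarrow>
      holds_locally n q X A ((- 1) ^ k \<^bold>* Cross Under 1 k) ?t"
  proof -
    have "tangle_eq n q ?a ?b ((- 1) ^ k \<^bold>* Cross Under 1 k) ?s"
      using cross_under_eq_beta[of n j q] j assms(1,5) unfolding tangle_eq_def
      by (intro cat_eq.scale_cong) simp
    then have "tangle_eq n q ?a ?b ((- 1) ^ k \<^bold>* Cross Under 1 k) ?t"
      using web_eq_imp_tangle_eq[OF flat] unfolding tangle_eq_def by (rule cat_eq.trans)
    then show ?thesis
      unfolding holds_locally_def by (blast intro: skein_null.local_relation)
  qed
qed

end
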